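(* Let $\mathcal{G}\subset\mathbb{R}^N$ be a mutually consistent, maximal set of stationary solutions. Let $\mathbf{u}=(u^k)_{k\in\mathcal{I}}$ and $\mathbf{v}=(v^k)_{k\in\mathcal{I}}$ be entropy solutions with respect to $\mathcal{G}$ of $$u^k_t+f^k(u^k)_x=0\quad\text{for }x\in D^k,\ k\in\mathcal{I},$$ with initial data $\bar{\mathbf{u}},\bar{\mathbf{v}}\in L^\infty_{\mathrm{oco}}(\mathcal{G})\cap L^1(\Omega;\lambda)$ respectively, and assume that each of the functions $u^k,v^k$ ($k\in\mathcal{I}$) has a strong trace at $x=0$. Then $$\sum_{k\in\mathcal{I}}\big\|u^k(t)-v^k(t)\big\|_{L^1(D^k)}\leq\sum_{k\in\mathcal{I}}\big\|\bar u^k-\bar v^k\big\|_{L^1(D^k)}$$ for every $t>0$. In particular, there exists at most one entropy solution for given initial data.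
   Context: **Network.** Fix integers $N_{\mathrm{in}},N_{\mathrm{out}}\geq1$, $N=N_{\mathrm{in}}+N_{\mathrm{out}}$, index sets $\mathcal{I}_{\mathrm{in}}=\{-N_{\mathrm{in}},\dots,-1\}$, $\mathcal{I}_{\mathrm{out}}=\{1,\dots,N_{\mathrm{out}}\}$, $\mathcal{I}=\mathcal{I}_{\mathrm{in}}\cup\mathcal{I}_{\mathrm{out}}$. Edges: $D^k=(-\infty,0)$ for $k\in\mathcal{I}_{\mathrm{in}}$, $D^k=(0,\infty)$ for $k\in\mathcal{I}_{\mathrm{out}}$; the single vertex is at $x=0$. Fluxes $f^k:\mathbb{R}\to\mathbb{R}$ ($k\in\mathcal{I}$) are continuous. $\Omega=\bigcup_{k\in\mathcal{I}}D^k\times\{k\}$ with $\lambda=$ (Lebesgue measure)$\times$(counting measure), so $\int_\Omega\mathbf{u}\,d\lambda=\sum_{k}\int_{D^k}u^k\,dx$; functions on $\Omega$ are written $\mathbf{u}=(u^k)_{k\in\mathcal{I}}$. **Stationary solutions.** Vectors $\mathbf{c}=(c^k)_{k\in\mathcal{I}}\in\mathbb{R}^N$ with $\sum_{k\in\mathcal{I}_{\mathrm{in}}}f^k(c^k)=\sum_{k\in\mathcal{I}_{\mathrm{out}}}f^k(c^k)$. **Kruzkov pairs.** $\eta_c(u)=|u-c|$, $q^k_c(u)=\operatorname{sgn}(u-c)(f^k(u)-f^k(c))$. **Mutual consistency, maximality.** A set $\mathcal{G}\subset\mathbb{R}^N$ of stationary solutions is mutually consistent if $\sum_{k\in\mathcal{I}_{\mathrm{in}}}q^k_{c^k}(\tilde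 c^k)\geq\sum_{k\in\mathcal{I}_{\mathrm{out}}}q^k_{c^k}(\tilde c^k)$ for all $\mathbf{c},\tilde{\mathbf{c}}\in\mathcal{G}$. A mutually consistent set $\mathcal{G}$ is maximal if no mutually consistent set of stationary solutions has $\mathcal{G}$ as a strict subset. **Initial data class.** With $\pi^k(\mathbf{c})=c^k$, $L^\infty_{\mathrm{oco}}(\mathcal{G})$ is the set of $\mathbf{u}\in L^\infty(\Omega;\lambda)$ for which there exist $\mathbf{c},\mathbf{d}\in\mathcal{G}$ such that $[c^k,d^k]\subset\pi^k(\mathcal{G})$ for all $k\in\mathcal{I}$, $c^k\leq u^k(x)\leq d^k$ for (a.e.) $x\in D^k$ and all $k\in\mathcal{I}$, and $c^k\leq d^l$ for all $k,l\in\mathcal{I}$. **Entropy solution.** $\mathbf{u}\in L^\infty(\mathbb{R}_+;L^\infty(\Omega;\lambda))$ is an entropy solution with respect to a mutually consistent set $\mathcal{G}$ with initial data $\bar{\mathbf{u}}$ if $$\sum_{k\in\mathcal{I}}\int_0^\infty\!\!\int_{D^k}\eta_{c^k}(u^k)\varphi^k_t+q^k_{c^k}(u^k)\varphi^k_x\,dx\,dt+\sum_{k\in\mathcal{I}}\int_{D^k}\eta_{c^k}(\bar u^k(x))\varphi^k(x,0)\,dx\geq0$$ for every $\mathbf{c}\in\mathcal{G}$ and all $0\leq\varphi^k\in C_c^\infty(\overline{D^k}\times[0,\infty))$ with $\varphi^k(0,t)=\varphi^1(0,t)$ for all $k\in\mathcal{I}$, $t\ge 0$. **Strong trace.** A function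 $g\in L^\infty(D^k\times\mathbb{R}_+)$ has a strong trace at $x=0$ if there is $g(0,\cdot)\in L^\infty(\mathbb{R}_+)$ with $\operatorname{ess\,lim}_{x\to0,\,x\in D^k}\int_0^T|g(x,t)-g(0,t)|\,dt=0$ for every $T>0$.
   Formalization: Solutions are classes up to null sets of times, so "for every t>0" fails for arbitrary representatives; the bound is proved for almost every t>0, and for every t>0 at which u and v both equal their essential L^1_loc limit in time. *)

theory Defs
  imports "HOL-Analysis.Analysis"
begin

text \<open>
  Points of the space-time domain are pairs \<open>(x, t)\<close>, and a function on the network is a
  family indexed by edge labels \<open>k\<close>; only labels in the index set matter. Elements of Lebesgue
  spaces are represented by Lebesgue measurable functions.
\<close>

definition idx_in :: "nat \<Rightarrow> int set" where
  "idx_in Nin = {- int Nin..-1}"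

definition idx_out :: "nat \<Rightarrow> int set" where
  "idx_out Nout = {1..int Nout}"

definition idx :: "nat \<Rightarrow> nat \<Rightarrow> int set" where
  "idx Nin Nout = idx_in Nin \<union> idx_out Nout"

definition edge :: "int \<Rightarrow> real set" where
  "edge k = (if k < 0 then {..<0} else {0<..})"

text \<open>
  Vectors in \<open>\<real>\<^sup>N\<close> are functions on labels that are \<open>undefined\<close> off the index set
  (\<^const>\<open>extensional\<close>), so that equality and strict inclusion of sets of vectors have
  their usual meaning.
\<close>

definition stationary :: "nat \<Rightarrow> nat \<Rightarrow> (int \<Rightarrow> real \<Rightarrow> real) \<Rightarrow> (int \<Rightarrow> real) set" where
  "stationary Nin Nout f =
    {c \<in> extensional (idx Nin Nout).
      (\<Sum>k\<in>idx_in Nin. f k (c k)) = (\<Sum>k\<in>idx_out Nout. f k (c k))}"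

definition kruzkov_eta :: "real \<Rightarrow> real \<Rightarrow> real" where
  "kruzkov_eta c u = \<bar>u - c\<bar>"

definition kruzkov_flux :: "(real \<Rightarrow> real) \<Rightarrow> real \<Rightarrow> real \<Rightarrow> real" where
  "kruzkov_flux g c u = sgn (u - c) * (g u - g c)"

definition mutually_consistent ::
    "nat \<Rightarrow> nat \<Rightarrow> (int \<Rightarrow> real \<Rightarrow> real) \<Rightarrow> (int \<Rightarrow> real) set \<Rightarrow> bool" where
  "mutually_consistent Nin Nout f G \<longleftrightarrow>
    G \<subseteq> stationary Nin Nout f \<and>
    (\<forall>c\<in>G. \<forall>c'\<in>G.
      (\<Sum>k\<in>idx_in Nin. kruzkov_flux (f k) (c k) (c' k))
        \<ge> (\<Sum>k\<in>idx_out Nout. kruzkov_flux (f k) (c k) (c' k)))"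

definition maximal_consistent ::
    "nat \<Rightarrow> nat \<Rightarrow> (int \<Rightarrow> real \<Rightarrow> real) \<Rightarrow> (int \<Rightarrow> real) set \<Rightarrow> bool" where
  "maximal_consistent Nin Nout f G \<longleftrightarrow>
    mutually_consistent Nin Nout f G \<and>
    \<not> (\<exists>H. mutually_consistent Nin Nout f H \<and> G \<subset> H)"

definition Linf_on :: "'a::euclidean_space set \<Rightarrow> ('a \<Rightarrow> real) \<Rightarrow> bool" where
  "Linf_on S g \<longleftrightarrow>
    g \<in> borel_measurable (lebesgue_on S) \<and> (\<exists>C. AE x in lebesgue_on S. \<bar>g x\<bar> \<le> C)"

definition Linf_oco :: "nat \<Rightarrow> nat \<Rightarrow> (int \<Rightarrow> real) set \<Rightarrow> (int \<Rightarrow> real \<Rightarrow> real) set" where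
  "Linf_oco Nin Nout G =
    {w. (\<forall>k\<in>idx Nin Nout. Linf_on (edge k) (w k)) \<and>
      (\<exists>c\<in>G. \<exists>d\<in>G.
        (\<forall>k\<in>idx Nin Nout. {c k..d k} \<subseteq> (\<lambda>b. b k) ` G) \<and>
        (\<forall>k\<in>idx Nin Nout. AE x in lebesgue_on (edge k). c k \<le> w k x \<and> w k x \<le> d k) \<and>
        (\<forall>k\<in>idx Nin Nout. \<forall>l\<in>idx Nin Nout. c k \<le> d l))}"

text \<open>
  Smoothness up to the boundary of a closed quadrant \<open>S\<close>: \<open>D i j\<close> is the derivative of order
  \<open>i\<close> in \<open>x\<close> and \<open>j\<close> in \<open>t\<close>, one-sided at the boundary; all of them are continuous on \<open>S\<close>.
\<close>

definition smooth_upto :: "(real \<times> real) set \<Rightarrow> (real \<times> real \<Rightarrow> real) \<Rightarrow> bool" where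
  "smooth_upto S \<phi> \<longleftrightarrow>
    (\<exists>D :: nat \<Rightarrow> nat \<Rightarrow> real \<times> real \<Rightarrow> real.
      (\<forall>p\<in>S. D 0 0 p = \<phi> p) \<and>
      (\<forall>i j. continuous_on S (D i j)) \<and>
      (\<forall>i j x t. (x, t) \<in> S \<longrightarrow>
        ((\<lambda>y. D i j (y, t)) has_real_derivative D (Suc i) j (x, t)) (at x within {y. (y, t) \<in> S}) \<and>
        ((\<lambda>s. D i j (x, s)) has_real_derivative D i (Suc j) (x, t)) (at t within {s. (x, s) \<in> S})))"

definition test_function :: "int \<Rightarrow> (real \<times> real \<Rightarrow> real) \<Rightarrow> bool" where
  "test_function k \<phi> \<longleftrightarrow>
    smooth_upto (closure (edge k) \<times> {0..}) \<phi> \<and>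
    (\<exists>K. compact K \<and> (\<forall>p \<in> closure (edge k) \<times> {0..} - K. \<phi> p = 0))"

definition entropy_solution ::
    "nat \<Rightarrow> nat \<Rightarrow> (int \<Rightarrow> real \<Rightarrow> real) \<Rightarrow> (int \<Rightarrow> real) set \<Rightarrow>
      (int \<Rightarrow> real \<Rightarrow> real) \<Rightarrow> (int \<Rightarrow> real \<times> real \<Rightarrow> real) \<Rightarrow> bool" where
  "entropy_solution Nin Nout f G u0 u \<longleftrightarrow>
    (\<forall>k\<in>idx Nin Nout. Linf_on (edge k \<times> {0<..}) (u k)) \<and>
    (\<forall>c\<in>G. \<forall>\<phi>.
      (\<forall>k\<in>idx Nin Nout. test_function k (\<phi> k) \<and> (\<forall>p \<in> closure (edge k) \<times> {0..}. 0 \<le> \<phi> k p)) \<and>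
      (\<forall>k\<in>idx Nin Nout. \<forall>t\<ge>0. \<phi> k (0, t) = \<phi> 1 (0, t)) \<longrightarrow>
      (\<Sum>k\<in>idx Nin Nout.
          LINT (x, t)|lebesgue_on (edge k \<times> {0<..}).
            kruzkov_eta (c k) (u k (x, t)) * deriv (\<lambda>s. \<phi> k (x, s)) t
            + kruzkov_flux (f k) (c k) (u k (x, t)) * deriv (\<lambda>y. \<phi> k (y, t)) x)
        + (\<Sum>k\<in>idx Nin Nout.
            LINT x|lebesgue_on (edge k). kruzkov_eta (c k) (u0 k x) * \<phi> k (x, 0))
        \<ge> 0)"

definition ess_lim :: "(real \<Rightarrow> real) \<Rightarrow> real set \<Rightarrow> real \<Rightarrow> real \<Rightarrow> bool" where
  "ess_lim F S a l \<longleftrightarrow>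
    (\<forall>e>0. \<exists>d>0. AE s in lebesgue_on S. \<bar>s - a\<bar> < d \<longrightarrow> \<bar>F s - l\<bar> < e)"

definition has_strong_trace :: "int \<Rightarrow> (real \<times> real \<Rightarrow> real) \<Rightarrow> bool" where
  "has_strong_trace k g \<longleftrightarrow>
    Linf_on (edge k \<times> {0<..}) g \<and>
    (\<exists>h. Linf_on {0<..} h \<and>
      (\<forall>T>0. ess_lim (\<lambda>x. LINT t|lebesgue_on {0<..<T}. \<bar>g (x, t) - h t\<bar>) (edge k) 0 0))"

text \<open>
  An element of \<open>L\<^sup>\<infinity>(\<real>\<^sub>+; L\<^sup>\<infinity>(\<Omega>))\<close> has no value at an individual time unless a
  representative is singled out. The following says that the chosen representative takes at
  time \<open>t\<close> the value prescribed by its equivalence class, namely the essential limit of \<open>u(s)\<close>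
  in \<open>L\<^sup>1\<close>-loc as \<open>s\<close> tends to \<open>t\<close>; it holds at every \<open>t > 0\<close> for a representative that is
  continuous from \<open>(0, \<infinity>)\<close> into \<open>L\<^sup>1\<close>-loc.
\<close>

definition time_value_attained ::
    "nat \<Rightarrow> nat \<Rightarrow> (int \<Rightarrow> real \<times> real \<Rightarrow> real) \<Rightarrow> real \<Rightarrow> bool" where
  "time_value_attained Nin Nout u t \<longleftrightarrow>
    (\<forall>k\<in>idx Nin Nout. \<forall>R>0.
      integrable (lebesgue_on (edge k \<inter> {-R..R})) (\<lambda>x. u k (x, t)) \<and>
      ess_lim (\<lambda>s. LINT x|lebesgue_on (edge k \<inter> {-R..R}). \<bar>u k (x, s) - u k (x, t)\<bar>) {0<..} t 0)"

text \<open>The \<open>L\<^sup>1\<close> norm, with value \<open>\<infinity>\<close> for functions that are not integrable.\<close>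

definition L1_norm :: "real set \<Rightarrow> (real \<Rightarrow> real) \<Rightarrow> ennreal" where
  "L1_norm S g = (\<integral>\<^sup>+x. ennreal \<bar>g x\<bar> \<partial>lebesgue_on S)"

end

theory Submission imports Defs begin

text \<open>
  Fix the data \<open>u0\<close> between \<open>c, d \<in> G\<close>. Adding the entropy inequalities for \<open>c\<close> and \<open>d\<close>
  shows that \<open>u\<close> stays between \<open>c\<close> and \<open>d\<close>, so on each edge all values of \<open>v\<close> are admissible
  Kruzkov constants for \<open>u\<close> and vice versa; doubling of variables gives the Kato inequality away
  from the vertex. Letting test functions concentrate at the vertex, the traces of \<open>u\<close> satisfy
  the entropy inequality against every element of \<open>G\<close>, and the Rankine-Hugoniot condition because
  they lie between \<open>c\<close> and \<open>d\<close>; by maximality they belong to \<open>G\<close>. Mutual consistency then gives the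
  vertex terms in the Kato inequality for \<open>u - v\<close> the good sign. The fluxes are merely continuous,
  so there is no finite speed of propagation; in one space dimension a cutoff at \<open>\<bar>x\<bar> \<approx> R\<close> still
  costs only a bounded amount, which yields integrability of \<open>u - v\<close> and then lets \<open>R \<rightarrow> \<infinity>\<close>.
\<close>

section \<open>Smooth functions of one variable\<close>

text \<open>Two obstacles shape the work. Doubling of variables and the trace argument want
  inequalities for single values and for all elements of \<open>G\<close>, whereas solutions are
  given almost everywhere. So they are replaced by Borel functions lying between \<open>c\<close>
  and \<open>d\<close> at every point, whose values are admissible constants without exceptional
  set; and the trace inequalities, each valid off its own null set, are collected over a countable
  dense subset of \<open>G\<close> and extended by continuity. The other obstacle is the missing
  Lipschitz bound: a cutoff is affordable because the derivative of \<open>cutoff R\<close> has L1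
  norm at most 2 at every scale. For a trace g the ordering c \<le> g \<le> d removes the signs in
  the Kruzkov fluxes: the signed sums of f(g) - f(c) and of f(d) - f(g) are both nonpositive, and
  stationarity of \<open>c\<close> and \<open>d\<close> makes the signed sum of f(g) zero. Test
  functions are products \<psi>(x) \<theta>(t) of functions on the whole line. Solutions are
  continued to negative times, constant in time and without flux, so the initial data need no
  separate term.\<close>

definition smooth_fun :: "(real \<Rightarrow> real) \<Rightarrow> bool" where
  "smooth_fun g \<longleftrightarrow> (\<forall>n x. ((deriv ^^ n) g has_real_derivative (deriv ^^ Suc n) g x) (at x))"

text \<open>Derivatives are unique, so the derivative supplied by \<open>closed\<close> is
  \<open>deriv g\<close> and all iterates of \<open>deriv\<close> stay in \<open>F\<close>.
  Smoothness thus needs only a family closed under differentiation, never a formula for the n-th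
  derivative.\<close>

lemma smooth_fun_coinduct:
  assumes g: "g \<in> F"
    and closed: "\<And>g. g \<in> F \<Longrightarrow> \<exists>g'\<in>F. \<forall>x. (g has_real_derivative g' x) (at x)"
  shows "smooth_fun g"
proof -
  have step: "deriv h \<in> F \<and> (\<forall>x. (h has_real_derivative deriv h x) (at x))" if "h \<in> F" for h
  proof -
    obtain h' where h': "h' \<in> F" "\<forall>x. (h has_real_derivative h' x) (at x)"
      using closed[OF \<open>h \<in> F\<close>] by blast
    then have "deriv h = h'"
      by (auto intro!: ext DERIV_imp_deriv)
    with h' show ?thesis by simp
  qed
  have "(deriv ^^ n) g \<in> F" for n
    by (induction n) (use g step in auto)
  with step show ?thesis
    by (auto simp: smooth_fun_def)
qed

lemma smooth_fun_has_deriv: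
  assumes "smooth_fun g"
  shows "(g has_real_derivative deriv g x) (at x)"
  using assms unfolding smooth_fun_def by (metis funpow_0 funpow_simps_right(1) comp_apply funpow.simps id_apply)

lemma smooth_fun_deriv:
  assumes "smooth_fun g"
  shows "smooth_fun (deriv g)"
  unfolding smooth_fun_def
proof (intro allI)
  fix n x
  show "((deriv ^^ n) (deriv g) has_real_derivative (deriv ^^ Suc n) (deriv g) x) (at x)"
    using assms unfolding smooth_fun_def
    by (metis (no_types, lifting) comp_apply funpow_Suc_right)
qed

lemma smooth_fun_continuous: "smooth_fun g \<Longrightarrow> continuous_on S g"
  by (meson DERIV_continuous_on smooth_fun_has_deriv has_field_derivative_at_within)

lemma smooth_fun_measurable [measurable_dest]: "smooth_fun g \<Longrightarrow> g \<in> borel_measurable borel"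
  by (intro borel_measurable_continuous_onI smooth_fun_continuous)

lemma smooth_fun_measurable_deriv: "smooth_fun g \<Longrightarrow> deriv g \<in> borel_measurable borel"
  by (intro smooth_fun_measurable smooth_fun_deriv)

lemma smooth_fun_const: "smooth_fun (\<lambda>x. c)"
  by (rule smooth_fun_coinduct[where F = "range (\<lambda>c x. c)"]) (auto intro!: derivative_eq_intros bexI[of _ "\<lambda>_. 0"])

text \<open>The outer factor \<open>m\<close> belongs to the family because each differentiation
  brings out another factor \<open>a\<close>.\<close>

lemma smooth_fun_affine:
  assumes "smooth_fun g"
  shows "smooth_fun (\<lambda>x. m * g (a * x + b))"
proof (rule smooth_fun_coinduct[where F = "{\<lambda>x. m * h (a * x + b) | h m. smooth_fun h}"])
  show "(\<lambda>x. m * g (a * x + b)) \<in> {\<lambda>x. m * h (a * x + b) | h m. smooth_fun h}"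
    using assms by auto
next
  fix k assume "k \<in> {\<lambda>x. m * h (a * x + b) | h m. smooth_fun h}"
  then obtain h m where k: "k = (\<lambda>x. m * h (a * x + b))" "smooth_fun h" by auto
  have "(k has_real_derivative (m * a) * deriv h (a * x + b)) (at x)" for x
  proof -
    have "((\<lambda>x. a * x + b) has_real_derivative a) (at x)"
      by (auto intro!: derivative_eq_intros)
    from DERIV_cmult[OF DERIV_chain2[OF smooth_fun_has_deriv[OF k(2)] this], of m] show ?thesis
      by (simp add: k(1) algebra_simps)
  qed
  then show "\<exists>g'\<in>{\<lambda>x. m * h (a * x + b) | h m. smooth_fun h}. \<forall>x. (k has_real_derivative g' x) (at x)"
    using smooth_fun_deriv[OF k(2)] by (auto intro!: bexI[of _ "\<lambda>x. (m * a) * deriv h (a * x + b)"])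
qed

text \<open>A class that contains the products and, by the Leibniz rule, also the derivatives of its
  members.\<close>

inductive_set smooth_products :: "(real \<Rightarrow> real) set" where
  mult: "smooth_fun p \<Longrightarrow> smooth_fun q \<Longrightarrow> (\<lambda>x. p x * q x) \<in> smooth_products"
| add: "p \<in> smooth_products \<Longrightarrow> q \<in> smooth_products \<Longrightarrow> (\<lambda>x. p x + q x) \<in> smooth_products"

lemma smooth_products_smooth: "g \<in> smooth_products \<Longrightarrow> smooth_fun g"
proof (rule smooth_fun_coinduct[where F = smooth_products])
  fix g assume "g \<in> smooth_products"
  then show "\<exists>g'\<in>smooth_products. \<forall>x. (g has_real_derivative g' x) (at x)"
  proof induction
    case (mult p q)
    from mult have "(\<lambda>x. p x * deriv q x) \<in> smooth_products" "(\<lambda>x. deriv p x * q x) \<in> smooth_products"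
      by (simp_all only: smooth_products.mult smooth_fun_deriv)
    from smooth_products.add[OF this] mult show ?case
      by (intro bexI[of _ "\<lambda>x. p x * deriv q x + deriv p x * q x"])
        (auto intro!: DERIV_mult' smooth_fun_has_deriv)
  next
    case (add p q)
    then obtain p' q' where "p' \<in> smooth_products" "\<forall>x. (p has_real_derivative p' x) (at x)"
      "q' \<in> smooth_products" "\<forall>x. (q has_real_derivative q' x) (at x)" by auto
    then show ?case
      by (intro bexI[of _ "\<lambda>x. p' x + q' x"]) (auto intro!: DERIV_add smooth_products.intros)
  qed
qed

lemma smooth_fun_mult: "smooth_fun p \<Longrightarrow> smooth_fun q \<Longrightarrow> smooth_fun (\<lambda>x. p x * q x)"
  by (rule smooth_products_smooth[OF smooth_products.mult])

lemma smooth_fun_add: "smooth_fun p \<Longrightarrow> smooth_fun q \<Longrightarrow> smooth_fun (\<lambda>x. p x + q x)"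
proof -
  assume "smooth_fun p" "smooth_fun q"
  then have "(\<lambda>x. p x * 1) \<in> smooth_products" "(\<lambda>x. q x * 1) \<in> smooth_products"
    by (simp_all only: smooth_products.mult smooth_fun_const)
  from smooth_products_smooth[OF smooth_products.add[OF this]] show ?thesis by simp
qed

lemma smooth_fun_cmult: "smooth_fun p \<Longrightarrow> smooth_fun (\<lambda>x. m * p x)"
  using smooth_fun_affine[of p m 1 0] by simp

lemma smooth_fun_diff: "smooth_fun p \<Longrightarrow> smooth_fun q \<Longrightarrow> smooth_fun (\<lambda>x. p x - q x)"
  using smooth_fun_add[of p, OF _ smooth_fun_cmult[of q "-1"]] by simp

subsection \<open>A smooth step\<close>

text \<open>The polynomial in \<open>1 / x\<close> is carried along so that the family is closed
  under differentiation; \<open>p = 1\<close> is the classical function that is flat at 0.\<close>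

definition exp_flat :: "real poly \<Rightarrow> real \<Rightarrow> real" where
  "exp_flat p x = (if x > 0 then poly p (1 / x) * exp (- (1 / x)) else 0)"

lemma poly_exp_tendsto_0: "((\<lambda>y. poly p y * exp (- y)) \<longlongrightarrow> (0::real)) at_top"
proof -
  have "((\<lambda>y. \<Sum>i\<le>degree p. coeff p i * (y ^ i / exp y)) \<longlongrightarrow> (\<Sum>i\<le>degree p. coeff p i * 0)) at_top"
    by (intro tendsto_sum tendsto_mult tendsto_const tendsto_power_div_exp_0)
  then show ?thesis
    by (simp add: poly_altdef sum_distrib_right exp_minus divide_inverse mult.assoc)
qed

lemma exp_flat_tendsto_0: "(exp_flat p \<longlongrightarrow> 0) (at 0)"
proof -
  have "((\<lambda>x. poly p (inverse x) * exp (- inverse x)) \<longlongrightarrow> 0) (at_right 0)"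
    by (rule filterlim_compose[OF poly_exp_tendsto_0 filterlim_inverse_at_top_right])
  then have "(exp_flat p \<longlongrightarrow> 0) (at_right 0)"
    by (rule Lim_transform_eventually)
      (auto simp: eventually_at_filter exp_flat_def divide_inverse)
  moreover have "(exp_flat p \<longlongrightarrow> 0) (at_left 0)"
    by (rule Lim_transform_eventually[OF tendsto_const])
      (auto simp: eventually_at_filter exp_flat_def)
  ultimately show ?thesis
    by (simp add: filterlim_split_at)
qed

text \<open>With y = 1/x one has dy/dx = - y^2, and the y-derivative of p(y) exp(-y) is (p' - p)(y)
  exp(-y). The product of the two is the new member of the family; \<open>[:0, 0, 1:]\<close> is
  y^2.\<close>

lemma exp_flat_has_deriv:
  "(exp_flat p has_real_derivative exp_flat ([:0, 0, 1:] * (p - pderiv p)) x) (at x)"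
proof (cases x "0::real" rule: linorder_cases)
  case less
  have "((\<lambda>_. 0) has_real_derivative 0) (at x)" by simp
  then have "(exp_flat p has_real_derivative 0) (at x)"
    by (rule has_field_derivative_transform_within_open[where S = "{..<0}"]) (use less in \<open>auto simp: exp_flat_def\<close>)
  then show ?thesis using less by (simp add: exp_flat_def)
next
  case greater
  have "((\<lambda>x. poly p (1 / x) * exp (- (1 / x))) has_real_derivative
      poly ([:0, 0, 1:] * (p - pderiv p)) (1 / x) * exp (- (1 / x))) (at x)"
    using greater
    by (auto intro!: derivative_eq_intros DERIV_chain'[OF _ poly_DERIV] simp: field_simps power2_eq_square)
  then have "(exp_flat p has_real_derivative
      poly ([:0, 0, 1:] * (p - pderiv p)) (1 / x) * exp (- (1 / x))) (at x)"
    by (rule has_field_derivative_transform_within_open[where S = "{0<..}"]) (use greater in \<open>auto simp: exp_flat_def\<close>)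
  then show ?thesis using greater by (simp add: exp_flat_def)
next
  case equal
  \<comment> \<open>The difference quotient at 0 is itself in the family, for the polynomial y p(y),
    and so tends to 0.\<close>
  have "((\<lambda>h. exp_flat ([:0, 1:] * p) h) \<longlongrightarrow> 0) (at 0)" by (rule exp_flat_tendsto_0)
  then have "((\<lambda>h. (exp_flat p (0 + h) - exp_flat p 0) / h) \<longlongrightarrow> 0) (at 0)"
    by (rule Lim_transform_eventually)
      (auto simp: exp_flat_def eventually_at_filter)
  then show ?thesis
    by (simp add: equal DERIV_def exp_flat_def)
qed

lemma exp_flat_smooth: "smooth_fun (exp_flat p)"
  by (rule smooth_fun_coinduct[where F = "range exp_flat"]) (use exp_flat_has_deriv in blast)+

definition bump :: "real \<Rightarrow> real" where
  "bump x = exp_flat 1 (x - 1) * exp_flat 1 (2 - x)"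

lemma bump_smooth: "smooth_fun bump"
  using smooth_fun_mult[OF smooth_fun_affine[OF exp_flat_smooth[of 1], of 1 1 "-1"]
      smooth_fun_affine[OF exp_flat_smooth[of 1], of 1 "-1" 2]]
  by (simp add: bump_def[abs_def])

lemma bump_nonneg: "bump x \<ge> 0"
  by (simp add: bump_def exp_flat_def)

lemma bump_pos: "1 < x \<Longrightarrow> x < 2 \<Longrightarrow> bump x > 0"
  by (simp add: bump_def exp_flat_def)

lemma bump_eq_0: "x \<le> 1 \<or> x \<ge> 2 \<Longrightarrow> bump x = 0"
  by (auto simp: bump_def exp_flat_def)

text \<open>The transition sits in [1, 2] rather than around 0. Rescaled copies and their
  derivatives therefore vanish near the origin: averages look to one side only, and functions cut
  off at the vertex have compact support inside an open edge. For negative \<open>x\<close> the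
  interval of integration is empty and the value 0.\<close>

definition smooth_step :: "real \<Rightarrow> real" where
  "smooth_step x = integral {0..x} bump / integral {0..2} bump"

lemma bump_integrable_on: "bump integrable_on {a..b}"
  by (intro integrable_continuous_real smooth_fun_continuous bump_smooth)

lemma bump_integral_pos: "integral {0..2} bump > 0"
proof -
  have "integral {0..2} bump \<ge> 0"
    by (intro integral_nonneg bump_integrable_on bump_nonneg)
  moreover have "integral {0..2} bump \<noteq> 0"
  proof
    assume "integral {0..2} bump = 0"
    then have "bump (3/2) = 0"
      using has_integral_0_cbox_imp_0[of 0 "2::real" bump "3/2"] bump_integrable_on[of 0 2]
        smooth_fun_continuous[OF bump_smooth] bump_nonneg
      by (auto simp: has_integral_iff box_real)
    with bump_pos[of "3/2"] show False by simp
  qed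
  ultimately show ?thesis by simp
qed

lemma smooth_step_le_1: "x \<le> 1 \<Longrightarrow> smooth_step x = 0"
proof -
  assume "x \<le> 1"
  then have "integral {0..x} bump = integral {0..x} (\<lambda>_. 0)"
    by (intro integral_cong) (auto simp: bump_eq_0)
  then show ?thesis by (simp add: smooth_step_def)
qed

lemma smooth_step_ge_2: "x \<ge> 2 \<Longrightarrow> smooth_step x = 1"
proof -
  assume x: "x \<ge> 2"
  have "integral {2..x} bump = integral {2..x} (\<lambda>_. 0)"
    by (intro integral_cong) (auto simp: bump_eq_0)
  then have "integral {0..x} bump = integral {0..2} bump"
    using Henstock_Kurzweil_Integration.integral_combine[of 0 2 x bump] x bump_integrable_on by simp
  then show ?thesis using bump_integral_pos by (simp add: smooth_step_def)
qed

lemma smooth_step_has_deriv: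
  "(smooth_step has_real_derivative bump x / integral {0..2} bump) (at x)"
proof (cases "x < 1")
  case True
  have "((\<lambda>_. 0) has_real_derivative 0) (at x)" by simp
  then have "(smooth_step has_real_derivative 0) (at x)"
    by (rule has_field_derivative_transform_within_open[where S = "{..<1}"]) (use True in \<open>auto simp: smooth_step_le_1\<close>)
  then show ?thesis using True by (simp add: bump_eq_0)
next
  case False
  have "((\<lambda>x. integral {0..x} bump) has_real_derivative bump x) (at x within {0..x + 1})"
    using False by (intro integral_has_real_derivative smooth_fun_continuous bump_smooth) auto
  then have "((\<lambda>x. integral {0..x} bump) has_real_derivative bump x) (at x)"
    using False at_within_Icc_at[of 0 x "x + 1"] by simp
  then show ?thesis
    unfolding smooth_step_def[abs_def] by (rule DERIV_cdivide)
qed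

lemma deriv_smooth_step: "deriv smooth_step x = bump x / integral {0..2} bump"
  by (rule DERIV_imp_deriv[OF smooth_step_has_deriv])

lemma smooth_step_smooth: "smooth_fun smooth_step"
proof (rule smooth_fun_coinduct[where F = "insert smooth_step (Collect smooth_fun)"])
  fix g assume g: "g \<in> insert smooth_step (Collect smooth_fun)"
  show "\<exists>g'\<in>insert smooth_step (Collect smooth_fun). \<forall>x. (g has_real_derivative g' x) (at x)"
  proof (cases "g = smooth_step")
    case True
    then show ?thesis
      using smooth_step_has_deriv smooth_fun_cmult[OF bump_smooth, of "1 / integral {0..2} bump"]
      by (intro bexI[of _ "\<lambda>x. bump x / integral {0..2} bump"]) auto
  next
    case False
    with g show ?thesis
      by (intro bexI[of _ "deriv g"]) (auto intro: smooth_fun_deriv smooth_fun_has_deriv)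
  qed
qed simp

lemma deriv_smooth_step_nonneg: "deriv smooth_step x \<ge> 0"
  using bump_nonneg bump_integral_pos by (simp add: deriv_smooth_step less_imp_le)

lemma deriv_smooth_step_eq_0: "x \<le> 1 \<or> x \<ge> 2 \<Longrightarrow> deriv smooth_step x = 0"
  using bump_eq_0 by (auto simp: deriv_smooth_step)

lemma smooth_step_mono: "x \<le> y \<Longrightarrow> smooth_step x \<le> smooth_step y"
  using smooth_step_has_deriv deriv_smooth_step_nonneg
  by (metis DERIV_nonneg_imp_nondecreasing deriv_smooth_step)

lemma smooth_step_nonneg: "0 \<le> smooth_step x"
  using smooth_step_mono[of "min x 1" x] by (simp add: smooth_step_le_1)

lemma smooth_step_upper: "smooth_step x \<le> 1"
  using smooth_step_mono[of x "max x 2"] by (simp add: smooth_step_ge_2)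

lemma smooth_fun_bounded_on:
  assumes "smooth_fun g" "compact S"
  obtains B where "B > 0" "\<And>x. x \<in> S \<Longrightarrow> \<bar>g x\<bar> \<le> B"
proof -
  have "compact (g ` S)"
    using assms by (intro compact_continuous_image smooth_fun_continuous)
  then obtain B where "B > 0" "\<And>y. y \<in> g ` S \<Longrightarrow> norm y \<le> B"
    by (meson bounded_pos compact_imp_bounded)
  then show ?thesis by (intro that[of B]) auto
qed

section \<open>Measure-theoretic preliminaries\<close>

text \<open>
  Fluxes are only continuous. This affine bound is what replaces a Lipschitz estimate.
\<close>

lemma compact_continuous_modulus:
  fixes F :: "'a::metric_space \<Rightarrow> real"
  assumes "compact K" "continuous_on K F" "0 < e"
  obtains C where "C \<ge> 0" "\<And>p q. p \<in> K \<Longrightarrow> q \<in> K \<Longrightarrow> \<bar>F p - F q\<bar> \<le> e + C * dist p q"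
proof -
  obtain d where d: "d > 0" "\<And>p q. p \<in> K \<Longrightarrow> q \<in> K \<Longrightarrow> dist q p < d \<Longrightarrow> dist (F q) (F p) < e"
    using compact_uniformly_continuous[OF assms(2,1)] \<open>0 < e\<close>
    unfolding uniformly_continuous_on_def by meson
  have "compact (F ` K)" by (rule compact_continuous_image[OF assms(2,1)])
  then obtain B where B: "B > 0" "\<And>y. y \<in> F ` K \<Longrightarrow> norm y \<le> B"
    by (meson bounded_pos compact_imp_bounded)
  \<comment> \<open>Below distance \<open>d\<close> uniform continuity gives \<open>e\<close>;
    beyond it the trivial bound \<open>2 * B\<close> is absorbed by the linear term, which fixes the
    slope \<open>2 * B / d\<close>.\<close>
  have "\<bar>F p - F q\<bar> \<le> e + (2 * B / d) * dist p q" if "p \<in> K" "q \<in> K" for p q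
  proof (cases "dist q p < d")
    case True
    then have "\<bar>F p - F q\<bar> < e" using d(2)[OF that] by (simp add: dist_real_def abs_minus_commute)
    also have "\<dots> \<le> e + (2 * B / d) * dist p q" using B(1) d(1) by simp
    finally show ?thesis by simp
  next
    case False
    have "\<bar>F p - F q\<bar> \<le> 2 * B" using B(2)[of "F p"] B(2)[of "F q"] that by auto
    also have "\<dots> = (2 * B / d) * d" using d(1) by simp
    also have "\<dots> \<le> (2 * B / d) * dist p q"
      using False B(1) d(1) by (intro mult_left_mono) (auto simp: dist_commute)
    also have "\<dots> \<le> e + \<dots>" using \<open>0 < e\<close> by simp
    finally show ?thesis .
  qed
  with B(1) d(1) show ?thesis by (intro that[of "2 * B / d"]) auto
qed

section \<open>Translation invariance, and integrability of bounded functions with bounded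
  support\<close>

lemma lborel_distr_uminus_euclidean: "distr lborel borel uminus = (lborel :: 'a::euclidean_space measure)"
  by (subst lborel_affine[of "-1" 0]) (auto simp: density_1)

lemma nn_integral_lborel_plus:
  fixes f :: "'a::euclidean_space \<Rightarrow> ennreal"
  assumes [measurable]: "f \<in> borel_measurable borel"
  shows "(\<integral>\<^sup>+x. f (c + x) \<partial>lborel) = (\<integral>\<^sup>+x. f x \<partial>lborel)"
  by (subst (2) lborel_distr_plus[of c, symmetric]) (simp add: nn_integral_distr)

lemma nn_integral_lborel_minus:
  fixes f :: "'a::euclidean_space \<Rightarrow> ennreal"
  assumes [measurable]: "f \<in> borel_measurable borel"
  shows "(\<integral>\<^sup>+x. f (c - x) \<partial>lborel) = (\<integral>\<^sup>+x. f x \<partial>lborel)"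
proof -
  have "(\<integral>\<^sup>+x. f (c - x) \<partial>lborel) = (\<integral>\<^sup>+x. (\<lambda>y. f (c + y)) (- x) \<partial>lborel)" by simp
  also have "\<dots> = (\<integral>\<^sup>+x. f (c + x) \<partial>distr lborel borel uminus)"
    by (subst nn_integral_distr) auto
  also have "\<dots> = (\<integral>\<^sup>+x. f x \<partial>lborel)"
    by (simp add: lborel_distr_uminus_euclidean nn_integral_lborel_plus)
  finally show ?thesis .
qed

lemma nn_integral_less_top_bounded:
  fixes f :: "'a::euclidean_space \<Rightarrow> real"
  assumes "\<And>x. 0 \<le> f x" "\<And>x. f x \<le> C" "\<And>x. x \<notin> B \<Longrightarrow> f x = 0" "bounded B"
  shows "(\<integral>\<^sup>+x. ennreal (f x) \<partial>lborel) < \<infinity>"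
proof -
  from \<open>bounded B\<close> obtain r where r: "B \<subseteq> cball 0 r"
    by (meson bounded_subset_ballD ball_subset_cball order_trans)
  have C: "C \<ge> 0" using assms(1,2)[of undefined] by linarith
  have "(\<integral>\<^sup>+x. ennreal (f x) \<partial>lborel) \<le> (\<integral>\<^sup>+x. ennreal C * indicator (cball (0::'a) r) x \<partial>lborel)"
  proof (rule nn_integral_mono)
    fix x
    have "f x = 0" if "x \<notin> cball 0 r" using that r assms(3) by blast
    then show "ennreal (f x) \<le> ennreal C * indicator (cball (0::'a) r) x"
      using assms(2)[of x] by (auto simp: indicator_def intro: ennreal_leI)
  qed
  also have "\<dots> = ennreal C * emeasure lborel (cball (0::'a) r)"
    by (rule nn_integral_cmult_indicator) simp
  also have "\<dots> < \<infinity>"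
    using emeasure_compact_finite[OF compact_cball, of "0::'a" r] by (simp add: ennreal_mult_less_top)
  finally show ?thesis .
qed

lemma integrable_bounded_support:
  fixes f :: "'a::euclidean_space \<Rightarrow> real"
  assumes "f \<in> borel_measurable borel" "\<And>x. \<bar>f x\<bar> \<le> C" "\<And>x. x \<notin> B \<Longrightarrow> f x = 0" "bounded B"
  shows "integrable lborel f"
  using assms nn_integral_less_top_bounded[of "\<lambda>x. \<bar>f x\<bar>" C B]
  by (auto intro!: integrableI_bounded)

text \<open>A nonintegrable function has Bochner integral 0, so the inequality survives without
  integrability. It lets final estimates be carried out with nonnegative integrals.\<close>

lemma ennreal_integral_le_nn_integral:
  assumes "\<And>x. 0 \<le> f x"
  shows "ennreal (LINT x|M. f x) \<le> (\<integral>\<^sup>+x. ennreal (f x) \<partial>M)"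
  using assms by (cases "integrable M f") (auto simp: nn_integral_eq_integral not_integrable_integral_eq)

text \<open>Measurable functions are almost everywhere limits of continuous ones. Clamping these to
  [-M, M] keeps the limit and provides the dominating function \<open>2 * M\<close> on the bounded
  set \<open>B\<close>.\<close>

lemma continuous_approximation_L1:
  fixes V :: "'a::euclidean_space \<Rightarrow> real"
  assumes [measurable]: "V \<in> borel_measurable borel" and M: "\<And>x. \<bar>V x\<bar> \<le> M"
    and B [measurable]: "B \<in> sets borel" and "bounded B" and "0 < e"
  obtains g where "continuous_on UNIV g" "\<And>x. \<bar>g x\<bar> \<le> M"
    "(\<integral>\<^sup>+x. ennreal (indicator B x * \<bar>V x - g x\<bar>) \<partial>lborel) < ennreal e"
proof -
  have "V measurable_on UNIV"
    by (intro lebesgue_measurable_imp_measurable_on_real) (auto intro: measurable_completion)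
  then obtain N g where N: "negligible N" and g: "\<And>n. continuous_on UNIV (g n)"
    and lim: "\<And>x. x \<notin> N \<Longrightarrow> (\<lambda>n. g n x) \<longlonglongrightarrow> V x"
    unfolding measurable_on_def by auto
  define h where "h n x = max (- M) (min M (g n x))" for n :: nat and x
  have h: "continuous_on UNIV (h n)" for n
    unfolding h_def by (intro continuous_intros g)
  have M0: "M \<ge> 0" using M[of undefined] by linarith
  have hM: "\<bar>h n x\<bar> \<le> M" for n x using M0 by (auto simp: h_def)
  have [measurable]: "h n \<in> borel_measurable borel" for n by (intro borel_measurable_continuous_onI h)
  have ae: "AE x in lborel. x \<notin> N"
    using AE_not_in[of N lebesgue] N by (simp add: negligible_iff_null_sets AE_completion_iff)
  have "(\<lambda>n. \<integral>\<^sup>+x. ennreal (indicator B x * \<bar>V x - h n x\<bar>) \<partial>lborel) \<longlonglongrightarrow> (\<integral>\<^sup>+x. 0 \<partial>(lborel :: 'a measure))"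
  proof (rule nn_integral_dominated_convergence[where w = "\<lambda>x. ennreal (indicator B x * (2 * M))"])
    show "AE x in lborel. ennreal (indicator B x * \<bar>V x - h n x\<bar>) \<le> ennreal (indicator B x * (2 * M))" for n
    proof (intro AE_I2 ennreal_leI mult_left_mono)
      fix x
      show "\<bar>V x - h n x\<bar> \<le> 2 * M" using M[of x] hM[of n x] by linarith
    qed (simp add: indicator_def)
    show "(\<integral>\<^sup>+x. ennreal (indicator B x * (2 * M)) \<partial>lborel) < \<infinity>"
      using M0 \<open>bounded B\<close> by (intro nn_integral_less_top_bounded[of _ "2 * M" B]) (auto simp: indicator_def)
    show "AE x in lborel. (\<lambda>n. ennreal (indicator B x * \<bar>V x - h n x\<bar>)) \<longlonglongrightarrow> 0"
      using ae
    proof eventually_elim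
      case (elim x)
      have "V x = max (- M) (min M (V x))" using M[of x] by auto
      moreover have "(\<lambda>n. h n x) \<longlonglongrightarrow> max (- M) (min M (V x))"
        unfolding h_def by (intro tendsto_max tendsto_min tendsto_const lim elim)
      ultimately have "(\<lambda>n. h n x) \<longlonglongrightarrow> V x" by simp
      then have "(\<lambda>n. indicator B x * \<bar>V x - h n x\<bar>) \<longlonglongrightarrow> indicator B x * \<bar>V x - V x\<bar>"
        by (intro tendsto_intros)
      then show ?case by (subst ennreal_0[symmetric], intro tendsto_ennrealI) simp
    qed
  qed measurable
  then have "(\<lambda>n. \<integral>\<^sup>+x. ennreal (indicator B x * \<bar>V x - h n x\<bar>) \<partial>lborel) \<longlonglongrightarrow> 0" by simp
  then have "\<forall>\<^sub>F n in sequentially. (\<integral>\<^sup>+x. ennreal (indicator B x * \<bar>V x - h n x\<bar>) \<partial>lborel) < ennreal e"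
    using \<open>0 < e\<close> by (intro order_tendstoD(2)) auto
  then obtain n where "(\<integral>\<^sup>+x. ennreal (indicator B x * \<bar>V x - h n x\<bar>) \<partial>lborel) < ennreal e"
    by (auto simp: eventually_sequentially)
  with h hM show ?thesis by (intro that) auto
qed

text \<open>Three errors of size e / 3: a continuous approximation \<open>g\<close> of
  \<open>V\<close> moves little, and \<open>V - g\<close> is small in L1 both before and after the
  translation. The approximation is taken on a ball \<open>B'\<close> one unit larger than a ball
  containing \<open>B\<close>, so that translates by less than 1 stay inside it.\<close>

lemma L1_translation_continuous:
  fixes V :: "'a::euclidean_space \<Rightarrow> real"
  assumes V [measurable]: "V \<in> borel_measurable borel" and M: "\<And>x. \<bar>V x\<bar> \<le> M"
    and B [measurable]: "B \<in> sets borel" and "bounded B" and "0 < e"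
  obtains d where "0 < d" "\<And>z. norm z < d \<Longrightarrow>
    (\<integral>\<^sup>+x. ennreal (indicator B x * \<bar>V (x - z) - V x\<bar>) \<partial>lborel) \<le> ennreal e"
proof -
  obtain r where r: "B \<subseteq> cball 0 r" "r > 0"
    using \<open>bounded B\<close> by (meson bounded_subset_ballD ball_subset_cball order_trans)
  define B' :: "'a set" where "B' = cball 0 (r + 1)"
  have [measurable]: "B' \<in> sets borel" by (simp add: B'_def)
  define m where "m = measure lborel B'"
  have m: "emeasure lborel B' = ennreal m" "m \<ge> 0"
    unfolding m_def B'_def
    using emeasure_lborel_cball_finite[of "0::'a" "r + 1"] by (auto intro!: emeasure_eq_ennreal_measure)
  obtain g where g: "continuous_on UNIV g" and gM: "\<And>x. \<bar>g x\<bar> \<le> M"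
    and gV: "(\<integral>\<^sup>+x. ennreal (indicator B' x * \<bar>V x - g x\<bar>) \<partial>lborel) < ennreal (e / 3)"
    by (rule continuous_approximation_L1[of V M B' "e / 3"]) (use M \<open>0 < e\<close> in \<open>auto simp: B'_def\<close>)
  have [measurable]: "g \<in> borel_measurable borel" by (intro borel_measurable_continuous_onI g)
  have "uniformly_continuous_on B' g"
    by (intro compact_uniformly_continuous continuous_on_subset[OF g]) (auto simp: B'_def)
  moreover have "0 < e / (3 * (m + 1))" using \<open>0 < e\<close> m(2) by auto
  ultimately obtain d where d: "d > 0"
    "\<And>x y. x \<in> B' \<Longrightarrow> y \<in> B' \<Longrightarrow> dist y x < d \<Longrightarrow> dist (g y) (g x) < e / (3 * (m + 1))"
    unfolding uniformly_continuous_on_def by meson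
  show ?thesis
  proof (rule that[of "min d 1"])
    fix z :: 'a assume z: "norm z < min d 1"
    have inB': "x - z \<in> B'" "x \<in> B'" if "x \<in> B" for x
    proof -
      have "norm x \<le> r" using that r(1) by auto
      then show "x - z \<in> B'" "x \<in> B'"
        using z norm_triangle_ineq4[of x z] by (auto simp: B'_def)
    qed
    have pw: "indicator B x * \<bar>V (x - z) - V x\<bar> \<le>
        indicator B' (x - z) * \<bar>V (x - z) - g (x - z)\<bar> + (indicator B' x * \<bar>V x - g x\<bar>
        + e / (3 * (m + 1)) * indicator B' x)" for x
    proof (cases "x \<in> B")
      case True
      have "\<bar>g (x - z) - g x\<bar> < e / (3 * (m + 1))"
        using d(2)[of x "x - z"] inB'[OF True] z by (auto simp: dist_norm dist_real_def)
      then show ?thesis using True inB'[OF True] by (simp add: indicator_def)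
    next
      case False
      then show ?thesis using \<open>0 < e\<close> m(2) by (auto simp: indicator_def)
    qed
    have "(\<integral>\<^sup>+x. ennreal (indicator B x * \<bar>V (x - z) - V x\<bar>) \<partial>lborel) \<le>
      (\<integral>\<^sup>+x. ennreal (indicator B' (x - z) * \<bar>V (x - z) - g (x - z)\<bar>)
        + (ennreal (indicator B' x * \<bar>V x - g x\<bar>) + ennreal (e / (3 * (m + 1))) * indicator B' x) \<partial>lborel)"
    proof (rule nn_integral_mono)
      fix x
      have "ennreal (indicator B x * \<bar>V (x - z) - V x\<bar>) \<le> ennreal (indicator B' (x - z) * \<bar>V (x - z) - g (x - z)\<bar> + (indicator B' x * \<bar>V x - g x\<bar>
        + e / (3 * (m + 1)) * indicator B' x))" by (rule ennreal_leI[OF pw])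
      also have "\<dots> = ennreal (indicator B' (x - z) * \<bar>V (x - z) - g (x - z)\<bar>)
        + (ennreal (indicator B' x * \<bar>V x - g x\<bar>) + ennreal (e / (3 * (m + 1))) * indicator B' x)"
        using \<open>0 < e\<close> m(2) by (simp add: ennreal_plus ennreal_mult ennreal_indicator del: times_divide_eq_left)
      finally show "ennreal (indicator B x * \<bar>V (x - z) - V x\<bar>) \<le> \<dots>" .
    qed
    also have "\<dots> = (\<integral>\<^sup>+x. ennreal (indicator B' (x - z) * \<bar>V (x - z) - g (x - z)\<bar>) \<partial>lborel)
        + ((\<integral>\<^sup>+x. ennreal (indicator B' x * \<bar>V x - g x\<bar>) \<partial>lborel) + ennreal (e / (3 * (m + 1))) * emeasure lborel B')"
      by (simp add: nn_integral_add nn_integral_cmult)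
    also have "(\<integral>\<^sup>+x. ennreal (indicator B' (x - z) * \<bar>V (x - z) - g (x - z)\<bar>) \<partial>lborel)
        = (\<integral>\<^sup>+x. ennreal (indicator B' x * \<bar>V x - g x\<bar>) \<partial>lborel)"
      using nn_integral_lborel_plus[of "\<lambda>x. ennreal (indicator B' x * \<bar>V x - g x\<bar>)" "- z"]
      by simp
    also have "ennreal (e / (3 * (m + 1))) * emeasure lborel B' \<le> ennreal (e / 3)"
    proof -
      have "e / (3 * (m + 1)) * m \<le> e / 3" using \<open>0 < e\<close> m(2) by (simp add: field_simps)
      then show ?thesis using \<open>0 < e\<close> m by (simp add: ennreal_mult[symmetric] ennreal_leI)
    qed
    also have "(\<integral>\<^sup>+x. ennreal (indicator B' x * \<bar>V x - g x\<bar>) \<partial>lborel)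
        + ((\<integral>\<^sup>+x. ennreal (indicator B' x * \<bar>V x - g x\<bar>) \<partial>lborel) + ennreal (e / 3))
        \<le> ennreal (e / 3) + (ennreal (e / 3) + ennreal (e / 3))"
      using gV by (intro add_mono order_refl less_imp_le)
    also have "\<dots> = ennreal e" using \<open>0 < e\<close> by (simp flip: ennreal_plus)
    finally show "(\<integral>\<^sup>+x. ennreal (indicator B x * \<bar>V (x - z) - V x\<bar>) \<partial>lborel) \<le> ennreal e"
      by (simp add: add_mono)
  qed (use d in auto)
qed

text \<open>After the substitution z = x - y and Fubini, the kernel averages the translation errors
  with total weight 1. The width \<open>d\<close> depends on \<open>V\<close>, \<open>B\<close> and
  \<open>e\<close> only, so the kernel may be chosen afterwards, with unrelated scales in space and
  time.\<close>

lemma L1_mollification: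
  fixes V :: "'a::euclidean_space \<Rightarrow> real"
  assumes V [measurable]: "V \<in> borel_measurable borel" and M: "\<And>x. \<bar>V x\<bar> \<le> M"
    and B [measurable]: "B \<in> sets borel" and "bounded B" and "0 < e"
  obtains d where "0 < d" "\<And>k. k \<in> borel_measurable borel \<Longrightarrow> (\<And>z. 0 \<le> k z) \<Longrightarrow>
    (\<integral>\<^sup>+z. ennreal (k z) \<partial>lborel) = 1 \<Longrightarrow> (\<And>z. k z \<noteq> 0 \<Longrightarrow> norm z < d) \<Longrightarrow>
    (\<integral>\<^sup>+x. (\<integral>\<^sup>+y. ennreal (indicator B x * (k (x - y) * \<bar>V y - V x\<bar>)) \<partial>lborel) \<partial>lborel) \<le> ennreal e"
proof -
  obtain d where d: "0 < d" "\<And>z. norm z < d \<Longrightarrow>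
    (\<integral>\<^sup>+x. ennreal (indicator B x * \<bar>V (x - z) - V x\<bar>) \<partial>lborel) \<le> ennreal e"
    using L1_translation_continuous[OF assms] by blast
  show ?thesis
  proof (rule that[OF d(1)])
    fix k :: "'a \<Rightarrow> real"
    assume k [measurable]: "k \<in> borel_measurable borel" and k0: "\<And>z. 0 \<le> k z"
      and k1: "(\<integral>\<^sup>+z. ennreal (k z) \<partial>lborel) = 1" and kd: "\<And>z. k z \<noteq> 0 \<Longrightarrow> norm z < d"
    have "(\<integral>\<^sup>+x. (\<integral>\<^sup>+y. ennreal (indicator B x * (k (x - y) * \<bar>V y - V x\<bar>)) \<partial>lborel) \<partial>lborel)
        = (\<integral>\<^sup>+x. (\<integral>\<^sup>+z. ennreal (indicator B x * (k z * \<bar>V (x - z) - V x\<bar>)) \<partial>lborel) \<partial>lborel)"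
    proof (rule nn_integral_cong)
      fix x
      show "(\<integral>\<^sup>+y. ennreal (indicator B x * (k (x - y) * \<bar>V y - V x\<bar>)) \<partial>lborel)
        = (\<integral>\<^sup>+z. ennreal (indicator B x * (k z * \<bar>V (x - z) - V x\<bar>)) \<partial>lborel)"
        by (subst nn_integral_lborel_minus[symmetric, of _ x]) auto
    qed
    also have "\<dots> = (\<integral>\<^sup>+z. (\<integral>\<^sup>+x. ennreal (indicator B x * (k z * \<bar>V (x - z) - V x\<bar>)) \<partial>lborel) \<partial>lborel)"
      by (rule lborel_pair.Fubini') measurable
    also have "\<dots> \<le> (\<integral>\<^sup>+z. ennreal (k z) * ennreal e \<partial>lborel)"
    proof (rule nn_integral_mono)
      fix z
      have "(\<integral>\<^sup>+x. ennreal (indicator B x * (k z * \<bar>V (x - z) - V x\<bar>)) \<partial>lborel)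
        = (\<integral>\<^sup>+x. ennreal (k z) * ennreal (indicator B x * \<bar>V (x - z) - V x\<bar>) \<partial>lborel)"
        using k0 by (intro nn_integral_cong) (simp add: ennreal_mult[symmetric] mult_ac)
      also have "\<dots> = ennreal (k z) * (\<integral>\<^sup>+x. ennreal (indicator B x * \<bar>V (x - z) - V x\<bar>) \<partial>lborel)"
        by (rule nn_integral_cmult) measurable
      also have "\<dots> \<le> ennreal (k z) * ennreal e"
        using d(2)[of z] kd[of z] by (cases "k z = 0") (auto intro!: mult_left_mono)
      finally show "(\<integral>\<^sup>+x. ennreal (indicator B x * (k z * \<bar>V (x - z) - V x\<bar>)) \<partial>lborel) \<le> ennreal (k z) * ennreal e" .
    qed
    also have "\<dots> = ennreal e" by (simp add: nn_integral_multc k1)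
    finally show "(\<integral>\<^sup>+x. (\<integral>\<^sup>+y. ennreal (indicator B x * (k (x - y) * \<bar>V y - V x\<bar>)) \<partial>lborel) \<partial>lborel) \<le> ennreal e" .
  qed
qed

text \<open>A kernel of unit mass that vanishes outside [h, 2 h], hence strictly to the right of 0.
  Being the derivative of a rescaled step, it is also what differentiating a cutoff
  produces.\<close>

definition mollifier :: "real \<Rightarrow> real \<Rightarrow> real" where
  "mollifier h z = deriv smooth_step (z / h) / h"

lemma mollifier_smooth: "smooth_fun (mollifier h)"
  using smooth_fun_affine[OF smooth_fun_deriv[OF smooth_step_smooth], of "1 / h" "1 / h" 0]
  by (simp add: mollifier_def[abs_def])

lemma mollifier_measurable [measurable]: "mollifier h \<in> borel_measurable borel"
  by (rule smooth_fun_measurable[OF mollifier_smooth])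

lemma mollifier_nonneg: "h > 0 \<Longrightarrow> mollifier h z \<ge> 0"
  by (simp add: mollifier_def deriv_smooth_step_nonneg)

lemma mollifier_eq_0: "h > 0 \<Longrightarrow> z \<le> h \<or> z \<ge> 2 * h \<Longrightarrow> mollifier h z = 0"
  by (auto simp: mollifier_def field_simps intro!: deriv_smooth_step_eq_0)

lemma mollifier_antideriv:
  assumes "h > 0"
  shows "((\<lambda>z. smooth_step (z / h)) has_real_derivative mollifier h z) (at z)"
proof -
  have "((\<lambda>z. z / h) has_real_derivative 1 / h) (at z)" by (rule DERIV_cdivide[OF DERIV_ident])
  from DERIV_chain2[OF smooth_fun_has_deriv[OF smooth_step_smooth] this]
  show ?thesis by (simp only: mollifier_def times_divide_eq_right mult_1_right)
qed

lemma nn_integral_mollifier: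
  assumes "h > 0"
  shows "(\<integral>\<^sup>+z. ennreal (mollifier h z) \<partial>lborel) = 1"
proof -
  have "(\<integral>\<^sup>+z. ennreal (mollifier h z) \<partial>lborel) = (\<integral>\<^sup>+z. ennreal (mollifier h z) * indicator {0..2 * h} z \<partial>lborel)"
    using assms by (intro nn_integral_cong) (auto simp: indicator_def mollifier_eq_0)
  also have "\<dots> = smooth_step (2 * h / h) - smooth_step (0 / h)"
    using assms by (intro nn_integral_FTC_Icc mollifier_measurable mollifier_nonneg
        DERIV_subset[OF mollifier_antideriv]) auto
  finally show ?thesis using assms by (simp add: smooth_step_ge_2 smooth_step_le_1)
qed

lemma integral_mollifier:
  assumes "h > 0"
  shows "integrable lborel (mollifier h)" "(LINT z|lborel. mollifier h z) = 1"
proof -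
  have "has_bochner_integral lborel (mollifier h) 1"
    using assms by (intro has_bochner_integral_nn_integral) (auto simp: nn_integral_mollifier mollifier_nonneg)
  then show "integrable lborel (mollifier h)" "(LINT z|lborel. mollifier h z) = 1"
    by (auto simp: has_bochner_integral_iff)
qed

text \<open>The excess of \<open>W s\<close> over \<open>K\<close> is at most an average of the
  differences of \<open>W s\<close> and \<open>W t\<close>, and this is small in L1 by
  mollification; so the positive part of the excess vanishes almost everywhere. The kernel sees only
  times between s + h and s + 2 h, whence the condition \<open>s + 2 * h < b\<close>.\<close>

lemma AE_le_if_mollified_le:
  fixes W :: "real \<Rightarrow> real"
  assumes W [measurable]: "W \<in> borel_measurable borel" and M: "\<And>t. \<bar>W t\<bar> \<le> M"
    and le: "\<And>h s. h > 0 \<Longrightarrow> a < s \<Longrightarrow> s + 2 * h < b \<Longrightarrow> (LINT t|lborel. W t * mollifier h (t - s)) \<le> K"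
  shows "AE t in lborel. a < t \<and> t < b \<longrightarrow> W t \<le> K"
proof -
  have main: "AE t in lborel. t \<in> {a<..<b'} \<longrightarrow> W t \<le> K" if "b' < b" for b'
  proof -
    have small: "(\<integral>\<^sup>+s. ennreal (indicator {a<..<b'} s * max 0 (W s - K)) \<partial>lborel) \<le> ennreal e" if "e > 0" for e
    proof -
      obtain d where d: "0 < d" "\<And>k. k \<in> borel_measurable borel \<Longrightarrow> (\<And>z. 0 \<le> k z) \<Longrightarrow>
        (\<integral>\<^sup>+z. ennreal (k z) \<partial>lborel) = 1 \<Longrightarrow> (\<And>z. k z \<noteq> 0 \<Longrightarrow> norm z < d) \<Longrightarrow>
        (\<integral>\<^sup>+x. (\<integral>\<^sup>+y. ennreal (indicator {a<..<b'} x * (k (x - y) * \<bar>W y - W x\<bar>)) \<partial>lborel) \<partial>lborel) \<le> ennreal e"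
        using L1_mollification[of W M "{a<..<b'}" e] M \<open>e > 0\<close> by auto
      \<comment> \<open>The first bound makes the kernel narrow enough for the mollification
        estimate, the second keeps the averages started before \<open>b'\<close> below
        \<open>b\<close>.\<close>
      define h where "h = min (d / 3) ((b - b') / 3)"
      have h: "h > 0" "2 * h < d" "b' + 2 * h < b" using d(1) \<open>b' < b\<close> by (auto simp: h_def min_def field_simps)
      have "(\<integral>\<^sup>+s. ennreal (indicator {a<..<b'} s * max 0 (W s - K)) \<partial>lborel)
        \<le> (\<integral>\<^sup>+s. (\<integral>\<^sup>+t. ennreal (indicator {a<..<b'} s * (mollifier h (- (s - t)) * \<bar>W t - W s\<bar>)) \<partial>lborel) \<partial>lborel)"
      proof (rule nn_integral_mono)
        fix s
        show "ennreal (indicator {a<..<b'} s * max 0 (W s - K)) \<le>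
          (\<integral>\<^sup>+t. ennreal (indicator {a<..<b'} s * (mollifier h (- (s - t)) * \<bar>W t - W s\<bar>)) \<partial>lborel)"
        proof (cases "s \<in> {a<..<b'}")
          case True
          have int: "integrable lborel (\<lambda>t. mollifier h (t - s))"
            using lborel_integrable_real_affine[of "mollifier h" 1 "- s"] integral_mollifier[OF h(1)]
            by (simp add: algebra_simps)
          have one: "(LINT t|lborel. mollifier h (t - s)) = 1"
            using lborel_integral_real_affine[of 1 "mollifier h" "- s"] integral_mollifier[OF h(1)]
            by (simp add: algebra_simps)
          have intW: "integrable lborel (\<lambda>t. W t * mollifier h (t - s))"
            by (rule Bochner_Integration.integrable_bound[OF integrable_mult_right[OF int, of M]])
              (use M in \<open>auto intro!: AE_I2 mult_right_mono simp: abs_mult intro: order_trans[OF M abs_ge_self]\<close>)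
          have "W s - K \<le> W s - (LINT t|lborel. W t * mollifier h (t - s))"
            using le[of h s] h True by auto
          also have "\<dots> = (LINT t|lborel. W s * mollifier h (t - s)) - (LINT t|lborel. W t * mollifier h (t - s))"
            using one by simp
          also have "\<dots> = (LINT t|lborel. W s * mollifier h (t - s) - W t * mollifier h (t - s))"
            using int intW by (intro Bochner_Integration.integral_diff[symmetric]) auto
          also have "\<dots> \<le> (LINT t|lborel. \<bar>W s * mollifier h (t - s) - W t * mollifier h (t - s)\<bar>)"
            using int intW by (intro integral_mono) auto
          also have "\<dots> = (LINT t|lborel. mollifier h (- (s - t)) * \<bar>W t - W s\<bar>)"
            using mollifier_nonneg[OF h(1)]
            by (intro Bochner_Integration.integral_cong refl)
              (simp add: left_diff_distrib[symmetric] abs_mult abs_minus_commute mult.commute)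
          finally have "ennreal (max 0 (W s - K)) \<le> ennreal (LINT t|lborel. mollifier h (- (s - t)) * \<bar>W t - W s\<bar>)"
            using mollifier_nonneg[OF h(1)] by (intro ennreal_leI) (auto intro!: integral_nonneg_AE)
          also have "\<dots> \<le> (\<integral>\<^sup>+t. ennreal (mollifier h (- (s - t)) * \<bar>W t - W s\<bar>) \<partial>lborel)"
            using mollifier_nonneg[OF h(1)] by (intro ennreal_integral_le_nn_integral) auto
          finally show ?thesis using True by simp
        qed simp
      qed
      also have "\<dots> \<le> ennreal e"
      proof (rule d(2))
        show "(\<integral>\<^sup>+z. ennreal (mollifier h (- z)) \<partial>lborel) = 1"
          using nn_integral_lborel_minus[of "\<lambda>z. ennreal (mollifier h z)" 0] nn_integral_mollifier[OF h(1)] by simp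
        show "norm z < d" if "mollifier h (- z) \<noteq> 0" for z
        proof -
          have "\<not> (- z \<le> h \<or> - z \<ge> 2 * h)" using mollifier_eq_0[OF h(1)] that by blast
          then show ?thesis using h by auto
        qed
      qed (use mollifier_nonneg[OF h(1)] in auto)
      finally show ?thesis .
    qed
    have "(\<integral>\<^sup>+s. ennreal (indicator {a<..<b'} s * max 0 (W s - K)) \<partial>lborel) \<le> 0"
      by (rule ennreal_le_epsilon) (use small in auto)
    then have "(\<integral>\<^sup>+s. ennreal (indicator {a<..<b'} s * max 0 (W s - K)) \<partial>lborel) = 0" by simp
    then have "AE s in lborel. ennreal (indicator {a<..<b'} s * max 0 (W s - K)) = 0"
      by (subst (asm) nn_integral_0_iff_AE) auto
    then show ?thesis
      by eventually_elim (auto simp: indicator_def ennreal_eq_0_iff split: if_splits)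
  qed
  have "AE t in lborel. \<forall>n::nat. t \<in> {a<..<b - 1 / Suc n} \<longrightarrow> W t \<le> K"
    by (subst AE_all_countable) (intro allI main, simp)
  then show ?thesis
  proof eventually_elim
    case (elim t)
    show ?case
    proof
      assume t: "a < t \<and> t < b"
      then obtain n where "1 / Suc n < b - t" using nat_approx_posE[of "b - t"] by auto
      then show "W t \<le> K" using elim t by (auto dest!: spec[of _ n])
    qed
  qed
qed

lemma measurable_fst_snd_borel [measurable]:
  "fst \<in> borel_measurable (borel :: (real \<times> real) measure)"
  "snd \<in> borel_measurable (borel :: (real \<times> real) measure)"
  by (intro borel_measurable_continuous_onI continuous_intros)+

section \<open>Test functions and cutoffs\<close>

text \<open>Nonnegativity is included because entropy inequalities are tested with nonnegative
  functions. The variable ranges over the whole line: in time, negative arguments carry the initial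
  data.\<close>

definition test_fun :: "(real \<Rightarrow> real) \<Rightarrow> bool" where
  "test_fun g \<longleftrightarrow> smooth_fun g \<and> (\<forall>x. 0 \<le> g x) \<and> (\<exists>r. \<forall>x. r < \<bar>x\<bar> \<longrightarrow> g x = 0)"

lemma deriv_eq_0_outside:
  assumes "\<And>x. r < \<bar>x\<bar> \<Longrightarrow> g x = (0::real)" "r < \<bar>x\<bar>"
  shows "deriv g x = 0"
proof -
  have "((\<lambda>_. 0) has_real_derivative 0) (at x)" by simp
  then have "(g has_real_derivative 0) (at x)"
    by (rule has_field_derivative_transform_within_open[where S = "{y. r < \<bar>y\<bar>}"])
      (use assms in \<open>auto intro!: open_Collect_less continuous_intros\<close>)
  then show ?thesis by (rule DERIV_imp_deriv)
qed

lemma test_fun_bounds: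
  assumes "test_fun g"
  obtains B r where "B > 0" "r > 0" "\<And>x. \<bar>g x\<bar> \<le> B" "\<And>x. \<bar>deriv g x\<bar> \<le> B"
    "\<And>x. r < \<bar>x\<bar> \<Longrightarrow> g x = 0" "\<And>x. r < \<bar>x\<bar> \<Longrightarrow> deriv g x = 0"
proof -
  obtain r where r: "\<And>x. r < \<bar>x\<bar> \<Longrightarrow> g x = 0" using assms by (auto simp: test_fun_def)
  have s: "smooth_fun g" "smooth_fun (deriv g)" using assms by (auto simp: test_fun_def smooth_fun_deriv)
  obtain B1 where B1: "B1 > 0" "\<And>x. x \<in> {-\<bar>r\<bar>..\<bar>r\<bar>} \<Longrightarrow> \<bar>g x\<bar> \<le> B1"
    by (rule smooth_fun_bounded_on[OF s(1) compact_Icc]) auto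
  obtain B2 where B2: "B2 > 0" "\<And>x. x \<in> {-\<bar>r\<bar>..\<bar>r\<bar>} \<Longrightarrow> \<bar>deriv g x\<bar> \<le> B2"
    by (rule smooth_fun_bounded_on[OF s(2) compact_Icc]) auto
  have z: "g x = 0" "deriv g x = 0" if "\<bar>r\<bar> < \<bar>x\<bar>" for x
    using that r deriv_eq_0_outside[of "\<bar>r\<bar>" g x] by auto
  show ?thesis
  proof (rule that[of "max B1 B2" "\<bar>r\<bar> + 1"])
    fix x
    have x: "\<bar>r\<bar> < \<bar>x\<bar> \<or> x \<in> {-\<bar>r\<bar>..\<bar>r\<bar>}" by auto
    show "\<bar>g x\<bar> \<le> max B1 B2"
      using x z(1)[of x] B1(1) B1(2)[of x] by (auto simp: le_max_iff_disj)
    show "\<bar>deriv g x\<bar> \<le> max B1 B2"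
      using x z(2)[of x] B2(1) B2(2)[of x] by (auto simp: le_max_iff_disj)
  qed (use B1 z in auto)
qed

lemma test_fun_smooth: "test_fun g \<Longrightarrow> smooth_fun g"
  and test_fun_nonneg: "test_fun g \<Longrightarrow> 0 \<le> g x"
  by (auto simp: test_fun_def)

lemma test_fun_mult:
  assumes "test_fun g" "smooth_fun h" "\<And>x. 0 \<le> h x"
  shows "test_fun (\<lambda>x. g x * h x)"
  using assms unfolding test_fun_def by (auto intro!: smooth_fun_mult)

lemma smooth_step_scaled: "smooth_fun (\<lambda>x. smooth_step (x / h))"
  using smooth_fun_affine[OF smooth_step_smooth, of 1 "1 / h" 0] by simp

lemma smooth_step_scaled_neg: "smooth_fun (\<lambda>x. smooth_step (- x / h))"
  using smooth_fun_affine[OF smooth_step_smooth, of 1 "- 1 / h" 0] by simp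

text \<open>One family serves at two scales: a large \<open>R\<close> truncates at infinity, a small
  one concentrates at the vertex, where the value is 1 for all edges alike.\<close>

definition cutoff :: "real \<Rightarrow> real \<Rightarrow> real" where
  "cutoff R x = 1 - smooth_step (x / R) - smooth_step (- x / R)"

lemma cutoff_eq_1: "R > 0 \<Longrightarrow> \<bar>x\<bar> \<le> R \<Longrightarrow> cutoff R x = 1"
  by (simp add: cutoff_def smooth_step_le_1 abs_le_iff field_simps)

lemma cutoff_eq_0: "R > 0 \<Longrightarrow> 2 * R \<le> \<bar>x\<bar> \<Longrightarrow> cutoff R x = 0"
proof -
  assume "R > 0" "2 * R \<le> \<bar>x\<bar>"
  then consider "2 \<le> x / R" "- x / R \<le> 1" | "2 \<le> - x / R" "x / R \<le> 1"
    by (force simp: field_simps abs_if split: if_splits)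
  then show ?thesis
    by cases (simp_all add: cutoff_def smooth_step_le_1 smooth_step_ge_2)
qed

lemma cutoff_bounds: "R > 0 \<Longrightarrow> 0 \<le> cutoff R x \<and> cutoff R x \<le> 1"
proof -
  assume "R > 0"
  then consider "x / R \<le> 1" | "- x / R \<le> 1"
    by (force simp: field_simps)
  then show ?thesis
    by cases (simp_all add: cutoff_def smooth_step_le_1 smooth_step_nonneg smooth_step_upper)
qed

lemma cutoff_smooth: "smooth_fun (cutoff R)"
  unfolding cutoff_def[abs_def]
  by (intro smooth_fun_diff smooth_fun_const smooth_step_scaled smooth_step_scaled_neg)

lemma cutoff_test_fun: "R > 0 \<Longrightarrow> test_fun (cutoff R)"
  unfolding test_fun_def using cutoff_smooth cutoff_bounds cutoff_eq_0
  by (metis less_le)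

lemma deriv_cutoff:
  assumes "R > 0"
  shows "deriv (cutoff R) x = mollifier R (- x) - mollifier R x"
proof (rule DERIV_imp_deriv)
  have "((\<lambda>x. smooth_step (- x / R)) has_real_derivative mollifier R (- x) * - 1) (at x)"
    by (rule DERIV_chain2[OF mollifier_antideriv[OF assms]]) (auto intro!: derivative_eq_intros)
  then have "((\<lambda>x. 1 - smooth_step (x / R) - smooth_step (- x / R)) has_real_derivative 0 - mollifier R x - mollifier R (- x) * - 1) (at x)"
    by (intro DERIV_diff DERIV_const mollifier_antideriv[OF assms])
  then show "(cutoff R has_real_derivative mollifier R (- x) - mollifier R x) (at x)"
    unfolding cutoff_def[abs_def] by simp
qed

lemma cutoff_measurable [measurable]:
  "cutoff R \<in> borel_measurable borel" "deriv (cutoff R) \<in> borel_measurable borel"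
  by (intro smooth_fun_measurable smooth_fun_measurable_deriv cutoff_smooth)+

text \<open>A slope bound for the unscaled step, fixed once, so that pointwise bounds on derivatives
  of cutoffs read \<open>step_slope / R\<close> with the same constant at every scale.\<close>

definition step_slope :: real where
  "step_slope = (SOME B. B > 0 \<and> (\<forall>x. \<bar>deriv smooth_step x\<bar> \<le> B))"

lemma step_slope: "step_slope > 0" "\<bar>deriv smooth_step x\<bar> \<le> step_slope"
proof -
  obtain B where B: "B > 0" "\<And>x. x \<in> {1..2} \<Longrightarrow> \<bar>deriv smooth_step x\<bar> \<le> B"
    by (rule smooth_fun_bounded_on[OF smooth_fun_deriv[OF smooth_step_smooth] compact_Icc]) auto
  then have "\<exists>B. B > 0 \<and> (\<forall>x. \<bar>deriv smooth_step x\<bar> \<le> B)"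
    by (metis abs_zero atLeastAtMost_iff deriv_smooth_step_eq_0 less_imp_le linear)
  from someI_ex[OF this] show "step_slope > 0" "\<bar>deriv smooth_step x\<bar> \<le> step_slope"
    by (auto simp: step_slope_def)
qed

lemma mollifier_le: "h > 0 \<Longrightarrow> mollifier h z \<le> step_slope / h"
  using step_slope(2)[of "z / h"] by (auto simp: mollifier_def divide_right_mono)

lemma deriv_cutoff_abs_le: "R > 0 \<Longrightarrow> \<bar>deriv (cutoff R) x\<bar> \<le> mollifier R x + mollifier R (- x)"
  using mollifier_nonneg[of R x] mollifier_nonneg[of R "- x"] by (auto simp: deriv_cutoff)

lemma deriv_cutoff_abs_le': "R > 0 \<Longrightarrow> \<bar>deriv (cutoff R) x\<bar> \<le> step_slope / R"
  using mollifier_nonneg[of R x] mollifier_nonneg[of R "- x"] mollifier_le[of R x] mollifier_le[of R "- x"]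
  unfolding deriv_cutoff by linarith

lemma integral_mollifier_uminus:
  assumes "h > 0"
  shows "integrable lborel (\<lambda>z. mollifier h (- z))" "(LINT z|lborel. mollifier h (- z)) = 1"
  using lborel_integrable_real_affine[of "mollifier h" "-1" 0]
    lborel_integral_real_affine[of "-1" "mollifier h" 0] integral_mollifier[OF assms]
  by simp_all

lemma integral_mollifier_shift:
  assumes "h > 0"
  shows "integrable lborel (\<lambda>z. mollifier h (z - s))" "(LINT z|lborel. mollifier h (z - s)) = 1"
  using lborel_integrable_real_affine[of "mollifier h" 1 "- s"]
    lborel_integral_real_affine[of 1 "mollifier h" "- s"] integral_mollifier[OF assms]
  by (simp_all add: algebra_simps)

text \<open>One unit of variation on each flank, whatever the scale. Hence a bounded flux through
  the flanks costs a bounded amount however large \<open>R\<close> is.\<close>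

lemma integral_deriv_cutoff_abs:
  assumes "R > 0"
  shows "integrable lborel (\<lambda>x. \<bar>deriv (cutoff R) x\<bar>)" "(LINT x|lborel. \<bar>deriv (cutoff R) x\<bar>) \<le> 2"
proof -
  note i = integral_mollifier[OF assms] integral_mollifier_uminus[OF assms]
  show *: "integrable lborel (\<lambda>x. \<bar>deriv (cutoff R) x\<bar>)"
    using i deriv_cutoff[OF assms] by auto
  have "(LINT x|lborel. \<bar>deriv (cutoff R) x\<bar>) \<le> (LINT x|lborel. mollifier R x + mollifier R (- x))"
    using i * deriv_cutoff_abs_le[OF assms] by (intro integral_mono) auto
  then show "(LINT x|lborel. \<bar>deriv (cutoff R) x\<bar>) \<le> 2" using i by simp
qed

section \<open>The integral estimate\<close>

text \<open>The distribution \<open>- (H_t + L_x)\<close> applied to the product test function. The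
  integral is over the whole plane; restrictions to an edge or to positive times are put into
  \<open>H\<close> and \<open>L\<close> as factors.\<close>

definition weak_pairing ::
    "(real \<times> real \<Rightarrow> real) \<Rightarrow> (real \<times> real \<Rightarrow> real) \<Rightarrow> (real \<Rightarrow> real) \<Rightarrow> (real \<Rightarrow> real) \<Rightarrow> real" where
  "weak_pairing H L \<psi> \<theta> =
    (LINT p|lborel. H p * (\<psi> (fst p) * deriv \<theta> (snd p)) + L p * (deriv \<psi> (fst p) * \<theta> (snd p)))"

text \<open>
  Testing with \<open>cutoff R\<close> in space first shows that \<open>w(t)\<close> is integrable; only then does the
  bound \<open>\<bar>Q\<bar> \<le> e + C w\<close> make the flux through \<open>\<bar>x\<bar> \<approx> R\<close> negligible. Data at
  time \<open>0\<close> are encoded by extending \<open>w\<close> constantly to negative times.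
\<close>

locale L1_estimate =
  fixes w Q :: "real \<times> real \<Rightarrow> real" and M :: real
  assumes w_measurable [measurable]: "w \<in> borel_measurable borel"
    and Q_measurable [measurable]: "Q \<in> borel_measurable borel"
    and w_nonneg: "\<And>p. 0 \<le> w p" and w_le: "\<And>p. w p \<le> M" and Q_le: "\<And>p. \<bar>Q p\<bar> \<le> M"
    and Q_modulus: "\<And>e. e > 0 \<Longrightarrow> \<exists>C\<ge>0. \<forall>p. \<bar>Q p\<bar> \<le> e + C * w p"
    and w_past: "\<And>x t. t \<le> 0 \<Longrightarrow> w (x, t) = w (x, 0)"
    and Q_past: "\<And>x t. t \<le> 0 \<Longrightarrow> Q (x, t) = 0"
    and ineq: "\<And>R \<theta>. R > 0 \<Longrightarrow> test_fun \<theta> \<Longrightarrow>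
      0 \<le> weak_pairing w Q (cutoff R) \<theta>"
begin

text \<open>\<open>WR\<close> is the mass seen by the cutoff and \<open>PR\<close> the flux through
  its flanks. In these terms \<open>ineq\<close> says that the time derivative of
  \<open>WR R\<close> is at most \<open>PR R\<close> as a distribution.\<close>

definition WR :: "real \<Rightarrow> real \<Rightarrow> real" where
  "WR R t = (LINT x|lborel. w (x, t) * cutoff R x)"

definition PR :: "real \<Rightarrow> real \<Rightarrow> real" where
  "PR R t = (LINT x|lborel. Q (x, t) * deriv (cutoff R) x)"

lemma M_nonneg: "M \<ge> 0"
  using w_nonneg[of undefined] w_le[of undefined] by linarith

lemma w_abs: "\<bar>w p\<bar> \<le> M" using w_nonneg w_le by simp

lemma WR_measurable [measurable]: "WR R \<in> borel_measurable borel"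
  unfolding WR_def[abs_def] by measurable

lemma PR_measurable [measurable]: "PR R \<in> borel_measurable borel"
  unfolding PR_def[abs_def] by measurable

lemma integrable_w_cutoff:
  assumes "R > 0" shows "integrable lborel (\<lambda>x. w (x, t) * cutoff R x)"
proof (rule integrable_bounded_support[where C = M and B = "{- 2 * R..2 * R}"])
  show "\<bar>w (x, t) * cutoff R x\<bar> \<le> M" for x
    using w_abs[of "(x, t)"] cutoff_bounds[OF assms, of x] M_nonneg
    by (auto simp: abs_mult intro: mult_left_le_one_le order_trans[OF mult_left_le])
  show "w (x, t) * cutoff R x = 0" if "x \<notin> {- 2 * R..2 * R}" for x
  proof -
    have "2 * R \<le> \<bar>x\<bar>" using that by auto
    then show ?thesis using cutoff_eq_0[OF assms, of x] by simp
  qed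
qed auto

lemma integrable_Q_cutoff:
  assumes "R > 0" shows "integrable lborel (\<lambda>x. Q (x, t) * deriv (cutoff R) x)"
  by (rule Bochner_Integration.integrable_bound[OF integrable_mult_right[OF integral_deriv_cutoff_abs(1)[OF assms], of M]])
    (use Q_le M_nonneg in \<open>auto simp: abs_mult intro!: AE_I2 mult_right_mono\<close>)

lemma WR_abs_le:
  assumes "R > 0" shows "\<bar>WR R t\<bar> \<le> M * (LINT x|lborel. cutoff R x)"
proof -
  have i: "integrable lborel (cutoff R)"
    by (rule integrable_bounded_support[where C = 1 and B = "{- 2 * R..2 * R}"])
      (use cutoff_bounds[OF assms] cutoff_eq_0[OF assms] in auto)
  have "\<bar>WR R t\<bar> \<le> (LINT x|lborel. \<bar>w (x, t) * cutoff R x\<bar>)"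
    unfolding WR_def by (rule integral_abs_bound)
  also have "\<dots> \<le> (LINT x|lborel. M * cutoff R x)"
  proof (rule integral_mono)
    show "integrable lborel (\<lambda>x. \<bar>w (x, t) * cutoff R x\<bar>)"
      by (rule integrable_abs[OF integrable_w_cutoff[OF assms]])
  qed (use i w_abs cutoff_bounds[OF assms] in \<open>auto simp: abs_mult intro!: mult_right_mono\<close>)
  finally show ?thesis by simp
qed

lemma PR_abs_le_integral:
  assumes "R > 0" shows "\<bar>PR R t\<bar> \<le> (LINT x|lborel. \<bar>Q (x, t)\<bar> * \<bar>deriv (cutoff R) x\<bar>)"
  unfolding PR_def using integral_abs_bound[of lborel "\<lambda>x. Q (x, t) * deriv (cutoff R) x"]
  by (simp add: abs_mult)

lemma PR_abs_le:
  assumes "R > 0" shows "\<bar>PR R t\<bar> \<le> 2 * M"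
proof -
  have "(LINT x|lborel. \<bar>Q (x, t)\<bar> * \<bar>deriv (cutoff R) x\<bar>) \<le> (LINT x|lborel. M * \<bar>deriv (cutoff R) x\<bar>)"
    using integrable_abs[OF integrable_Q_cutoff[OF assms, of t], unfolded abs_mult] integral_deriv_cutoff_abs(1)[OF assms] Q_le
    by (intro integral_mono) (auto intro!: mult_right_mono)
  also have "\<dots> \<le> M * 2"
    using integral_deriv_cutoff_abs[OF assms] M_nonneg by (auto intro!: mult_left_mono)
  finally show ?thesis using PR_abs_le_integral[OF assms, of t] by simp
qed

lemma PR_past: "t \<le> 0 \<Longrightarrow> PR R t = 0"
  by (simp add: PR_def Q_past)

lemma ineq_time:
  assumes "R > 0" "test_fun \<theta>"
  shows "integrable lborel (\<lambda>t. WR R t * deriv \<theta> t)" "integrable lborel (\<lambda>t. PR R t * \<theta> t)"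
    "0 \<le> (LINT t|lborel. WR R t * deriv \<theta> t) + (LINT t|lborel. PR R t * \<theta> t)"
proof -
  obtain B r where th: "B > 0" "r > 0" "\<And>x. \<bar>\<theta> x\<bar> \<le> B" "\<And>x. \<bar>deriv \<theta> x\<bar> \<le> B"
    "\<And>x. r < \<bar>x\<bar> \<Longrightarrow> \<theta> x = 0" "\<And>x. r < \<bar>x\<bar> \<Longrightarrow> deriv \<theta> x = 0"
    using test_fun_bounds[OF assms(2)] by metis
  have [measurable]: "\<theta> \<in> borel_measurable borel" "deriv \<theta> \<in> borel_measurable borel"
    using assms(2) by (auto intro: smooth_fun_measurable smooth_fun_measurable_deriv test_fun_smooth)
  have r: "t \<notin> {-r..r} \<Longrightarrow> r < \<bar>t\<bar>" for t by auto
  show i1: "integrable lborel (\<lambda>t. WR R t * deriv \<theta> t)"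
    using th r by (intro integrable_bounded_support[where C = "M * (LINT x|lborel. cutoff R x) * B" and B = "{-r..r}"])
      (auto simp: abs_mult intro!: mult_mono WR_abs_le[OF assms(1)] order_trans[OF abs_ge_zero WR_abs_le[OF assms(1)]])
  show i2: "integrable lborel (\<lambda>t. PR R t * \<theta> t)"
    using th r M_nonneg by (intro integrable_bounded_support[where C = "2 * M * B" and B = "{-r..r}"])
      (auto simp: abs_mult intro!: mult_mono PR_abs_le[OF assms(1)])
  define F where "F x t = w (x, t) * (cutoff R x * deriv \<theta> t) + Q (x, t) * (deriv (cutoff R) x * \<theta> t)" for x t
  have [measurable]: "case_prod F \<in> borel_measurable borel"
    unfolding F_def[abs_def] case_prod_beta' by measurable
  have "integrable lborel (case_prod F)"
  proof (rule integrable_bounded_support[where B = "{- 2 * R..2 * R} \<times> {-r..r}"])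
    fix p :: "real \<times> real"
    obtain x t where p: "p = (x, t)" by (cases p)
    have "\<bar>F x t\<bar> \<le> \<bar>w (x, t)\<bar> * (\<bar>cutoff R x\<bar> * \<bar>deriv \<theta> t\<bar>) + \<bar>Q (x, t)\<bar> * (\<bar>deriv (cutoff R) x\<bar> * \<bar>\<theta> t\<bar>)"
      unfolding F_def by (rule order_trans[OF abs_triangle_ineq]) (simp add: abs_mult)
    also have "\<dots> \<le> M * (1 * B) + M * (step_slope / R * B)"
      using cutoff_bounds[OF assms(1)] assms(1) step_slope(1)
      by (intro add_mono mult_mono w_abs Q_le th deriv_cutoff_abs_le') (auto intro!: M_nonneg)
    finally show "\<bar>case_prod F p\<bar> \<le> M * (1 * B) + M * (step_slope / R * B)" by (simp add: p)
  next
    fix p :: "real \<times> real" assume np: "p \<notin> {- 2 * R..2 * R} \<times> {-r..r}"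
    obtain x t where p: "p = (x, t)" by (cases p)
    show "case_prod F p = 0"
    proof (cases "t \<in> {-r..r}")
      case True
      then have x: "2 * R < \<bar>x\<bar>" using np p by auto
      then have "cutoff R x = 0" "deriv (cutoff R) x = 0"
        using cutoff_eq_0[OF assms(1)] deriv_eq_0_outside[of "2 * R" "cutoff R" x] by auto
      then show ?thesis by (simp add: p F_def)
    qed (use r th p in \<open>auto simp: F_def\<close>)
  qed (auto intro!: bounded_Times)
  then have F: "integrable (lborel \<Otimes>\<^sub>M lborel) (case_prod F)" by (simp add: lborel_prod)
  have "0 \<le> (LINT p|lborel. case_prod F p)"
    using ineq[OF assms] by (simp add: weak_pairing_def F_def case_prod_beta')
  also have "\<dots> = (LINT t|lborel. (LINT x|lborel. F x t))"
    using lborel_pair.integral_snd[OF F] by (simp add: lborel_prod)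
  also have "\<dots> = (LINT t|lborel. WR R t * deriv \<theta> t + PR R t * \<theta> t)"
  proof (intro Bochner_Integration.integral_cong refl)
    fix t
    have "(LINT x|lborel. F x t) = (LINT x|lborel. (w (x, t) * cutoff R x) * deriv \<theta> t + (Q (x, t) * deriv (cutoff R) x) * \<theta> t)"
      by (simp add: F_def mult_ac)
    also have "\<dots> = WR R t * deriv \<theta> t + PR R t * \<theta> t"
      unfolding WR_def PR_def
      using integrable_w_cutoff[OF assms(1), of t] integrable_Q_cutoff[OF assms(1), of t] by simp
    finally show "(LINT x|lborel. F x t) = WR R t * deriv \<theta> t + PR R t * \<theta> t" .
  qed
  also have "\<dots> = (LINT t|lborel. WR R t * deriv \<theta> t) + (LINT t|lborel. PR R t * \<theta> t)"
    using i1 i2 by simp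
  finally show "0 \<le> (LINT t|lborel. WR R t * deriv \<theta> t) + (LINT t|lborel. PR R t * \<theta> t)" .
qed

text \<open>The distributional inequality integrated from the past up to a time before
  \<open>T\<close>: the mass exceeds its initial value by at most the flux accumulated during (0,
  T).\<close>

lemma WR_le:
  assumes R: "R > 0" and T: "T > 0" and b: "0 \<le> b" "AE t in lborel. 0 < t \<and> t < T \<longrightarrow> \<bar>PR R t\<bar> \<le> b"
    and M0: "WR R 0 \<le> M0"
  shows "AE t in lborel. 0 < t \<and> t < T \<longrightarrow> WR R t \<le> M0 + T * b"
proof (rule AE_le_if_mollified_le[where M = "M * (LINT x|lborel. cutoff R x)"])
  fix h s :: real assume h: "h > 0" and s: "0 < s" "s + 2 * h < T"
  \<comment> \<open>The rise takes place for -3 \<le> t \<le> -2, in the past, where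
    \<open>WR R\<close> keeps its initial value. The fall between s + h and s + 2 h produces the
    mollified value at \<open>s\<close>.\<close>
  define \<theta> where "\<theta> t = smooth_step (t + 4) - smooth_step ((t - s) / h)" for t
  have st: "\<theta> t = 0" if "t < - 3 \<or> t > s + 2 * h" for t
    using that h s by (auto simp: \<theta>_def smooth_step_le_1 smooth_step_ge_2 field_simps)
  have bd: "0 \<le> \<theta> t \<and> \<theta> t \<le> 1" for t
  proof (cases "(t - s) / h \<le> 1")
    case True then show ?thesis by (simp add: \<theta>_def smooth_step_le_1 smooth_step_nonneg smooth_step_upper)
  next
    case False
    then have "t > 0" using h s by (auto simp: field_simps)
    then show ?thesis by (simp add: \<theta>_def smooth_step_ge_2 smooth_step_nonneg smooth_step_upper)
  qed
  have sm: "smooth_fun \<theta>"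
    unfolding \<theta>_def[abs_def]
    using smooth_fun_diff[OF smooth_fun_affine[OF smooth_step_smooth, of 1 1 4] smooth_fun_affine[OF smooth_step_smooth, of 1 "1 / h" "- s / h"]]
    by (simp add: diff_divide_distrib)
  have tf: "test_fun \<theta>"
    unfolding test_fun_def using sm bd st s h by (intro conjI allI exI[of _ "3 + s + 2 * h"]) (auto simp: abs_if split: if_splits)
  have d: "deriv \<theta> t = mollifier 1 (t + 4) - mollifier h (t - s)" for t
  proof (rule DERIV_imp_deriv)
    have 1: "((\<lambda>t. t + 4) has_real_derivative 1) (at t)" "((\<lambda>t. t - s) has_real_derivative 1) (at t)"
      by (auto intro!: derivative_eq_intros)
    from DERIV_diff[OF DERIV_chain2[OF mollifier_antideriv[OF zero_less_one] 1(1)] DERIV_chain2[OF mollifier_antideriv[OF h] 1(2)]]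
    show "(\<theta> has_real_derivative mollifier 1 (t + 4) - mollifier h (t - s)) (at t)"
      by (simp add: \<theta>_def[abs_def])
  qed
  have m1: "integrable lborel (\<lambda>t. mollifier 1 (t + 4))" "(LINT t|lborel. mollifier 1 (t + 4)) = 1"
    using integral_mollifier_shift[of 1 "-4"] by simp_all
  have WR_int: "integrable lborel (\<lambda>t. WR R t * g t)" if g: "integrable lborel g" for g
  proof (rule Bochner_Integration.integrable_bound[OF integrable_mult_right[OF integrable_abs[OF g], of "M * (LINT x|lborel. cutoff R x)"]])
    show "(\<lambda>t. WR R t * g t) \<in> borel_measurable lborel" using g by measurable
    have "\<bar>WR R t\<bar> * \<bar>g t\<bar> \<le> M * (LINT x|lborel. cutoff R x) * \<bar>g t\<bar>" for t
      by (intro mult_right_mono WR_abs_le R abs_ge_zero)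
    then show "AE t in lborel. norm (WR R t * g t) \<le> norm (M * (LINT x|lborel. cutoff R x) * \<bar>g t\<bar>)"
      by (intro AE_I2) (metis abs_ge_self abs_mult order_trans real_norm_def)
  qed
  note i = WR_int[OF m1(1)] WR_int[OF integral_mollifier_shift(1)[OF h, of s]]
  have WR_past: "WR R t = WR R 0" if "t \<le> 0" for t by (simp add: WR_def w_past[OF that])
  have "(LINT t|lborel. WR R t * mollifier h (t - s)) = (LINT t|lborel. WR R t * mollifier 1 (t + 4)) - (LINT t|lborel. WR R t * deriv \<theta> t)"
    using i by (simp add: d right_diff_distrib)
  also have "\<dots> \<le> (LINT t|lborel. WR R t * mollifier 1 (t + 4)) + (LINT t|lborel. PR R t * \<theta> t)"
    using ineq_time(3)[OF R tf] by simp
  also have "(LINT t|lborel. WR R t * mollifier 1 (t + 4)) = (LINT t|lborel. WR R 0 * mollifier 1 (t + 4))"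
  proof (intro Bochner_Integration.integral_cong refl)
    fix t show "WR R t * mollifier 1 (t + 4) = WR R 0 * mollifier 1 (t + 4)"
      using WR_past[of t] mollifier_eq_0[of 1 "t + 4"] by (cases "t \<le> 0") auto
  qed
  also have "\<dots> \<le> M0" using m1 M0 by simp
  also have "(LINT t|lborel. PR R t * \<theta> t) \<le> (LINT t|lborel. b * indicator {0<..<T} t)"
  proof (rule integral_mono_AE[OF ineq_time(2)[OF R tf]])
    show "AE t in lborel. PR R t * \<theta> t \<le> b * indicator {0<..<T} t"
      using b(2)
    proof eventually_elim
      case (elim t)
      consider "t \<le> 0" | "0 < t \<and> t < T" | "t \<ge> T" by linarith
      then show ?case
      proof cases
        case 2
        then have "PR R t * \<theta> t \<le> b * 1" using elim bd[of t] b(1) by (intro mult_mono) auto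
        then show ?thesis using 2 by simp
      qed (use s st[of t] PR_past[of t R] in auto)
    qed
  qed (use T in auto)
  also have "\<dots> = T * b" using T by simp
  finally show "(LINT t|lborel. WR R t * mollifier h (t - s)) \<le> M0 + T * b" by simp
qed (use WR_abs_le[OF R] in auto)

text \<open>Fatou along the radii \<open>Suc n\<close>: at each point the cutoff is eventually 1.
  The bounds \<open>K n\<close> may vary with \<open>n\<close>, since the flux error depends on the
  radius.\<close>

lemma nn_integral_w_le:
  assumes "\<And>n. WR (real (Suc n)) t \<le> K n" "K \<longlonglongrightarrow> L" "0 \<le> L"
  shows "(\<integral>\<^sup>+x. ennreal (w (x, t)) \<partial>lborel) \<le> ennreal L"
proof -
  have "(\<integral>\<^sup>+x. ennreal (w (x, t)) \<partial>lborel) = (\<integral>\<^sup>+x. liminf (\<lambda>n. ennreal (w (x, t) * cutoff (real (Suc n)) x)) \<partial>lborel)"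
  proof (intro nn_integral_cong lim_imp_Liminf[symmetric] tendsto_eventually)
    fix x
    obtain N :: nat where "\<bar>x\<bar> < real N" using reals_Archimedean2 by blast
    then show "\<forall>\<^sub>F n in sequentially. ennreal (w (x, t) * cutoff (real (Suc n)) x) = ennreal (w (x, t))"
      by (intro eventually_sequentiallyI[of N]) (auto simp: cutoff_eq_1)
  qed simp
  also have "\<dots> \<le> liminf (\<lambda>n. \<integral>\<^sup>+x. ennreal (w (x, t) * cutoff (real (Suc n)) x) \<partial>lborel)"
    by (rule nn_integral_liminf) measurable
  also have "\<dots> \<le> liminf (\<lambda>n. ennreal (K n))"
  proof (intro Liminf_mono always_eventually allI)
    fix n
    have "(\<integral>\<^sup>+x. ennreal (w (x, t) * cutoff (real (Suc n)) x) \<partial>lborel) = ennreal (WR (real (Suc n)) t)"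
      unfolding WR_def using w_nonneg cutoff_bounds[of "real (Suc n)"]
      by (intro nn_integral_eq_integral integrable_w_cutoff) auto
    also have "\<dots> \<le> ennreal (K n)" by (intro ennreal_leI assms)
    finally show "(\<integral>\<^sup>+x. ennreal (w (x, t) * cutoff (real (Suc n)) x) \<partial>lborel) \<le> ennreal (K n)" .
  qed
  also have "\<dots> = ennreal L"
    using tendsto_ennrealI[OF assms(2)] by (intro lim_imp_Liminf) auto
  finally show ?thesis .
qed

theorem L1_bound:
  "AE t in lborel. 0 < t \<longrightarrow> (\<integral>\<^sup>+x. ennreal (w (x, t)) \<partial>lborel) \<le> (\<integral>\<^sup>+x. ennreal (w (x, 0)) \<partial>lborel)"
proof (cases "(\<integral>\<^sup>+x. ennreal (w (x, 0)) \<partial>lborel)")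
  \<comment> \<open>With infinite initial mass the bound is trivial; here \<open>M0\<close> is its
    finite value.\<close>
  case (real M0)
  have WR0: "WR R 0 \<le> M0" if "R > 0" for R
  proof -
    have "ennreal (WR R 0) = (\<integral>\<^sup>+x. ennreal (w (x, 0) * cutoff R x) \<partial>lborel)"
      unfolding WR_def using w_nonneg cutoff_bounds[OF that]
      by (intro nn_integral_eq_integral[symmetric] integrable_w_cutoff that) auto
    also have "\<dots> \<le> (\<integral>\<^sup>+x. ennreal (w (x, 0)) \<partial>lborel)"
      using w_nonneg cutoff_bounds[OF that] by (intro nn_integral_mono ennreal_leI) (auto intro!: mult_left_le)
    finally show ?thesis using real by (simp add: ennreal_le_iff)
  qed
  \<comment> \<open>The crude bound \<open>2 * M\<close> on the flux grows with \<open>T\<close> but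
    is uniform in the radius, which is enough for finiteness.\<close>
  have finite: "AE t in lborel. 0 < t \<and> t < T \<longrightarrow> (\<integral>\<^sup>+x. ennreal (w (x, t)) \<partial>lborel) \<le> ennreal (M0 + T * (2 * M))"
    if "T > 0" for T
  proof -
    have "AE t in lborel. \<forall>n. 0 < t \<and> t < T \<longrightarrow> WR (real (Suc n)) t \<le> M0 + T * (2 * M)"
      by (subst AE_all_countable, intro allI WR_le that WR0 AE_I2 impI PR_abs_le) (use M_nonneg in auto)
    then show ?thesis
      by (rule eventually_mono)
        (use that M_nonneg real in \<open>auto intro!: nn_integral_w_le[OF _ tendsto_const] simp del: ennreal_plus\<close>)
  qed
  \<comment> \<open>The constant \<open>e\<close> meets a derivative of L1 norm at most 2 and gives
    \<open>2 * e\<close>. The part \<open>C * w\<close> meets a slope of at most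
    \<open>step_slope / R\<close> and the finite mass \<open>L\<close>, and disappears as the radius
    grows.\<close>
  have small: "AE t in lborel. 0 < t \<and> t < T \<longrightarrow> (\<integral>\<^sup>+x. ennreal (w (x, t)) \<partial>lborel) \<le> ennreal (M0 + T * (2 * e))"
    if T: "T > 0" and "e > 0" for T e
  proof -
    obtain C where C: "C \<ge> 0" "\<And>p. \<bar>Q p\<bar> \<le> e + C * w p" using Q_modulus[OF \<open>e > 0\<close>] by auto
    define L where "L = M0 + T * (2 * M)"
    have L: "L \<ge> 0" using T M_nonneg real by (simp add: L_def)
    define b where "b R = 2 * e + C * (step_slope / R) * L" for R
    have PRb: "AE t in lborel. 0 < t \<and> t < T \<longrightarrow> \<bar>PR R t\<bar> \<le> b R" if R: "R > 0" for R
      using finite[OF T]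
    proof eventually_elim
      case (elim t)
      show ?case
      proof
        assume "0 < t \<and> t < T"
        with elim have le: "(\<integral>\<^sup>+x. ennreal (w (x, t)) \<partial>lborel) \<le> ennreal L" by (simp add: L_def)
        have iw: "integrable lborel (\<lambda>x. w (x, t))"
          using le by (intro integrableI_bounded) (auto simp: w_nonneg intro: le_less_trans)
        have wL: "(LINT x|lborel. w (x, t)) \<le> L"
          using le nn_integral_eq_integral[OF iw] L w_nonneg by (simp add: ennreal_le_iff)
        have "(LINT x|lborel. \<bar>Q (x, t)\<bar> * \<bar>deriv (cutoff R) x\<bar>)
            \<le> (LINT x|lborel. e * \<bar>deriv (cutoff R) x\<bar> + C * (step_slope / R) * w (x, t))"
        proof (rule integral_mono)
          show "integrable lborel (\<lambda>x. \<bar>Q (x, t)\<bar> * \<bar>deriv (cutoff R) x\<bar>)"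
            using integrable_abs[OF integrable_Q_cutoff[OF R]] by (simp add: abs_mult)
          show "integrable lborel (\<lambda>x. e * \<bar>deriv (cutoff R) x\<bar> + C * (step_slope / R) * w (x, t))"
            using iw integral_deriv_cutoff_abs(1)[OF R] by simp
          fix x
          have "\<bar>Q (x, t)\<bar> * \<bar>deriv (cutoff R) x\<bar> \<le> (e + C * w (x, t)) * \<bar>deriv (cutoff R) x\<bar>"
            by (intro mult_right_mono C) auto
          also have "\<dots> = e * \<bar>deriv (cutoff R) x\<bar> + C * w (x, t) * \<bar>deriv (cutoff R) x\<bar>"
            by (simp add: distrib_right)
          also have "C * w (x, t) * \<bar>deriv (cutoff R) x\<bar> \<le> C * w (x, t) * (step_slope / R)"
            using C(1) w_nonneg by (intro mult_left_mono deriv_cutoff_abs_le' R) auto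
          finally show "\<bar>Q (x, t)\<bar> * \<bar>deriv (cutoff R) x\<bar> \<le> e * \<bar>deriv (cutoff R) x\<bar> + C * (step_slope / R) * w (x, t)"
            by (simp add: mult_ac)
        qed
        also have "\<dots> = e * (LINT x|lborel. \<bar>deriv (cutoff R) x\<bar>) + C * (step_slope / R) * (LINT x|lborel. w (x, t))"
          using iw integral_deriv_cutoff_abs(1)[OF R] by simp
        also have "\<dots> \<le> e * 2 + C * (step_slope / R) * L"
          using \<open>e > 0\<close> C(1) R step_slope(1) wL integral_deriv_cutoff_abs(2)[OF R]
          by (intro add_mono mult_left_mono) auto
        finally show "\<bar>PR R t\<bar> \<le> b R" using PR_abs_le_integral[OF R, of t] by (simp add: b_def)
      qed
    qed
    have b0: "0 \<le> b R" if "R > 0" for R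
      using that \<open>e > 0\<close> C(1) L step_slope(1) by (simp add: b_def)
    have "AE t in lborel. \<forall>n. 0 < t \<and> t < T \<longrightarrow> WR (real (Suc n)) t \<le> M0 + T * b (real (Suc n))"
      by (subst AE_all_countable) (intro allI WR_le T b0 PRb WR0; simp)
    moreover have "(\<lambda>n. M0 + T * b (real (Suc n))) \<longlonglongrightarrow> M0 + T * (2 * e + C * 0 * L)"
    proof -
      have "(\<lambda>n. step_slope / real (Suc n)) \<longlonglongrightarrow> 0"
        using tendsto_mult[OF tendsto_const[of step_slope] LIMSEQ_inverse_real_of_nat] by (simp add: divide_inverse)
      then show ?thesis unfolding b_def by (intro tendsto_intros)
    qed
    ultimately show ?thesis
      using real T \<open>e > 0\<close> by (elim eventually_mono) (auto intro!: nn_integral_w_le[where K = "\<lambda>n. M0 + T * b (real (Suc n))"] simp del: ennreal_plus of_nat_Suc)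
  qed
  \<comment> \<open>Countably many horizons \<open>Suc m\<close> and errors
    \<open>1 / Suc n\<close>, so that one null set serves them all.\<close>
  have "AE t in lborel. \<forall>m n. 0 < t \<and> t < real (Suc m) \<longrightarrow>
      (\<integral>\<^sup>+x. ennreal (w (x, t)) \<partial>lborel) \<le> ennreal (M0 + real (Suc m) * (2 * (1 / real (Suc n))))"
    by (subst AE_all_countable, intro allI, subst AE_all_countable, intro allI small) auto
  then show ?thesis
  proof eventually_elim
    case (elim t)
    show ?case
    proof
      assume "0 < t"
      obtain m where "t < real (Suc m)" using reals_Archimedean2[of t] by (metis less_Suc_eq_le of_nat_less_iff order_less_trans lessI)
      then have "(\<integral>\<^sup>+x. ennreal (w (x, t)) \<partial>lborel) \<le> ennreal (M0 + real (Suc m) * (2 * (1 / real (Suc n))))" for n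
        using elim \<open>0 < t\<close> by blast
      moreover have "(\<lambda>n. ennreal (M0 + real (Suc m) * (2 * (1 / real (Suc n))))) \<longlonglongrightarrow> ennreal (M0 + real (Suc m) * (2 * 0))"
        using LIMSEQ_inverse_real_of_nat by (intro tendsto_ennrealI tendsto_intros) (simp add: divide_inverse)
      ultimately have "(\<integral>\<^sup>+x. ennreal (w (x, t)) \<partial>lborel) \<le> ennreal (M0 + real (Suc m) * (2 * 0))"
        by (intro LIMSEQ_le_const) auto
      then show "(\<integral>\<^sup>+x. ennreal (w (x, t)) \<partial>lborel) \<le> (\<integral>\<^sup>+x. ennreal (w (x, 0)) \<partial>lborel)"
        by (simp add: real)
    qed
  qed
qed simp

end

section \<open>The Kato inequality inside an edge\<close>

definition edge_test :: "real set \<Rightarrow> (real \<Rightarrow> real) \<Rightarrow> bool" where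
  "edge_test E g \<longleftrightarrow> smooth_fun g \<and> (\<forall>x. 0 \<le> g x) \<and> (\<exists>K. compact K \<and> K \<subseteq> E \<and> (\<forall>x. x \<notin> K \<longrightarrow> g x = 0))"

lemma edge_test_test_fun: "edge_test E g \<Longrightarrow> test_fun g"
proof -
  assume g: "edge_test E g"
  then obtain K where K: "compact K" "\<And>x. x \<notin> K \<Longrightarrow> g x = 0" by (auto simp: edge_test_def)
  then obtain r where r: "K \<subseteq> cball 0 r"
    by (meson bounded_subset_ballD ball_subset_cball order_trans compact_imp_bounded)
  have "g x = 0" if "r < \<bar>x\<bar>" for x
  proof -
    have "x \<notin> K" using r that by auto
    then show ?thesis by (rule K(2))
  qed
  with g show ?thesis by (auto simp: test_fun_def edge_test_def)
qed

text \<open>Boundedness at every point, not almost everywhere, makes the class closed under all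
  operations used, composition included; together with bounded support it settles
  integrability.\<close>

definition bounded_borel :: "('a::topological_space \<Rightarrow> real) \<Rightarrow> bool" where
  "bounded_borel f \<longleftrightarrow> f \<in> borel_measurable borel \<and> (\<exists>C. \<forall>x. \<bar>f x\<bar> \<le> C)"

lemma bounded_borelI: "f \<in> borel_measurable borel \<Longrightarrow> (\<And>x. \<bar>f x\<bar> \<le> C) \<Longrightarrow> bounded_borel f"
  by (auto simp: bounded_borel_def)

lemma bounded_borel_measurable: "bounded_borel f \<Longrightarrow> f \<in> borel_measurable borel"
  by (simp add: bounded_borel_def)

lemma bounded_borel_common_bound:
  assumes "bounded_borel f" "bounded_borel g"
  obtains C where "\<And>x. \<bar>f x\<bar> \<le> C" "\<And>x. \<bar>g x\<bar> \<le> C"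
proof -
  obtain C D where "\<And>x. \<bar>f x\<bar> \<le> C" "\<And>x. \<bar>g x\<bar> \<le> D" using assms by (auto simp: bounded_borel_def)
  then show ?thesis by (intro that[of "max C D"]) (simp_all add: le_max_iff_disj)
qed

lemma bounded_borel_mult:
  assumes "bounded_borel f" "bounded_borel g" shows "bounded_borel (\<lambda>x. f x * g x)"
proof -
  obtain C D where "\<And>x. \<bar>f x\<bar> \<le> C" "\<And>x. \<bar>g x\<bar> \<le> D" using assms by (auto simp: bounded_borel_def)
  then have "\<bar>f x * g x\<bar> \<le> C * D" for x
    by (auto simp: abs_mult intro!: mult_mono intro: order_trans[OF abs_ge_zero])
  with assms show ?thesis by (auto simp: bounded_borel_def)
qed

lemma bounded_borel_add:
  assumes "bounded_borel f" "bounded_borel g" shows "bounded_borel (\<lambda>x. f x + g x)"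
proof -
  obtain C D where "\<And>x. \<bar>f x\<bar> \<le> C" "\<And>x. \<bar>g x\<bar> \<le> D" using assms by (auto simp: bounded_borel_def)
  then have "\<bar>f x + g x\<bar> \<le> C + D" for x
    by (meson abs_triangle_ineq add_mono order_trans)
  with assms show ?thesis by (auto simp: bounded_borel_def)
qed

lemma bounded_borel_uminus: "bounded_borel f \<Longrightarrow> bounded_borel (\<lambda>x. - f x)"
  by (auto simp: bounded_borel_def)

lemma bounded_borel_diff:
  assumes "bounded_borel f" "bounded_borel g" shows "bounded_borel (\<lambda>x. f x - g x)"
  using bounded_borel_add[OF assms(1) bounded_borel_uminus[OF assms(2)]] by simp

lemma bounded_borel_compose:
  assumes "bounded_borel f" "g \<in> borel \<rightarrow>\<^sub>M borel" shows "bounded_borel (\<lambda>x. f (g x))"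
  using assms measurable_compose[OF assms(2)] by (auto simp: bounded_borel_def)

lemma bounded_borel_integrable:
  fixes f :: "'a::euclidean_space \<Rightarrow> real"
  assumes "bounded_borel f" "\<And>x. x \<notin> S \<Longrightarrow> f x = 0" "bounded S"
  shows "integrable lborel f"
proof -
  obtain C where "\<And>x. \<bar>f x\<bar> \<le> C" using assms(1) by (auto simp: bounded_borel_def)
  with bounded_borel_measurable[OF assms(1)] show ?thesis
    using assms(2,3) by (rule integrable_bounded_support)
qed

lemma test_fun_bounded_borel:
  assumes "test_fun g" shows "bounded_borel g" "bounded_borel (deriv g)"
proof -
  obtain B where B: "\<And>x. \<bar>g x\<bar> \<le> B" "\<And>x. \<bar>deriv g x\<bar> \<le> B"
    using test_fun_bounds[OF assms] by metis
  show "bounded_borel g" "bounded_borel (deriv g)"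
    by (intro bounded_borelI[OF smooth_fun_measurable B(1)] bounded_borelI[OF smooth_fun_measurable_deriv B(2)] test_fun_smooth assms)+
qed

section \<open>Integrals of product functions over the plane\<close>

lemma nn_integral_lborel_product:
  fixes f g :: "real \<Rightarrow> real"
  assumes [measurable]: "f \<in> borel_measurable borel" "g \<in> borel_measurable borel"
    and f: "\<And>x. 0 \<le> f x" and g: "\<And>x. 0 \<le> g x"
  shows "(\<integral>\<^sup>+p. ennreal (f (fst p) * g (snd p)) \<partial>lborel) = (\<integral>\<^sup>+x. ennreal (f x) \<partial>lborel) * (\<integral>\<^sup>+t. ennreal (g t) \<partial>lborel)"
proof -
  have "(\<integral>\<^sup>+p. ennreal (f (fst p) * g (snd p)) \<partial>lborel)
      = (\<integral>\<^sup>+p. ennreal (f (fst p) * g (snd p)) \<partial>(lborel \<Otimes>\<^sub>M lborel))" by (simp add: lborel_prod)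
  also have "\<dots> = (\<integral>\<^sup>+x. (\<integral>\<^sup>+t. ennreal (f x * g t) \<partial>lborel) \<partial>lborel)"
    by (subst lborel.nn_integral_fst[symmetric]) auto
  also have "\<dots> = (\<integral>\<^sup>+x. ennreal (f x) * (\<integral>\<^sup>+t. ennreal (g t) \<partial>lborel) \<partial>lborel)"
    using f g by (intro nn_integral_cong) (simp add: ennreal_mult nn_integral_cmult)
  also have "\<dots> = (\<integral>\<^sup>+x. ennreal (f x) \<partial>lborel) * (\<integral>\<^sup>+t. ennreal (g t) \<partial>lborel)"
    by (rule nn_integral_multc) simp
  finally show ?thesis .
qed

lemma integral_lborel_product:
  fixes f g :: "real \<Rightarrow> real"
  assumes "integrable lborel f" "integrable lborel g"
  shows "integrable lborel (\<lambda>p. f (fst p) * g (snd p))"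
    "(LINT p|lborel. f (fst p) * g (snd p)) = (LINT x|lborel. f x) * (LINT t|lborel. g t)"
proof -
  have i: "integrable (lborel \<Otimes>\<^sub>M lborel) (\<lambda>(x, t). f x * g t)"
  proof (rule lborel_pair.Fubini_integrable)
    have [measurable]: "f \<in> borel_measurable lborel" "g \<in> borel_measurable lborel"
      using assms by auto
    show "(\<lambda>(x, t). f x * g t) \<in> borel_measurable (lborel \<Otimes>\<^sub>M lborel)" by measurable
  qed (use assms in \<open>auto simp: abs_mult\<close>)
  then show "integrable lborel (\<lambda>p. f (fst p) * g (snd p))"
    by (simp add: lborel_prod case_prod_beta')
  have "(LINT p|lborel. f (fst p) * g (snd p)) = (LINT p|(lborel \<Otimes>\<^sub>M lborel). (case p of (x, t) \<Rightarrow> f x * g t))"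
    by (simp add: lborel_prod case_prod_beta')
  also have "\<dots> = (LINT x|lborel. (LINT t|lborel. f x * g t))"
    using lborel_pair.integral_fst'[OF i] by simp
  finally show "(LINT p|lborel. f (fst p) * g (snd p)) = (LINT x|lborel. f x) * (LINT t|lborel. g t)"
    by simp
qed

text \<open>A third of an error budget, for a coefficient \<open>x\<close> that may be 0; hence the
  added 1.\<close>

lemma fraction_bound:
  fixes e x :: real
  assumes "0 < e" "0 \<le> x"
  shows "0 < e / (3 * (x + 1))" "x * (e / (3 * (x + 1))) \<le> e / 3"
proof -
  show "0 < e / (3 * (x + 1))" using assms by simp
  have "x / (x + 1) * (e / 3) \<le> 1 * (e / 3)" using assms by (intro mult_right_mono) auto
  then show "x * (e / (3 * (x + 1))) \<le> e / 3" by (simp add: ac_simps)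
qed

text \<open>
  Doubling of variables. Testing the inequality for \<open>U\<close> with \<open>\<psi>(x) \<delta>(x - y) \<theta>(t) \<eta>(t - s)\<close> in
  \<open>(x, t)\<close> and the one for \<open>V\<close> with the same function in \<open>(y, s)\<close>, all derivatives of \<open>\<eta>\<close> cancel,
  and those of \<open>\<delta>\<close> do so up to the factor \<open>a(t) - a(s)\<close>, which vanishes unless \<open>0 < t < 2k\<close>.
\<close>

theorem kato_inequality:
  fixes U V :: "real \<times> real \<Rightarrow> real" and A F :: "real \<Rightarrow> real \<Rightarrow> real" and a :: "real \<Rightarrow> real"
  assumes bU: "bounded_borel U" and bV: "bounded_borel V"
    and A: "continuous_on UNIV (\<lambda>z. A (fst z) (snd z))"
    and F: "continuous_on UNIV (\<lambda>z. F (fst z) (snd z))"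
    and a: "a = indicator {0<..}" and E: "open E"
    and hU: "\<And>q \<psi> \<theta>. edge_test E \<psi> \<Longrightarrow> test_fun \<theta> \<Longrightarrow>
      0 \<le> weak_pairing (\<lambda>p. A (U p) (V q)) (\<lambda>p. a (snd p) * F (U p) (V q)) \<psi> \<theta>"
    and hV: "\<And>p \<psi> \<theta>. edge_test E \<psi> \<Longrightarrow> test_fun \<theta> \<Longrightarrow>
      0 \<le> weak_pairing (\<lambda>q. A (U p) (V q)) (\<lambda>q. a (snd q) * F (U p) (V q)) \<psi> \<theta>"
    and \<psi>: "edge_test E \<psi>" and \<theta>: "test_fun \<theta>"
  shows "0 \<le> weak_pairing (\<lambda>p. A (U p) (V p)) (\<lambda>p. a (snd p) * F (U p) (V p)) \<psi> \<theta>"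
proof -
  define g0 where "g0 p = A (U p) (V p) * (\<psi> (fst p) * deriv \<theta> (snd p)) + a (snd p) * F (U p) (V p) * (deriv \<psi> (fst p) * \<theta> (snd p))" for p
  note U [measurable] = bounded_borel_measurable[OF bU] and V [measurable] = bounded_borel_measurable[OF bV]
  obtain M where UM: "\<And>p. \<bar>U p\<bar> \<le> M" and VM: "\<And>p. \<bar>V p\<bar> \<le> M"
    using bounded_borel_common_bound[OF bU bV] by metis
  define S where "S = {-M..M} \<times> {-M..M}"
  have S: "compact S" unfolding S_def by (intro compact_Times compact_Icc)
  have inS: "(U p, V q) \<in> S" for p q using UM[of p] VM[of q] by (auto simp: S_def abs_le_iff)
  obtain K where K: "compact K" "K \<subseteq> E" "\<And>x. x \<notin> K \<Longrightarrow> \<psi> x = 0" using \<psi> by (auto simp: edge_test_def)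
  have \<psi>': "test_fun \<psi>" by (rule edge_test_test_fun[OF \<psi>])
  obtain B1 r1 where B1: "B1 > 0" "r1 > 0" "\<And>x. \<bar>\<psi> x\<bar> \<le> B1" "\<And>x. \<bar>deriv \<psi> x\<bar> \<le> B1"
    "\<And>x. r1 < \<bar>x\<bar> \<Longrightarrow> \<psi> x = 0" "\<And>x. r1 < \<bar>x\<bar> \<Longrightarrow> deriv \<psi> x = 0"
    using test_fun_bounds[OF \<psi>'] by metis
  obtain B2 r2 where B2: "B2 > 0" "r2 > 0" "\<And>x. \<bar>\<theta> x\<bar> \<le> B2" "\<And>x. \<bar>deriv \<theta> x\<bar> \<le> B2"
    "\<And>x. r2 < \<bar>x\<bar> \<Longrightarrow> \<theta> x = 0" "\<And>x. r2 < \<bar>x\<bar> \<Longrightarrow> deriv \<theta> x = 0"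
    using test_fun_bounds[OF \<theta>] by metis
  define B where "B = {-r1..r1} \<times> {-r2..r2}"
  have [measurable]: "B \<in> sets borel" by (simp add: B_def borel_closed closed_Times)
  have bB: "bounded B" by (simp add: B_def bounded_Times)
  define mB where "mB = 4 * r1 * r2"
  have mB: "emeasure lborel B = ennreal mB" "mB \<ge> 0"
  proof -
    have "emeasure lborel B = emeasure lborel {-r1..r1} * emeasure lborel {-r2..r2}"
      unfolding B_def lborel_prod[symmetric] by (intro lborel.emeasure_pair_measure_Times) auto
    then show "emeasure lborel B = ennreal mB"
      using B1(2) B2(2) by (simp add: mB_def ennreal_mult[symmetric] algebra_simps)
  qed (use B1 B2 in \<open>simp add: mB_def\<close>)
  have "compact ((\<lambda>z. F (fst z) (snd z)) ` S)"
    by (intro compact_continuous_image S continuous_on_subset[OF F]) auto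
  then obtain MF where MF: "MF > 0" "\<And>y. y \<in> (\<lambda>z. F (fst z) (snd z)) ` S \<Longrightarrow> norm y \<le> MF"
    by (meson bounded_pos compact_imp_bounded)
  have FM: "\<bar>F (U p) (V q)\<bar> \<le> MF" for p q
    using MF(2)[of "F (U p) (V q)"] inS[of p q] by force
  have "compact ((\<lambda>z. A (fst z) (snd z)) ` S)"
    by (intro compact_continuous_image S continuous_on_subset[OF A]) auto
  then obtain MA where MA: "MA > 0" "\<And>y. y \<in> (\<lambda>z. A (fst z) (snd z)) ` S \<Longrightarrow> norm y \<le> MA"
    by (meson bounded_pos compact_imp_bounded)
  have AM: "\<bar>A (U p) (V q)\<bar> \<le> MA" for p q
    using MA(2)[of "A (U p) (V q)"] inS[of p q] by force
  have [measurable]: "(\<lambda>z. A (fst z) (snd z)) \<in> borel_measurable borel" "(\<lambda>z. F (fst z) (snd z)) \<in> borel_measurable borel"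
    by (intro borel_measurable_continuous_onI A F)+
  have AFm: "(\<lambda>x. A (f x) (g x)) \<in> borel_measurable N" "(\<lambda>x. F (f x) (g x)) \<in> borel_measurable N"
    if [measurable]: "f \<in> borel_measurable N" "g \<in> borel_measurable N" for f g and N :: "'x measure"
  proof -
    have "(\<lambda>x. (\<lambda>z. A (fst z) (snd z)) (f x, g x)) \<in> borel_measurable N" by measurable
    then show "(\<lambda>x. A (f x) (g x)) \<in> borel_measurable N" by simp
    have "(\<lambda>x. (\<lambda>z. F (fst z) (snd z)) (f x, g x)) \<in> borel_measurable N" by measurable
    then show "(\<lambda>x. F (f x) (g x)) \<in> borel_measurable N" by simp
  qed
  have [measurable]: "\<psi> \<in> borel_measurable borel" "deriv \<psi> \<in> borel_measurable borel"
    "\<theta> \<in> borel_measurable borel" "deriv \<theta> \<in> borel_measurable borel"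
    using \<psi>' \<theta> by (auto intro: smooth_fun_measurable smooth_fun_measurable_deriv test_fun_smooth)
  have [measurable]: "a \<in> borel_measurable borel" by (simp add: a)
  have a01: "\<bar>a t\<bar> \<le> 1" for t by (simp add: a indicator_def)
  \<comment> \<open>A safety margin: for x in \<open>K\<close> the kernel centred at x, as a
    function of the second variable, will be supported inside \<open>E\<close> and thus be an
    admissible test function.\<close>
  obtain d0 where d0: "d0 > 0" "\<And>x. x \<in> K \<Longrightarrow> cball x d0 \<subseteq> E"
  proof (cases "K = {}")
    case False
    then obtain d where "d > 0" "{x. infdist x K \<le> d} \<subseteq> E"
      using compact_in_open_separated[OF False K(1) E K(2)] by auto
    moreover have "infdist y K \<le> d" if "x \<in> K" "y \<in> cball x d" for x y
      using infdist_le[OF that(1), of y] that(2) by (simp add: dist_commute)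
    ultimately show ?thesis by (intro that) auto
  qed (auto intro: that[of 1])

  have main: "- (LINT p|lborel. g0 p) \<le> e" if e: "e > 0" for e
  proof -
    \<comment> \<open>The budget \<open>e\<close> is split into thirds. \<open>C1\<close> belongs to
      the two terms in which \<open>V p\<close> has been replaced by \<open>V q\<close>, one with
      \<open>A\<close> and one with \<open>F\<close>; hence the factor 2.\<close>
    define C1 where "C1 = 2 * (B1 * B2)"
    have C1: "C1 > 0" using B1(1) B2(1) by (simp add: C1_def)
    define ea where "ea = e / (3 * (C1 * mB + 1))"
    have ea: "ea > 0" "C1 * ea * mB \<le> e / 3"
      using fraction_bound[OF e, of "C1 * mB"] C1 mB(2) by (auto simp: ea_def mult_ac)
    obtain CA where CA: "CA \<ge> 0" "\<And>p q. p \<in> S \<Longrightarrow> q \<in> S \<Longrightarrow> \<bar>A (fst p) (snd p) - A (fst q) (snd q)\<bar> \<le> ea + CA * dist p q"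
      using compact_continuous_modulus[OF S continuous_on_subset[OF A] ea(1)] by auto
    obtain CF where CF: "CF \<ge> 0" "\<And>p q. p \<in> S \<Longrightarrow> q \<in> S \<Longrightarrow> \<bar>F (fst p) (snd p) - F (fst q) (snd q)\<bar> \<le> ea + CF * dist p q"
      using compact_continuous_modulus[OF S continuous_on_subset[OF F] ea(1)] by auto
    define C where "C = max CA CF"
    have C: "C \<ge> 0" using CA(1) by (simp add: C_def)
    have dAF: "\<bar>A (U p) (V q) - A (U p) (V p)\<bar> \<le> ea + C * \<bar>V q - V p\<bar>"
      "\<bar>F (U p) (V q) - F (U p) (V p)\<bar> \<le> ea + C * \<bar>V q - V p\<bar>" for p q
      using CA(2)[OF inS[of p q] inS[of p p]] CF(2)[OF inS[of p q] inS[of p p]]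
        mult_right_mono[of CA C "\<bar>V q - V p\<bar>"] mult_right_mono[of CF C "\<bar>V q - V p\<bar>"]
      by (auto simp: C_def dist_Pair_Pair dist_real_def)
    define eb where "eb = e / (3 * (C1 * C + 1))"
    have eb: "eb > 0" "C1 * C * eb \<le> e / 3"
      using fraction_bound[OF e, of "C1 * C"] C1 C by (auto simp: eb_def mult_ac)
    obtain d where d: "0 < d" "\<And>k. k \<in> borel_measurable borel \<Longrightarrow> (\<And>z. 0 \<le> k z) \<Longrightarrow>
        (\<integral>\<^sup>+z. ennreal (k z) \<partial>lborel) = 1 \<Longrightarrow> (\<And>z. k z \<noteq> 0 \<Longrightarrow> norm z < d) \<Longrightarrow>
        (\<integral>\<^sup>+x. (\<integral>\<^sup>+y. ennreal (indicator B x * (k (x - y) * \<bar>V y - V x\<bar>)) \<partial>lborel) \<partial>lborel) \<le> ennreal eb"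
      using L1_mollification[OF V VM \<open>B \<in> sets borel\<close> bB eb(1)] by blast
    \<comment> \<open>\<open>2 * h \<le> d0\<close> keeps the kernel within the margin around
      \<open>K\<close>. Half of \<open>d\<close> is left for the time scale, so that the planar
      kernel has radius below \<open>d\<close>.\<close>
    define h where "h = min (d / 4) (d0 / 2)"
    have h: "h > 0" "2 * h \<le> d / 2" "2 * h \<le> d0" using d(1) d0(1) by (auto simp: h_def)
    define \<delta> where "\<delta> = mollifier h"
    have \<delta>s: "smooth_fun \<delta>" by (simp add: \<delta>_def mollifier_smooth)
    have \<delta>0: "\<delta> z = 0" if "z \<le> h \<or> 2 * h \<le> z" for z using mollifier_eq_0[OF h(1) that] by (simp add: \<delta>_def)
    have \<delta>n: "0 \<le> \<delta> z" for z using mollifier_nonneg[OF h(1)] by (simp add: \<delta>_def)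
    have \<delta>t: "test_fun \<delta>"
      unfolding test_fun_def using \<delta>s \<delta>n h(1) by (intro conjI allI exI[of _ "2 * h"] impI \<delta>0) auto
    have \<delta>z: "\<delta> z = 0" "deriv \<delta> z = 0" if "2 * h < \<bar>z\<bar>" for z
    proof -
      have *: "\<delta> z = 0" if "2 * h < \<bar>z\<bar>" for z using that h(1) by (intro \<delta>0) auto
      show "\<delta> z = 0" "deriv \<delta> z = 0" using that * deriv_eq_0_outside[of "2 * h" \<delta> z] by auto
    qed
    have [measurable]: "\<delta> \<in> borel_measurable borel" "deriv \<delta> \<in> borel_measurable borel"
      using \<delta>s by (auto intro: smooth_fun_measurable smooth_fun_measurable_deriv)
    obtain D where D: "(\<integral>\<^sup>+z. ennreal \<bar>deriv \<delta> z\<bar> \<partial>lborel) = ennreal D" "D \<ge> 0"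
    proof -
      obtain b where b: "\<And>z. \<bar>deriv \<delta> z\<bar> \<le> b" using test_fun_bounds[OF \<delta>t] by metis
      have "(\<integral>\<^sup>+z. ennreal \<bar>deriv \<delta> z\<bar> \<partial>lborel) < \<infinity>"
        by (rule nn_integral_less_top_bounded[of _ b "{-2 * h..2 * h}"]) (use b \<delta>z in auto)
      then show ?thesis by (intro that[of "enn2real (\<integral>\<^sup>+z. ennreal \<bar>deriv \<delta> z\<bar> \<partial>lborel)"]) auto
    qed
    define C2 where "C2 = MF * (B1 * B2)"
    have C2: "C2 \<ge> 0" using MF(1) B1(1) B2(1) by (simp add: C2_def)
    \<comment> \<open>The time scale is chosen after the space scale: \<open>D\<close>, the L1 norm
      of the derivative of \<delta>, depends on \<open>h\<close>, and a thin strip of times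
      compensates it once \<open>h\<close> is fixed.\<close>
    define k where "k = min (d / 4) (e / (12 * (C2 * r1 * D + 1)))"
    have cpos: "C2 * r1 * D \<ge> 0" using C2 B1(2) D(2) by simp
    have k: "k > 0" "2 * k \<le> d / 2" "C2 * (2 * r1 * (2 * k)) * D \<le> e / 3"
    proof -
      show "k > 0" "2 * k \<le> d / 2" using d(1) e cpos by (auto simp: k_def intro!: divide_pos_pos)
      have "C2 * (2 * r1 * (2 * k)) * D = 4 * (C2 * r1 * D) * k" by simp
      also have "\<dots> \<le> 4 * (C2 * r1 * D) * (e / (12 * (C2 * r1 * D + 1)))"
        using cpos by (intro mult_left_mono) (auto simp: k_def)
      also have "\<dots> \<le> e / 3" using e cpos by (auto simp: field_simps)
      finally show "C2 * (2 * r1 * (2 * k)) * D \<le> e / 3" .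
    qed
    define \<eta> where "\<eta> = mollifier k"
    have \<eta>s: "smooth_fun \<eta>" by (simp add: \<eta>_def mollifier_smooth)
    have \<eta>0: "\<eta> z = 0" if "z \<le> k \<or> 2 * k \<le> z" for z using mollifier_eq_0[OF k(1) that] by (simp add: \<eta>_def)
    have \<eta>n: "0 \<le> \<eta> z" for z using mollifier_nonneg[OF k(1)] by (simp add: \<eta>_def)
    have \<eta>t: "test_fun \<eta>"
      unfolding test_fun_def using \<eta>s \<eta>n k(1) by (intro conjI allI exI[of _ "2 * k"] impI \<eta>0) auto
    have \<eta>z: "\<eta> z = 0" "deriv \<eta> z = 0" if "2 * k < \<bar>z\<bar>" for z
    proof -
      have *: "\<eta> z = 0" if "2 * k < \<bar>z\<bar>" for z using that k(1) by (intro \<eta>0) auto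
      show "\<eta> z = 0" "deriv \<eta> z = 0" using that * deriv_eq_0_outside[of "2 * k" \<eta> z] by auto
    qed
    have [measurable]: "\<eta> \<in> borel_measurable borel" "deriv \<eta> \<in> borel_measurable borel"
      using \<eta>s by (auto intro: smooth_fun_measurable smooth_fun_measurable_deriv)

    have shift: "smooth_fun (\<lambda>x. g (x - y))" "((\<lambda>x. g (x - y)) has_real_derivative deriv g (x - y)) (at x)"
      "smooth_fun (\<lambda>y. g (x - y))" "((\<lambda>y. g (x - y)) has_real_derivative - deriv g (x - y)) (at y)"
      if "smooth_fun g" for g and x y :: real
    proof -
      show "smooth_fun (\<lambda>x. g (x - y))" "smooth_fun (\<lambda>y. g (x - y))"
        using smooth_fun_affine[OF that, of 1 1 "- y"] smooth_fun_affine[OF that, of 1 "-1" x] by simp_all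
      have "((\<lambda>x. x - y) has_real_derivative 1) (at x)" by (auto intro!: derivative_eq_intros)
      from DERIV_chain2[OF smooth_fun_has_deriv[OF that] this]
      show "((\<lambda>x. g (x - y)) has_real_derivative deriv g (x - y)) (at x)" by simp
      have "((\<lambda>y. x - y) has_real_derivative - 1) (at y)" by (auto intro!: derivative_eq_intros)
      from DERIV_chain2[OF smooth_fun_has_deriv[OF that] this]
      show "((\<lambda>y. g (x - y)) has_real_derivative - deriv g (x - y)) (at y)" by simp
    qed

    \<comment> \<open>\<open>J1\<close> is the integrand of the inequality for \<open>U\<close> at
      fixed \<open>q\<close>, \<open>J2\<close> that of the inequality for \<open>V\<close> at fixed
      \<open>p\<close>, and \<open>J0\<close> the target integrand spread out by the kernel. In
      \<open>J2\<close> the factor \<psi> \<theta> depends on \<open>p\<close> only and is a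
      nonnegative constant for the pairing in \<open>q\<close>.\<close>
    define J1 where "J1 z = A (U (fst z)) (V (snd z)) *
        ((\<psi> (fst (fst z)) * \<delta> (fst (fst z) - fst (snd z))) *
          (deriv \<theta> (snd (fst z)) * \<eta> (snd (fst z) - snd (snd z)) + \<theta> (snd (fst z)) * deriv \<eta> (snd (fst z) - snd (snd z))))
      + a (snd (fst z)) * F (U (fst z)) (V (snd z)) *
        ((deriv \<psi> (fst (fst z)) * \<delta> (fst (fst z) - fst (snd z)) + \<psi> (fst (fst z)) * deriv \<delta> (fst (fst z) - fst (snd z))) *
          (\<theta> (snd (fst z)) * \<eta> (snd (fst z) - snd (snd z))))" for z :: "(real \<times> real) \<times> (real \<times> real)"
    define J2 where "J2 z = (\<psi> (fst (fst z)) * \<theta> (snd (fst z))) * (A (U (fst z)) (V (snd z)) *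
        (\<delta> (fst (fst z) - fst (snd z)) * - deriv \<eta> (snd (fst z) - snd (snd z)))
      + a (snd (snd z)) * F (U (fst z)) (V (snd z)) *
        (- deriv \<delta> (fst (fst z) - fst (snd z)) * \<eta> (snd (fst z) - snd (snd z))))" for z :: "(real \<times> real) \<times> (real \<times> real)"
    define J0 where "J0 z = g0 (fst z) * (\<delta> (fst (fst z) - fst (snd z)) * \<eta> (snd (fst z) - snd (snd z)))"
      for z :: "(real \<times> real) \<times> (real \<times> real)"
    define Z where "Z = ({-r1..r1} \<times> {-r2..r2}) \<times> ({-(r1 + 2 * h)..r1 + 2 * h} \<times> {-(r2 + 2 * k)..r2 + 2 * k})"
    have bZ: "bounded Z" by (simp add: Z_def bounded_Times)
    have offZ: "J1 z = 0 \<and> J2 z = 0 \<and> J0 z = 0" if "z \<notin> Z" for z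
    proof -
      obtain x t y s where z: "z = ((x, t), (y, s))" by (metis surj_pair)
      have "r1 < \<bar>x\<bar> \<or> r2 < \<bar>t\<bar> \<or> 2 * h < \<bar>x - y\<bar> \<or> 2 * k < \<bar>t - s\<bar>"
      proof (rule ccontr)
        assume "\<not> ?thesis"
        then have "z \<in> Z" by (auto simp: z Z_def)
        with that show False by simp
      qed
      then show ?thesis
        unfolding J1_def J2_def J0_def g0_def z fst_conv snd_conv
        by (elim disjE) (simp_all add: B1(5,6) B2(5,6) \<delta>z \<eta>z)
    qed
    have fsm: "(\<lambda>z. fst (fst z)) \<in> borel_measurable (borel :: ((real \<times> real) \<times> (real \<times> real)) measure)"
      "(\<lambda>z. snd (fst z)) \<in> borel_measurable (borel :: ((real \<times> real) \<times> (real \<times> real)) measure)"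
      "(\<lambda>z. fst (snd z)) \<in> borel_measurable (borel :: ((real \<times> real) \<times> (real \<times> real)) measure)"
      "(\<lambda>z. snd (snd z)) \<in> borel_measurable (borel :: ((real \<times> real) \<times> (real \<times> real)) measure)"
      "(\<lambda>z. fst z) \<in> borel_measurable (borel :: ((real \<times> real) \<times> (real \<times> real)) measure)"
      "(\<lambda>z. snd z) \<in> borel_measurable (borel :: ((real \<times> real) \<times> (real \<times> real)) measure)"
      by (intro borel_measurable_continuous_onI continuous_intros)+
    note [measurable] = fsm
    note UVm = measurable_compose[OF fsm(5) U] measurable_compose[OF fsm(5) V] measurable_compose[OF fsm(6) V]
    have atoms_A: "bounded_borel (\<lambda>z. A (U (fst z)) (V (snd z)))" "bounded_borel (\<lambda>z::(real \<times> real) \<times> (real \<times> real). A (U (fst z)) (V (fst z)))"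
      by (intro bounded_borelI[where C = MA] AM AFm UVm)+
    have atoms_F: "bounded_borel (\<lambda>z. F (U (fst z)) (V (snd z)))" "bounded_borel (\<lambda>z::(real \<times> real) \<times> (real \<times> real). F (U (fst z)) (V (fst z)))"
      by (intro bounded_borelI[where C = MF] FM AFm UVm)+
    have atom_a: "bounded_borel a" by (rule bounded_borelI[where C = 1]) (use a01 in auto)
    note bb = test_fun_bounded_borel
    note atoms' = bounded_borel_compose[OF bb(1)[OF \<psi>'] fsm(1)] bounded_borel_compose[OF bb(2)[OF \<psi>'] fsm(1)]
      bounded_borel_compose[OF bb(1)[OF \<theta>] fsm(2)] bounded_borel_compose[OF bb(2)[OF \<theta>] fsm(2)]
      bounded_borel_compose[OF bb(1)[OF \<delta>t] borel_measurable_diff[OF fsm(1,3)]]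
      bounded_borel_compose[OF bb(2)[OF \<delta>t] borel_measurable_diff[OF fsm(1,3)]]
      bounded_borel_compose[OF bb(1)[OF \<eta>t] borel_measurable_diff[OF fsm(2,4)]]
      bounded_borel_compose[OF bb(2)[OF \<eta>t] borel_measurable_diff[OF fsm(2,4)]]
      bounded_borel_compose[OF atom_a fsm(2)] bounded_borel_compose[OF atom_a fsm(4)]
    have bJ: "bounded_borel J1" "bounded_borel J2" "bounded_borel J0"
      unfolding J1_def J2_def J0_def g0_def
      by (rule bounded_borel_add bounded_borel_mult bounded_borel_uminus atoms_A atoms_F atoms')+
    have iJ: "integrable lborel J1" "integrable lborel J2" "integrable lborel J0"
      by (rule bounded_borel_integrable[OF bJ(1) _ bZ] bounded_borel_integrable[OF bJ(2) _ bZ]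
          bounded_borel_integrable[OF bJ(3) _ bZ]; use offZ in blast)+
    have iJ': "integrable (lborel \<Otimes>\<^sub>M lborel) J1" "integrable (lborel \<Otimes>\<^sub>M lborel) J2" "integrable (lborel \<Otimes>\<^sub>M lborel) J0"
      using iJ by (simp_all add: lborel_prod)

    have J1q: "0 \<le> (LINT p|lborel. J1 (p, q))" for q
    proof -
      define f1 where "f1 x = \<psi> x * \<delta> (x - fst q)" for x
      define f2 where "f2 t = \<theta> t * \<eta> (t - snd q)" for t
      have 1: "edge_test E f1"
        using \<psi> K \<delta>n unfolding edge_test_def f1_def
        by (intro conjI smooth_fun_mult shift(1)[OF \<delta>s] exI[of _ K] allI) auto
      have 2: "test_fun f2"
        unfolding f2_def by (intro test_fun_mult \<theta> shift(1)[OF \<eta>s] \<eta>n)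
      have d1: "deriv f1 x = deriv \<psi> x * \<delta> (x - fst q) + \<psi> x * deriv \<delta> (x - fst q)" for x
        unfolding f1_def[abs_def] using DERIV_mult[OF smooth_fun_has_deriv[OF test_fun_smooth[OF \<psi>'], of x] shift(2)[OF \<delta>s, of "fst q" x]]
        by (intro DERIV_imp_deriv) (simp add: mult.commute)
      have d2: "deriv f2 x = deriv \<theta> x * \<eta> (x - snd q) + \<theta> x * deriv \<eta> (x - snd q)" for x
        unfolding f2_def[abs_def] using DERIV_mult[OF smooth_fun_has_deriv[OF test_fun_smooth[OF \<theta>], of x] shift(2)[OF \<eta>s, of "snd q" x]]
        by (intro DERIV_imp_deriv) (simp add: mult.commute)
      show ?thesis
        using hU[OF 1 2, of q] by (simp add: weak_pairing_def d1 d2 f1_def f2_def J1_def)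
    qed
    have "0 \<le> (LINT q|lborel. (LINT p|lborel. J1 (p, q)))"
      by (rule integral_nonneg_AE, rule AE_I2, rule J1q)
    also have "\<dots> = (LINT z|lborel. J1 z)"
      using lborel_pair.integral_snd[of "\<lambda>p q. J1 (p, q)"] iJ'(1) by (simp add: lborel_prod)
    finally have J1i: "0 \<le> (LINT z|lborel. J1 z)" .

    have J2p: "0 \<le> (LINT q|lborel. J2 (p, q))" for p
    proof (cases "fst p \<in> K")
      case False
      then show ?thesis using K(3) by (simp add: J2_def)
    next
      case True
      define f1 where "f1 y = \<delta> (fst p - y)" for y
      define f2 where "f2 s = \<eta> (snd p - s)" for s
      have 1: "edge_test E f1"
        unfolding edge_test_def
      proof (intro conjI exI[of _ "cball (fst p) d0"] allI impI d0(2) True)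
        fix y assume "y \<notin> cball (fst p) d0"
        then show "f1 y = 0" unfolding f1_def using h(3) by (intro \<delta>z(1)) (auto simp: dist_real_def)
      qed (auto simp: f1_def[abs_def] \<delta>n shift(3)[OF \<delta>s])
      have 2: "test_fun f2"
        unfolding test_fun_def
      proof (intro conjI exI[of _ "\<bar>snd p\<bar> + 2 * k"] allI impI)
        fix s assume "\<bar>snd p\<bar> + 2 * k < \<bar>s\<bar>"
        then show "f2 s = 0" unfolding f2_def by (intro \<eta>z(1)) auto
      qed (auto simp: f2_def[abs_def] \<eta>n shift(3)[OF \<eta>s])
      have d1: "deriv f1 y = - deriv \<delta> (fst p - y)" for y
        unfolding f1_def[abs_def] by (rule DERIV_imp_deriv[OF shift(4)[OF \<delta>s]])
      have d2: "deriv f2 s = - deriv \<eta> (snd p - s)" for s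
        unfolding f2_def[abs_def] by (rule DERIV_imp_deriv[OF shift(4)[OF \<eta>s]])
      have "0 \<le> (\<psi> (fst p) * \<theta> (snd p)) * weak_pairing (\<lambda>q. A (U p) (V q)) (\<lambda>q. a (snd q) * F (U p) (V q)) f1 f2"
        using test_fun_nonneg[OF \<psi>'] test_fun_nonneg[OF \<theta>] hV[OF 1 2, of p] by simp
      then show ?thesis
        unfolding J2_def weak_pairing_def fst_conv snd_conv integral_mult_right_zero by (simp add: d1 d2 f1_def f2_def)
    qed
    have "0 \<le> (LINT p|lborel. (LINT q|lborel. J2 (p, q)))"
      by (rule integral_nonneg_AE, rule AE_I2, rule J2p)
    also have "\<dots> = (LINT z|lborel. J2 z)"
      using lborel_pair.integral_fst'[OF iJ'(2)] by (simp add: lborel_prod)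
    finally have J2i: "0 \<le> (LINT z|lborel. J2 z)" .

    define k2 where "k2 z = \<delta> (fst z) * \<eta> (snd z)" for z :: "real \<times> real"
    have [measurable]: "k2 \<in> borel_measurable borel" unfolding k2_def[abs_def] by measurable
    have k2n: "0 \<le> k2 z" for z by (simp add: k2_def \<delta>n \<eta>n)
    have k2i: "(\<integral>\<^sup>+z. ennreal (k2 z) \<partial>lborel) = 1"
      unfolding k2_def using nn_integral_lborel_product[of \<delta> \<eta>] \<delta>n \<eta>n nn_integral_mollifier h(1) k(1)
      by (simp add: \<delta>_def \<eta>_def)
    have k2d: "norm z < d" if "k2 z \<noteq> 0" for z
    proof -
      have "\<not> (fst z \<le> h \<or> 2 * h \<le> fst z)" "\<not> (snd z \<le> k \<or> 2 * k \<le> snd z)"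
        using that \<delta>0 \<eta>0 unfolding k2_def by fastforce+
      then have "\<bar>fst z\<bar> < 2 * h" "\<bar>snd z\<bar> < 2 * k" using h(1) k(1) by auto
      then show ?thesis using norm_Pair_le[of "fst z" "snd z"] h(2) k(2) by simp
    qed
    have k2s: "(\<integral>\<^sup>+q. ennreal (k2 (p - q)) \<partial>lborel) = 1" for p
      using nn_integral_lborel_minus[of "\<lambda>z. ennreal (k2 z)" p] k2i by simp
    have k2l: "(LINT q|lborel. k2 (p - q)) = 1" for p
      using k2s[of p] k2n by (subst integral_eq_nn_integral) auto

    have "(LINT z|lborel. J0 z) = (LINT p|lborel. (LINT q|lborel. J0 (p, q)))"
      using lborel_pair.integral_fst'[OF iJ'(3)] by (simp add: lborel_prod)
    also have "\<dots> = (LINT p|lborel. (LINT q|lborel. g0 p * k2 (p - q)))"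
      by (simp add: J0_def k2_def)
    also have "\<dots> = (LINT p|lborel. g0 p)" by (simp add: k2l)
    finally have J0: "(LINT z|lborel. J0 z) = (LINT p|lborel. g0 p)" .

    define T3 where "T3 = {-r1..r1} \<times> {0<..<2 * k}"
    have [measurable]: "T3 \<in> sets borel" unfolding T3_def borel_prod[symmetric] by (rule pair_measureI) auto
    \<comment> \<open>Three majorants: \<open>b1\<close> has the mass of \<open>B\<close>,
      \<open>b2\<close> is the mollification error of \<open>V\<close>, and \<open>b3\<close>
      carries the derivative of \<delta> on a strip of measure \<open>4 * r1 * k\<close>.\<close>
    define b1 where "b1 p q = indicator B p * k2 (p - q)" for p q
    define b2 where "b2 p q = indicator B p * (k2 (p - q) * \<bar>V q - V p\<bar>)" for p q
    define b3 where "b3 p q = indicator T3 p * (\<bar>deriv \<delta> (fst p - fst q)\<bar> * \<eta> (snd p - snd q))" for p q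
    have bn: "0 \<le> b1 p q" "0 \<le> b2 p q" "0 \<le> b3 p q" for p q
      by (auto simp: b1_def b2_def b3_def k2n \<eta>n)
    have bm: "(\<lambda>z. b1 (fst z) (snd z)) \<in> borel_measurable borel" "(\<lambda>z. b2 (fst z) (snd z)) \<in> borel_measurable borel"
      "(\<lambda>z. b3 (fst z) (snd z)) \<in> borel_measurable borel"
      unfolding b1_def b2_def b3_def by measurable
    note [measurable] = bm
    have pw: "\<bar>J1 z + J2 z - J0 z\<bar> \<le> C1 * ea * b1 (fst z) (snd z) + (C1 * C * b2 (fst z) (snd z) + C2 * b3 (fst z) (snd z))" for z
    proof -
      obtain x t y s where z: "z = ((x, t), (y, s))" by (metis surj_pair)
      define p q where "p = (x, t)" and "q = (y, s)"
      let ?k = "\<delta> (x - y) * \<eta> (t - s)"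
      have k0: "0 \<le> ?k" by (simp add: \<delta>n \<eta>n)
      have k2: "k2 (p - q) = ?k" by (simp add: k2_def p_def q_def)
      have split: "J1 z + J2 z - J0 z = (A (U p) (V q) - A (U p) (V p)) * (\<psi> x * deriv \<theta> t) * ?k
          + a t * (F (U p) (V q) - F (U p) (V p)) * (deriv \<psi> x * \<theta> t) * ?k
          + (a t - a s) * F (U p) (V q) * (\<psi> x * \<theta> t) * (deriv \<delta> (x - y) * \<eta> (t - s))"
        unfolding J1_def J2_def J0_def g0_def z fst_conv snd_conv p_def[symmetric] q_def[symmetric]
        by (simp add: p_def[symmetric] q_def[symmetric]) (simp add: p_def q_def algebra_simps)
      have t1: "\<bar>(A (U p) (V q) - A (U p) (V p)) * (\<psi> x * deriv \<theta> t) * ?k\<bar>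
          \<le> (ea + C * \<bar>V q - V p\<bar>) * ((B1 * B2) * indicator B p) * ?k"
      proof (cases "p \<in> B")
        case True
        have "\<bar>A (U p) (V q) - A (U p) (V p)\<bar> * (\<bar>\<psi> x\<bar> * \<bar>deriv \<theta> t\<bar>) * ?k \<le> (ea + C * \<bar>V q - V p\<bar>) * (B1 * B2) * ?k"
          by (intro mult_right_mono[OF mult_mono[OF dAF(1) mult_mono[OF B1(3) B2(4)]] k0] mult_nonneg_nonneg add_nonneg_nonneg)
            (use ea(1) C B1(1) in simp_all)
        then show ?thesis using True k0 by (simp add: abs_mult \<delta>n \<eta>n)
      next
        case False
        then have "r1 < \<bar>x\<bar> \<or> r2 < \<bar>t\<bar>" by (auto simp: B_def p_def)
        then have "\<psi> x * deriv \<theta> t = 0" using B1(5) B2(6) by auto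
        then show ?thesis using False by simp
      qed
      have t2: "\<bar>a t * (F (U p) (V q) - F (U p) (V p)) * (deriv \<psi> x * \<theta> t) * ?k\<bar>
          \<le> (ea + C * \<bar>V q - V p\<bar>) * ((B1 * B2) * indicator B p) * ?k"
      proof (cases "p \<in> B")
        case True
        have "(\<bar>a t\<bar> * \<bar>F (U p) (V q) - F (U p) (V p)\<bar>) * (\<bar>deriv \<psi> x\<bar> * \<bar>\<theta> t\<bar>) * ?k \<le> (1 * (ea + C * \<bar>V q - V p\<bar>)) * (B1 * B2) * ?k"
          by (intro mult_right_mono[OF mult_mono[OF mult_mono[OF a01 dAF(2)] mult_mono[OF B1(4) B2(3)]] k0] mult_nonneg_nonneg add_nonneg_nonneg)
            (use ea(1) C B1(1) in simp_all)
        then show ?thesis using True k0 by (simp add: abs_mult \<delta>n \<eta>n)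
      next
        case False
        then have "r1 < \<bar>x\<bar> \<or> r2 < \<bar>t\<bar>" by (auto simp: B_def p_def)
        then have "deriv \<psi> x * \<theta> t = 0" using B1(6) B2(5) by auto
        then show ?thesis using False by simp
      qed
      \<comment> \<open>The kernel \<eta> demands k < t - s < 2 k, so s < t, and \<open>a t\<close>
        differs from \<open>a s\<close> only if s \<le> 0 < t. Then t < 2 k, and \<open>p\<close>
        lies in the strip \<open>T3\<close>.\<close>
      have t3: "\<bar>(a t - a s) * F (U p) (V q) * (\<psi> x * \<theta> t) * (deriv \<delta> (x - y) * \<eta> (t - s))\<bar>
          \<le> C2 * b3 p q"
      proof (cases "p \<in> T3 \<or> (a t - a s) * (\<psi> x * \<theta> t) * \<eta> (t - s) = 0")
        case False
        then have "r1 \<ge> \<bar>x\<bar>" using B1(5)[of x] by force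
        moreover have "k < t - s" "t - s < 2 * k" using False \<eta>0[of "t - s"] by force+
        moreover have "(0 < t) \<noteq> (0 < s)" using False by (auto simp: a indicator_def)
        ultimately have "p \<in> T3" using k(1) by (auto simp: p_def T3_def)
        with False show ?thesis by simp
      next
        case True
        show ?thesis
        proof (cases "p \<in> T3")
          case False
          with True have "(a t - a s) * (\<psi> x * \<theta> t) * \<eta> (t - s) = 0" by simp
          then show ?thesis using C2 bn(3)[of p q] by auto
        next
          case True
          have "\<bar>a t - a s\<bar> \<le> 1" by (simp add: a indicator_def)
          then have "\<bar>a t - a s\<bar> * \<bar>F (U p) (V q)\<bar> * (\<bar>\<psi> x\<bar> * \<bar>\<theta> t\<bar>) * (\<bar>deriv \<delta> (x - y)\<bar> * \<eta> (t - s))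
             \<le> 1 * MF * (B1 * B2) * (\<bar>deriv \<delta> (x - y)\<bar> * \<eta> (t - s))"
            by (intro mult_right_mono[OF mult_mono[OF mult_mono[OF _ FM] mult_mono[OF B1(3) B2(3)]]] mult_nonneg_nonneg)
              (use B1(1) MF(1) \<eta>n[of "t - s"] in simp_all)
          then show ?thesis using True \<eta>n[of "t - s"] by (simp add: b3_def C2_def p_def q_def abs_mult)
        qed
      qed
      have "\<bar>J1 z + J2 z - J0 z\<bar> \<le> 2 * ((ea + C * \<bar>V q - V p\<bar>) * ((B1 * B2) * indicator B p) * ?k) + C2 * b3 p q"
        unfolding split using t1 t2 t3 by linarith
      also have "\<dots> = C1 * ea * b1 p q + (C1 * C * b2 p q + C2 * b3 p q)"
        by (simp add: b1_def b2_def k2 C1_def algebra_simps)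
      finally show ?thesis by (simp add: z p_def q_def)
    qed

    have I1: "(\<integral>\<^sup>+p. (\<integral>\<^sup>+q. ennreal (b1 p q) \<partial>lborel) \<partial>lborel) = ennreal mB"
    proof -
      have "(\<integral>\<^sup>+q. ennreal (b1 p q) \<partial>lborel) = indicator B p" for p
        using k2s[of p] by (cases "p \<in> B") (simp_all add: b1_def)
      then show ?thesis by (simp add: mB)
    qed
    have I2: "(\<integral>\<^sup>+p. (\<integral>\<^sup>+q. ennreal (b2 p q) \<partial>lborel) \<partial>lborel) \<le> ennreal eb"
      unfolding b2_def by (intro d(2) k2n k2i k2d) measurable
    have I3: "(\<integral>\<^sup>+p. (\<integral>\<^sup>+q. ennreal (b3 p q) \<partial>lborel) \<partial>lborel) = ennreal (2 * r1 * (2 * k)) * ennreal D"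
    proof -
      have "(\<integral>\<^sup>+q. ennreal (b3 p q) \<partial>lborel) = indicator T3 p * ennreal D" for p
      proof -
        have "(\<integral>\<^sup>+q. ennreal (\<bar>deriv \<delta> (fst p - fst q)\<bar> * \<eta> (snd p - snd q)) \<partial>lborel)
          = (\<integral>\<^sup>+q. (\<lambda>z. ennreal (\<bar>deriv \<delta> (fst z)\<bar> * \<eta> (snd z))) (p - q) \<partial>lborel)" by simp
        also have "\<dots> = (\<integral>\<^sup>+z. ennreal (\<bar>deriv \<delta> (fst z)\<bar> * \<eta> (snd z)) \<partial>lborel)"
          by (rule nn_integral_lborel_minus) measurable
        also have "\<dots> = ennreal D"
          using nn_integral_lborel_product[of "\<lambda>z. \<bar>deriv \<delta> z\<bar>" \<eta>] \<eta>n nn_integral_mollifier[OF k(1)] D(1)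
          by (simp add: \<eta>_def)
        finally show ?thesis by (cases "p \<in> T3") (simp_all add: b3_def)
      qed
      moreover have "emeasure lborel T3 = ennreal (2 * r1 * (2 * k))"
      proof -
        have "emeasure lborel T3 = emeasure lborel {-r1..r1} * emeasure lborel {0<..<2 * k}"
          unfolding T3_def lborel_prod[symmetric] by (intro lborel.emeasure_pair_measure_Times) auto
        then show ?thesis using B1(2) k(1) by (simp add: ennreal_mult[symmetric])
      qed
      ultimately show ?thesis by (simp add: nn_integral_multc)
    qed
    have "- (LINT p|lborel. g0 p) \<le> (LINT z|lborel. J1 z) + (LINT z|lborel. J2 z) - (LINT z|lborel. J0 z)"
      using J1i J2i J0 by simp
    also have "\<dots> = (LINT z|lborel. J1 z + J2 z - J0 z)" using iJ by simp
    also have "\<dots> \<le> (LINT z|lborel. \<bar>J1 z + J2 z - J0 z\<bar>)"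
      using iJ by (intro integral_mono) auto
    finally have "ennreal (- (LINT p|lborel. g0 p)) \<le> ennreal (LINT z|lborel. \<bar>J1 z + J2 z - J0 z\<bar>)" by (rule ennreal_leI)
    also have "\<dots> \<le> (\<integral>\<^sup>+z. ennreal \<bar>J1 z + J2 z - J0 z\<bar> \<partial>lborel)"
      by (rule ennreal_integral_le_nn_integral) simp
    also have "\<dots> \<le> (\<integral>\<^sup>+z. ennreal (C1 * ea) * ennreal (b1 (fst z) (snd z)) + (ennreal (C1 * C) * ennreal (b2 (fst z) (snd z)) + ennreal C2 * ennreal (b3 (fst z) (snd z))) \<partial>lborel)"
    proof (rule nn_integral_mono)
      fix z
      have "ennreal \<bar>J1 z + J2 z - J0 z\<bar> \<le> ennreal (C1 * ea * b1 (fst z) (snd z) + (C1 * C * b2 (fst z) (snd z) + C2 * b3 (fst z) (snd z)))"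
        by (rule ennreal_leI[OF pw])
      also have "\<dots> = ennreal (C1 * ea) * ennreal (b1 (fst z) (snd z)) + (ennreal (C1 * C) * ennreal (b2 (fst z) (snd z)) + ennreal C2 * ennreal (b3 (fst z) (snd z)))"
        using bn C1 C C2 ea(1) by (simp add: ennreal_mult[symmetric] ennreal_plus[symmetric] del: ennreal_plus)
      finally show "ennreal \<bar>J1 z + J2 z - J0 z\<bar> \<le> \<dots>" .
    qed
    also have "\<dots> = ennreal (C1 * ea) * (\<integral>\<^sup>+z. ennreal (b1 (fst z) (snd z)) \<partial>lborel)
        + (ennreal (C1 * C) * (\<integral>\<^sup>+z. ennreal (b2 (fst z) (snd z)) \<partial>lborel) + ennreal C2 * (\<integral>\<^sup>+z. ennreal (b3 (fst z) (snd z)) \<partial>lborel))"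
      by (simp add: nn_integral_add nn_integral_cmult)
    also have "\<dots> = ennreal (C1 * ea) * (\<integral>\<^sup>+p. (\<integral>\<^sup>+q. ennreal (b1 p q) \<partial>lborel) \<partial>lborel)
        + (ennreal (C1 * C) * (\<integral>\<^sup>+p. (\<integral>\<^sup>+q. ennreal (b2 p q) \<partial>lborel) \<partial>lborel) + ennreal C2 * (\<integral>\<^sup>+p. (\<integral>\<^sup>+q. ennreal (b3 p q) \<partial>lborel) \<partial>lborel))"
    proof -
      have *: "(\<integral>\<^sup>+z. ennreal (b (fst z) (snd z)) \<partial>lborel) = (\<integral>\<^sup>+p. (\<integral>\<^sup>+q. ennreal (b p q) \<partial>lborel) \<partial>lborel)"
        if [measurable]: "(\<lambda>z. b (fst z) (snd z)) \<in> borel_measurable borel" for b :: "real \<times> real \<Rightarrow> real \<times> real \<Rightarrow> real"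
      proof -
        have "(\<lambda>z. ennreal (b (fst z) (snd z))) \<in> borel_measurable (lborel \<Otimes>\<^sub>M lborel)"
          by (simp add: lborel_prod)
        from lborel.nn_integral_fst[OF this] show ?thesis by (simp add: lborel_prod)
      qed
      show ?thesis by (simp only: *[OF bm(1)] *[OF bm(2)] *[OF bm(3)])
    qed
    also have "\<dots> \<le> ennreal (C1 * ea) * ennreal mB + (ennreal (C1 * C) * ennreal eb + ennreal C2 * (ennreal (2 * r1 * (2 * k)) * ennreal D))"
      unfolding I1 I3 by (intro add_mono mult_left_mono I2 order_refl) auto
    also have "\<dots> = ennreal (C1 * ea * mB + (C1 * C * eb + C2 * (2 * r1 * (2 * k)) * D))"
      using C1 ea(1) mB(2) C eb(1) C2 B1(2) k(1) D(2)
      by (simp add: ennreal_mult[symmetric] ennreal_plus[symmetric] mult.assoc del: ennreal_plus)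
    also have "\<dots> \<le> ennreal e"
      using ea(2) eb(2) k(3) by (intro ennreal_leI) simp
    finally show ?thesis using e by (simp add: ennreal_le_iff)
  qed
  have "- (LINT p|lborel. g0 p) \<le> 0" by (rule field_le_epsilon) (use main in simp)
  then show ?thesis by (simp add: weak_pairing_def g0_def)
qed

section \<open>Weak pairings and traces at the vertex\<close>

lemma test_product_bounded_borel:
  assumes "test_fun \<psi>" "test_fun \<theta>"
  shows "bounded_borel (\<lambda>p. \<psi> (fst p) * deriv \<theta> (snd p))" "bounded_borel (\<lambda>p. deriv \<psi> (fst p) * \<theta> (snd p))"
  by (intro bounded_borel_mult bounded_borel_compose[OF test_fun_bounded_borel(1) measurable_fst_snd_borel(1)]
      bounded_borel_compose[OF test_fun_bounded_borel(2) measurable_fst_snd_borel(1)]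
      bounded_borel_compose[OF test_fun_bounded_borel(1) measurable_fst_snd_borel(2)]
      bounded_borel_compose[OF test_fun_bounded_borel(2) measurable_fst_snd_borel(2)] assms)+

lemma weak_pairing_integrable:
  assumes "bounded_borel H" "test_fun \<psi>" "test_fun \<theta>"
  shows "integrable lborel (\<lambda>p. H p * (\<psi> (fst p) * deriv \<theta> (snd p)))"
    "integrable lborel (\<lambda>p. H p * (deriv \<psi> (fst p) * \<theta> (snd p)))"
proof -
  obtain r where r: "\<And>x. r < \<bar>x\<bar> \<Longrightarrow> \<psi> x = 0" "\<And>x. r < \<bar>x\<bar> \<Longrightarrow> deriv \<psi> x = 0"
    using test_fun_bounds[OF assms(2)] by metis
  obtain s where s: "\<And>x. s < \<bar>x\<bar> \<Longrightarrow> \<theta> x = 0" "\<And>x. s < \<bar>x\<bar> \<Longrightarrow> deriv \<theta> x = 0"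
    using test_fun_bounds[OF assms(3)] by metis
  have out: "r < \<bar>fst p\<bar> \<or> s < \<bar>snd p\<bar>" if "p \<notin> {-r..r} \<times> {-s..s}" for p
    using that by (cases p) auto
  have b: "bounded ({-r..r} \<times> {-s..s})" by (intro bounded_Times) auto
  show "integrable lborel (\<lambda>p. H p * (\<psi> (fst p) * deriv \<theta> (snd p)))"
  proof (rule bounded_borel_integrable[OF bounded_borel_mult[OF assms(1) test_product_bounded_borel(1)[OF assms(2,3)]] _ b])
    fix p assume "p \<notin> {-r..r} \<times> {-s..s}"
    from out[OF this] show "H p * (\<psi> (fst p) * deriv \<theta> (snd p)) = 0" using r s by auto
  qed
  show "integrable lborel (\<lambda>p. H p * (deriv \<psi> (fst p) * \<theta> (snd p)))"
  proof (rule bounded_borel_integrable[OF bounded_borel_mult[OF assms(1) test_product_bounded_borel(2)[OF assms(2,3)]] _ b])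
    fix p assume "p \<notin> {-r..r} \<times> {-s..s}"
    from out[OF this] show "H p * (deriv \<psi> (fst p) * \<theta> (snd p)) = 0" using r s by auto
  qed
qed

lemma weak_pairing_split:
  assumes "bounded_borel H" "bounded_borel L" "test_fun \<psi>" "test_fun \<theta>"
  shows "weak_pairing H L \<psi> \<theta> = (LINT p|lborel. H p * (\<psi> (fst p) * deriv \<theta> (snd p)))
    + (LINT p|lborel. L p * (deriv \<psi> (fst p) * \<theta> (snd p)))"
  unfolding weak_pairing_def using weak_pairing_integrable assms by (intro Bochner_Integration.integral_add)

lemma weak_pairing_add:
  assumes "bounded_borel H" "bounded_borel L" "bounded_borel H'" "bounded_borel L'" "test_fun \<psi>" "test_fun \<theta>"
  shows "weak_pairing (\<lambda>p. H p + H' p) (\<lambda>p. L p + L' p) \<psi> \<theta> = weak_pairing H L \<psi> \<theta> + weak_pairing H' L' \<psi> \<theta>"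
  by (simp add: weak_pairing_split weak_pairing_integrable assms bounded_borel_add distrib_right)

lemma weak_pairing_cmult:
  "weak_pairing (\<lambda>p. m * H p) (\<lambda>p. m * L p) \<psi> \<theta> = m * weak_pairing H L \<psi> \<theta>"
  unfolding weak_pairing_def by (simp add: mult.assoc distrib_left[symmetric])

lemma bounded_borel_sum:
  assumes "finite I" "\<And>k. k \<in> I \<Longrightarrow> bounded_borel (H k)"
  shows "bounded_borel (\<lambda>p. \<Sum>k\<in>I. H k p)"
  using assms by (induction I rule: finite_induct) (auto intro!: bounded_borel_add bounded_borelI[of "\<lambda>_. 0" 0])

lemma weak_pairing_sum:
  assumes "finite I" "\<And>k. k \<in> I \<Longrightarrow> bounded_borel (H k)" "\<And>k. k \<in> I \<Longrightarrow> bounded_borel (L k)"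
    and "test_fun \<psi>" "test_fun \<theta>"
  shows "weak_pairing (\<lambda>p. \<Sum>k\<in>I. H k p) (\<lambda>p. \<Sum>k\<in>I. L k p) \<psi> \<theta> = (\<Sum>k\<in>I. weak_pairing (H k) (L k) \<psi> \<theta>)"
  using assms(1-3)
proof (induction I rule: finite_induct)
  case (insert k I)
  then show ?case
    using assms(4,5) by (simp add: weak_pairing_add bounded_borel_sum)
qed (simp add: weak_pairing_def)

section \<open>Orientation of the edges, and constants tested against cutoffs\<close>

lemma integral_deriv_test_fun:
  assumes "test_fun \<theta>"
  shows "integrable lborel (deriv \<theta>)" "(LINT t|lborel. deriv \<theta> t) = 0"
proof -
  obtain r where r: "r > 0" "\<And>x. r < \<bar>x\<bar> \<Longrightarrow> \<theta> x = 0" "\<And>x. r < \<bar>x\<bar> \<Longrightarrow> deriv \<theta> x = 0"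
    using test_fun_bounds[OF assms] by metis
  show "integrable lborel (deriv \<theta>)"
  proof (rule bounded_borel_integrable[OF test_fun_bounded_borel(2)[OF assms], of "{-r..r}"])
    show "deriv \<theta> x = 0" if "x \<notin> {-r..r}" for x using that by (intro r(3)) auto
  qed auto
  have "(LINT t|lborel. deriv \<theta> t) = (LINT t|lborel. deriv \<theta> t * indicator {-(r+1)..r+1} t)"
  proof (intro Bochner_Integration.integral_cong refl)
    fix t
    show "deriv \<theta> t = deriv \<theta> t * indicator {-(r+1)..r+1} t"
      using r(3)[of t] by (cases "r < \<bar>t\<bar>") (auto simp: indicator_def)
  qed
  also have "\<dots> = \<theta> (r + 1) - \<theta> (- (r + 1))"
    using r(1) smooth_fun_continuous[OF smooth_fun_deriv[OF test_fun_smooth[OF assms]], of UNIV]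
    by (intro integral_FTC_Icc_real smooth_fun_has_deriv[OF test_fun_smooth[OF assms]])
      (auto simp: continuous_on_eq_continuous_at)
  also have "\<dots> = 0" using r(1) by (simp add: r(2))
  finally show "(LINT t|lborel. deriv \<theta> t) = 0" .
qed

text \<open>The factor of the flux. With it, data continued constantly to negative times satisfy the
  equation there trivially, and the past contributes the initial term alone.\<close>

definition future :: "real \<Rightarrow> real" where
  "future = indicator {0<..}"

lemma future_simps [simp]: "0 < t \<Longrightarrow> future t = 1" "t \<le> 0 \<Longrightarrow> future t = 0"
  by (auto simp: future_def)

lemma future_bounded_borel: "bounded_borel future"
  by (rule bounded_borelI[of _ 1]) (auto simp: future_def indicator_def)

lemma future_measurable [measurable]: "future \<in> borel_measurable borel"
  by (rule bounded_borel_measurable[OF future_bounded_borel])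

text \<open>On edge \<open>k\<close> the number \<open>orient k * x\<close> is the distance to the
  vertex, so incoming and outgoing edges can be treated alike. As a weight it turns the balance at
  the vertex into one signed sum.\<close>

definition orient :: "int \<Rightarrow> real" where
  "orient k = (if k < 0 then - 1 else 1)"

lemma edge_measurable [measurable]: "edge k \<in> sets borel" "edge k \<in> sets lborel"
  by (auto simp: edge_def)

lemma edge_bounded_borel: "bounded_borel (\<lambda>p::real \<times> real. indicator (edge k) (fst p) :: real)"
  by (rule bounded_borel_compose[OF bounded_borelI[of "indicator (edge k)" 1] measurable_fst_snd_borel(1)])
    (auto simp: indicator_def)

lemma future_snd_bounded_borel: "bounded_borel (\<lambda>p::real \<times> real. future (snd p))"
  by (rule bounded_borel_compose[OF future_bounded_borel measurable_fst_snd_borel(2)])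

lemma const_bounded_borel: "bounded_borel (\<lambda>p. m)"
  by (rule bounded_borelI[of _ "\<bar>m\<bar>"]) auto

lemma edge_open: "open (edge k)" by (auto simp: edge_def)

lemma orient_edge: "x \<in> edge k \<Longrightarrow> 0 < orient k * x"
  by (auto simp: edge_def orient_def split: if_splits)

lemma edge_iff_orient: "x \<in> edge k \<longleftrightarrow> 0 < orient k * x"
  by (auto simp: edge_def orient_def)

lemma orient_sq: "orient k * orient k = 1" "\<bar>orient k\<bar> = 1"
  by (auto simp: orient_def)

lemma deriv_cutoff_edge:
  assumes "R > 0" "x \<in> edge k"
  shows "deriv (cutoff R) x = - orient k * mollifier R (orient k * x)"
  using assms mollifier_eq_0[of R x] mollifier_eq_0[of R "- x"]
  by (auto simp: deriv_cutoff edge_def orient_def split: if_splits)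

lemma mollifier_off_edge:
  assumes "R > 0" "x \<notin> edge k"
  shows "mollifier R (orient k * x) = 0"
  using assms edge_iff_orient[of x k] by (intro mollifier_eq_0) auto

text \<open>The cutoff decreases with the distance from the vertex, whence the sign. The mollifier
  of \<open>orient k * x\<close> vanishes off the edge, so the right-hand side carries no
  indicator.\<close>

lemma deriv_cutoff_on_edge:
  "R > 0 \<Longrightarrow> indicator (edge k) x * deriv (cutoff R) x = - orient k * mollifier R (orient k * x)"
  by (cases "x \<in> edge k") (auto simp: deriv_cutoff_edge mollifier_off_edge)

lemma integral_mollifier_orient:
  assumes "h > 0"
  shows "integrable lborel (\<lambda>x. mollifier h (orient k * x))" "(LINT x|lborel. mollifier h (orient k * x)) = 1"
    "(\<integral>\<^sup>+x. ennreal (mollifier h (orient k * x)) \<partial>lborel) = 1"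
proof -
  show 1: "integrable lborel (\<lambda>x. mollifier h (orient k * x))" "(LINT x|lborel. mollifier h (orient k * x)) = 1"
    using integral_mollifier[OF assms] integral_mollifier_uminus[OF assms] by (auto simp: orient_def)
  then show "(\<integral>\<^sup>+x. ennreal (mollifier h (orient k * x)) \<partial>lborel) = 1"
    using nn_integral_eq_integral[OF 1(1)] mollifier_nonneg[OF assms] by simp
qed

lemma integrable_future_test:
  assumes "bounded_borel q" "test_fun \<theta>"
  shows "integrable lborel (\<lambda>t. future t * q t * \<theta> t)"
proof -
  obtain r where r: "\<And>x. r < \<bar>x\<bar> \<Longrightarrow> \<theta> x = 0"
    using test_fun_bounds[OF assms(2)] by metis
  show ?thesis
  proof (rule bounded_borel_integrable[of _ "{-r..r}"])
    show "bounded_borel (\<lambda>t. future t * q t * \<theta> t)"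
      by (intro bounded_borel_mult future_bounded_borel assms(1) test_fun_bounded_borel(1)[OF assms(2)])
    show "future x * q x * \<theta> x = 0" if "x \<notin> {-r..r}" for x
    proof -
      have "r < \<bar>x\<bar>" using that by auto
      then show ?thesis by (simp add: r)
    qed
  qed simp
qed

text \<open>The term with \<open>m\<close> drops out since the time derivative integrates to 0. On
  an edge the derivative of the cutoff integrates to \<open>- orient k\<close>, so constants leave a
  contribution that does not depend on \<open>R\<close>.\<close>

lemma weak_pairing_cutoff_const:
  assumes "R > 0" "test_fun \<theta>"
  shows "weak_pairing (\<lambda>p. m * indicator (edge k) (fst p)) (\<lambda>p. m' * (indicator (edge k) (fst p) * future (snd p))) (cutoff R) \<theta>
    = - (orient k * m' * (LINT t|lborel. future t * \<theta> t))"
proof -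
  note b = edge_bounded_borel and bf = future_snd_bounded_borel and bc = const_bounded_borel
  have i1: "integrable lborel (\<lambda>x. m * indicator (edge k) x * cutoff R x)"
  proof (rule bounded_borel_integrable[of _ "{-2 * R..2 * R}"])
    show "bounded_borel (\<lambda>x. m * indicator (edge k) x * cutoff R x)"
      by (intro bounded_borel_mult bc test_fun_bounded_borel(1) cutoff_test_fun assms bounded_borelI[of "indicator (edge k)" 1])
        (auto simp: indicator_def)
    show "m * indicator (edge k) x * cutoff R x = 0" if "x \<notin> {-2 * R..2 * R}" for x
    proof -
      have "2 * R \<le> \<bar>x\<bar>" using that by auto
      then show ?thesis using cutoff_eq_0[OF assms(1)] by simp
    qed
  qed simp
  have i2: "integrable lborel (\<lambda>t. future t * \<theta> t)"
    using integrable_future_test[OF bc[of 1] assms(2)] by simp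
  have "weak_pairing (\<lambda>p. m * indicator (edge k) (fst p)) (\<lambda>p. m' * (indicator (edge k) (fst p) * future (snd p))) (cutoff R) \<theta>
    = (LINT p|lborel. m * indicator (edge k) (fst p) * (cutoff R (fst p) * deriv \<theta> (snd p)))
    + (LINT p|lborel. m' * (indicator (edge k) (fst p) * future (snd p)) * (deriv (cutoff R) (fst p) * \<theta> (snd p)))"
    by (intro weak_pairing_split bounded_borel_mult b bf bc cutoff_test_fun assms)
  also have "(LINT p|lborel. m * indicator (edge k) (fst p) * (cutoff R (fst p) * deriv \<theta> (snd p))) = 0"
    using integral_lborel_product(2)[OF i1 integral_deriv_test_fun(1)[OF assms(2)]] integral_deriv_test_fun(2)[OF assms(2)]
    by (simp add: mult.assoc)
  also have "(LINT p|lborel. m' * (indicator (edge k) (fst p) * future (snd p)) * (deriv (cutoff R) (fst p) * \<theta> (snd p)))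
    = (LINT p|lborel. (- orient k * m' * mollifier R (orient k * fst p)) * (future (snd p) * \<theta> (snd p)))"
  proof (intro Bochner_Integration.integral_cong refl)
    fix p :: "real \<times> real"
    have "m' * (indicator (edge k) (fst p) * future (snd p)) * (deriv (cutoff R) (fst p) * \<theta> (snd p))
       = m' * (indicator (edge k) (fst p) * deriv (cutoff R) (fst p)) * (future (snd p) * \<theta> (snd p))" by simp
    then show "m' * (indicator (edge k) (fst p) * future (snd p)) * (deriv (cutoff R) (fst p) * \<theta> (snd p))
       = (- orient k * m' * mollifier R (orient k * fst p)) * (future (snd p) * \<theta> (snd p))"
      by (simp add: deriv_cutoff_on_edge[OF assms(1)])
  qed
  also have "\<dots> = (LINT x|lborel. - orient k * m' * mollifier R (orient k * x)) * (LINT t|lborel. future t * \<theta> t)"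
    by (rule integral_lborel_product(2)) (use integral_mollifier_orient(1)[OF assms(1)] i2 in auto)
  also have "\<dots> = - (orient k * m' * (LINT t|lborel. future t * \<theta> t))"
    using integral_mollifier_orient(1,2)[OF assms(1), of k] by simp
  finally show ?thesis by simp
qed

text \<open>The strong trace for Borel functions, phrased with nonnegative integrals so that
  majorants and sums raise no question of integrability. The quantifiers are those of an essential
  limit at the vertex.\<close>

definition edge_trace :: "real set \<Rightarrow> (real \<times> real \<Rightarrow> real) \<Rightarrow> (real \<Rightarrow> real) \<Rightarrow> bool" where
  "edge_trace E Q q \<longleftrightarrow> (\<forall>T>0. \<forall>e>0. \<exists>d>0. AE x in lborel. x \<in> E \<and> \<bar>x\<bar> < d \<longrightarrow>
    (\<integral>\<^sup>+t. ennreal (indicator {0<..<T} t * \<bar>Q (x, t) - q t\<bar>) \<partial>lborel) \<le> ennreal e)"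

lemma edge_trace_const: "edge_trace E (\<lambda>_. c) (\<lambda>_. c)"
  unfolding edge_trace_def by (auto intro!: exI[of _ 1])

text \<open>On compact sets a continuous \<open>F\<close> varies by at most a small constant
  \<open>ea\<close> plus a multiple of the distance of its arguments. Over (0, T) the constant adds
  up to e / 2, and each of the two arguments contributes at most e / 4.\<close>

lemma edge_trace_compose:
  fixes F :: "real \<Rightarrow> real \<Rightarrow> real"
  assumes F: "continuous_on UNIV (\<lambda>z. F (fst z) (snd z))"
    and b: "bounded_borel U" "bounded_borel V" "bounded_borel u" "bounded_borel v"
    and U: "edge_trace E U u" and V: "edge_trace E V v"
  shows "edge_trace E (\<lambda>p. F (U p) (V p)) (\<lambda>t. F (u t) (v t))"
  unfolding edge_trace_def
proof (intro allI impI)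
  fix T e :: real assume T: "T > 0" and e: "e > 0"
  note [measurable] = b[THEN bounded_borel_measurable]
  obtain M where M: "\<And>p. \<bar>U p\<bar> \<le> M" "\<And>p. \<bar>V p\<bar> \<le> M" "\<And>t. \<bar>u t\<bar> \<le> M" "\<And>t. \<bar>v t\<bar> \<le> M"
  proof -
    obtain C where "\<And>p. \<bar>U p\<bar> \<le> C" "\<And>p. \<bar>V p\<bar> \<le> C" using bounded_borel_common_bound[OF b(1,2)] by metis
    moreover obtain D where "\<And>t. \<bar>u t\<bar> \<le> D" "\<And>t. \<bar>v t\<bar> \<le> D" using bounded_borel_common_bound[OF b(3,4)] by metis
    ultimately show ?thesis by (intro that[of "max C D"]) (simp_all add: le_max_iff_disj)
  qed
  define S where "S = {-M..M} \<times> {-M..M}"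
  have S: "compact S" unfolding S_def by (intro compact_Times compact_Icc)
  define ea where "ea = e / (2 * T)"
  have ea: "ea > 0" using e T by (simp add: ea_def)
  obtain C where C: "C \<ge> 0" "\<And>p q. p \<in> S \<Longrightarrow> q \<in> S \<Longrightarrow> \<bar>F (fst p) (snd p) - F (fst q) (snd q)\<bar> \<le> ea + C * dist p q"
    using compact_continuous_modulus[OF S continuous_on_subset[OF F] ea] by auto
  define eb where "eb = e / (4 * (C + 1))"
  have eb: "eb > 0" "C * eb \<le> e / 4"
    using e C(1) by (auto simp: eb_def field_simps)
  obtain d1 where d1: "d1 > 0" "AE x in lborel. x \<in> E \<and> \<bar>x\<bar> < d1 \<longrightarrow>
    (\<integral>\<^sup>+t. ennreal (indicator {0<..<T} t * \<bar>U (x, t) - u t\<bar>) \<partial>lborel) \<le> ennreal eb"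
    using U T eb(1) unfolding edge_trace_def by blast
  obtain d2 where d2: "d2 > 0" "AE x in lborel. x \<in> E \<and> \<bar>x\<bar> < d2 \<longrightarrow>
    (\<integral>\<^sup>+t. ennreal (indicator {0<..<T} t * \<bar>V (x, t) - v t\<bar>) \<partial>lborel) \<le> ennreal eb"
    using V T eb(1) unfolding edge_trace_def by blast
  have "AE x in lborel. x \<in> E \<and> \<bar>x\<bar> < min d1 d2 \<longrightarrow>
    (\<integral>\<^sup>+t. ennreal (indicator {0<..<T} t * \<bar>F (U (x, t)) (V (x, t)) - F (u t) (v t)\<bar>) \<partial>lborel) \<le> ennreal e"
    using d1(2) d2(2)
  proof eventually_elim
    case (elim x)
    show ?case
    proof
      assume x: "x \<in> E \<and> \<bar>x\<bar> < min d1 d2"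
      have "(\<integral>\<^sup>+t. ennreal (indicator {0<..<T} t * \<bar>F (U (x, t)) (V (x, t)) - F (u t) (v t)\<bar>) \<partial>lborel)
        \<le> (\<integral>\<^sup>+t. ennreal ea * indicator {0<..<T} t + (ennreal C * ennreal (indicator {0<..<T} t * \<bar>U (x, t) - u t\<bar>)
            + ennreal C * ennreal (indicator {0<..<T} t * \<bar>V (x, t) - v t\<bar>)) \<partial>lborel)"
      proof (rule nn_integral_mono)
        fix t
        have "\<bar>F (U (x, t)) (V (x, t)) - F (u t) (v t)\<bar> \<le> ea + C * dist (U (x, t), V (x, t)) (u t, v t)"
          using C(2)[of "(U (x, t), V (x, t))" "(u t, v t)"] M by (auto simp: S_def abs_le_iff minus_le_iff)
        also have "dist (U (x, t), V (x, t)) (u t, v t) \<le> \<bar>U (x, t) - u t\<bar> + \<bar>V (x, t) - v t\<bar>"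
          using sqrt_sum_squares_le_sum_abs[of "dist (U (x, t)) (u t)" "dist (V (x, t)) (v t)"]
          by (simp add: dist_Pair_Pair dist_real_def)
        finally have "indicator {0<..<T} t * \<bar>F (U (x, t)) (V (x, t)) - F (u t) (v t)\<bar>
            \<le> indicator {0<..<T} t * (ea + C * (\<bar>U (x, t) - u t\<bar> + \<bar>V (x, t) - v t\<bar>))"
          using C(1) by (auto simp: indicator_def mult_left_mono)
        then have "ennreal (indicator {0<..<T} t * \<bar>F (U (x, t)) (V (x, t)) - F (u t) (v t)\<bar>)
            \<le> ennreal (indicator {0<..<T} t * (ea + C * (\<bar>U (x, t) - u t\<bar> + \<bar>V (x, t) - v t\<bar>)))" by (rule ennreal_leI)
        also have "\<dots> = ennreal ea * indicator {0<..<T} t + (ennreal C * ennreal (indicator {0<..<T} t * \<bar>U (x, t) - u t\<bar>)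
            + ennreal C * ennreal (indicator {0<..<T} t * \<bar>V (x, t) - v t\<bar>))"
          using C(1) ea by (cases "t \<in> {0<..<T}") (simp_all add: ennreal_mult[symmetric] ennreal_plus[symmetric] distrib_left del: ennreal_plus)
        finally show "ennreal (indicator {0<..<T} t * \<bar>F (U (x, t)) (V (x, t)) - F (u t) (v t)\<bar>) \<le> \<dots>" .
      qed
      also have "\<dots> = ennreal ea * ennreal T + (ennreal C * (\<integral>\<^sup>+t. ennreal (indicator {0<..<T} t * \<bar>U (x, t) - u t\<bar>) \<partial>lborel)
          + ennreal C * (\<integral>\<^sup>+t. ennreal (indicator {0<..<T} t * \<bar>V (x, t) - v t\<bar>) \<partial>lborel))"
        using T by (simp add: nn_integral_add nn_integral_cmult)
      also have "\<dots> \<le> ennreal ea * ennreal T + (ennreal C * ennreal eb + ennreal C * ennreal eb)"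
        using elim x by (intro add_mono mult_left_mono order_refl) auto
      also have "\<dots> = ennreal (ea * T + (C * eb + C * eb))"
        using ea T C(1) eb(1) by (simp add: ennreal_mult[symmetric] ennreal_plus[symmetric] del: ennreal_plus)
      also have "\<dots> \<le> ennreal e"
        using eb(2) T by (intro ennreal_leI) (simp add: ea_def)
      finally show "(\<integral>\<^sup>+t. ennreal (indicator {0<..<T} t * \<bar>F (U (x, t)) (V (x, t)) - F (u t) (v t)\<bar>) \<partial>lborel) \<le> ennreal e" .
    qed
  qed
  then show "\<exists>d>0. AE x in lborel. x \<in> E \<and> \<bar>x\<bar> < d \<longrightarrow>
    (\<integral>\<^sup>+t. ennreal (indicator {0<..<T} t * \<bar>F (U (x, t)) (V (x, t)) - F (u t) (v t)\<bar>) \<partial>lborel) \<le> ennreal e"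
    using d1(1) d2(1) by (intro exI[of _ "min d1 d2"]) simp
qed

text \<open>The term with the time derivative lives on a strip of width proportional to \<epsilon>
  and disappears. In the flux term the derivative of the cutoff is \<open>- orient k\<close> times a
  kernel of unit mass concentrating at the vertex from inside the edge, and so picks out the
  trace.\<close>

lemma weak_pairing_trace:
  assumes H: "bounded_borel H" and Q: "bounded_borel Q" and q: "bounded_borel q"
    and tr: "edge_trace (edge k) Q q" and \<theta>: "test_fun \<theta>"
  shows "((\<lambda>\<epsilon>. weak_pairing (\<lambda>p. indicator (edge k) (fst p) * H p) (\<lambda>p. indicator (edge k) (fst p) * future (snd p) * Q p) (cutoff \<epsilon>) \<theta>)
    \<longlongrightarrow> - orient k * (LINT t|lborel. future t * q t * \<theta> t)) (at_right 0)"
proof -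
  obtain B r where B: "B > 0" "r > 0" "\<And>x. \<bar>\<theta> x\<bar> \<le> B" "\<And>x. \<bar>deriv \<theta> x\<bar> \<le> B"
    "\<And>x. r < \<bar>x\<bar> \<Longrightarrow> \<theta> x = 0" "\<And>x. r < \<bar>x\<bar> \<Longrightarrow> deriv \<theta> x = 0"
    using test_fun_bounds[OF \<theta>] by metis
  have [measurable]: "\<theta> \<in> borel_measurable borel" "deriv \<theta> \<in> borel_measurable borel"
    using test_fun_bounded_borel[OF \<theta>] by (auto intro: bounded_borel_measurable)
  note [measurable] = bounded_borel_measurable[OF H] bounded_borel_measurable[OF Q] bounded_borel_measurable[OF q]
  obtain M where M: "\<And>p. \<bar>H p\<bar> \<le> M" using H by (auto simp: bounded_borel_def)
  have M0: "M \<ge> 0" using M[of undefined] by linarith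
  note bE = edge_bounded_borel and bf = future_snd_bounded_borel
  have bH: "bounded_borel (\<lambda>p. indicator (edge k) (fst p) * H p)" by (intro bounded_borel_mult bE H)
  have bQ: "bounded_borel (\<lambda>p. indicator (edge k) (fst p) * future (snd p) * Q p)" by (intro bounded_borel_mult bE bf Q)
  define I1 where "I1 \<epsilon> = (LINT p|lborel. indicator (edge k) (fst p) * H p * (cutoff \<epsilon> (fst p) * deriv \<theta> (snd p)))" for \<epsilon>
  define I2 where "I2 \<epsilon> = (LINT p|lborel. indicator (edge k) (fst p) * future (snd p) * Q p * (deriv (cutoff \<epsilon>) (fst p) * \<theta> (snd p)))" for \<epsilon>
  define q0 where "q0 = (LINT t|lborel. future t * q t * \<theta> t)"

  \<comment> \<open>The integrand is supported in a rectangle of measure (4 \<epsilon>) (2 r), the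
    origin of \<open>8 * r\<close>.\<close>
  have b1: "\<bar>I1 \<epsilon>\<bar> \<le> M * B * (8 * r) * \<epsilon>" if "\<epsilon> > 0" for \<epsilon>
  proof -
    have i: "integrable lborel (\<lambda>p. M * B * (indicator {-2 * \<epsilon>..2 * \<epsilon>} (fst p) * indicator {-r..r} (snd p)) :: real)"
      "(LINT p|lborel. M * B * (indicator {-2 * \<epsilon>..2 * \<epsilon>} (fst p) * indicator {-r..r} (snd p))) = M * B * ((4 * \<epsilon>) * (2 * r))"
      using integral_lborel_product[of "indicator {-2 * \<epsilon>..2 * \<epsilon>}" "indicator {-r..r}"] B(2) that by simp_all
    have "\<bar>I1 \<epsilon>\<bar> \<le> (LINT p|lborel. \<bar>indicator (edge k) (fst p) * H p * (cutoff \<epsilon> (fst p) * deriv \<theta> (snd p))\<bar>)"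
      unfolding I1_def by (rule integral_abs_bound)
    also have "\<dots> \<le> (LINT p|lborel. M * B * (indicator {-2 * \<epsilon>..2 * \<epsilon>} (fst p) * indicator {-r..r} (snd p)))"
    proof (rule integral_mono)
      show "integrable lborel (\<lambda>p. \<bar>indicator (edge k) (fst p) * H p * (cutoff \<epsilon> (fst p) * deriv \<theta> (snd p))\<bar>)"
        by (intro integrable_abs weak_pairing_integrable(1) bH \<theta> cutoff_test_fun that)
      fix p :: "real \<times> real"
      show "\<bar>indicator (edge k) (fst p) * H p * (cutoff \<epsilon> (fst p) * deriv \<theta> (snd p))\<bar>
          \<le> M * B * (indicator {-2 * \<epsilon>..2 * \<epsilon>} (fst p) * indicator {-r..r} (snd p))"
      proof (cases "fst p \<in> {-2 * \<epsilon>..2 * \<epsilon>} \<and> snd p \<in> {-r..r}")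
        case True
        have "\<bar>indicator (edge k) (fst p)\<bar> * \<bar>H p\<bar> * (\<bar>cutoff \<epsilon> (fst p)\<bar> * \<bar>deriv \<theta> (snd p)\<bar>) \<le> 1 * M * (1 * B)"
          using cutoff_bounds[OF that, of "fst p"] M0 B(1)
          by (intro mult_mono M B mult_nonneg_nonneg) (simp_all add: indicator_def)
        then show ?thesis using True by (simp add: abs_mult)
      next
        case False
        then have "2 * \<epsilon> \<le> \<bar>fst p\<bar> \<or> r < \<bar>snd p\<bar>" by auto
        then have z: "cutoff \<epsilon> (fst p) * deriv \<theta> (snd p) = 0" using cutoff_eq_0[OF that] B(6) by auto
        show ?thesis by (simp only: z mult_zero_right abs_zero) (use M0 B(1) in simp)
      qed
    qed (rule i(1))
    finally show ?thesis unfolding i(2) by (simp add: mult_ac)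
  qed
  have lim1: "(I1 \<longlongrightarrow> 0) (at_right 0)"
  proof (rule Lim_null_comparison)
    show "\<forall>\<^sub>F \<epsilon> in at_right 0. norm (I1 \<epsilon>) \<le> M * B * (8 * r) * \<epsilon>"
      using b1 by (auto simp: eventually_at_filter)
    show "((\<lambda>\<epsilon>. M * B * (8 * r) * \<epsilon>) \<longlongrightarrow> 0) (at_right 0)"
      by (auto intro!: tendsto_eq_intros)
  qed

  have lim2: "(I2 \<longlongrightarrow> - orient k * q0) (at_right 0)"
  proof (rule tendstoI)
    fix e :: real assume e: "e > 0"
    define e' where "e' = e / (2 * B)"
    have e': "e' > 0" "B * e' < e" using e B(1) by (auto simp: e'_def)
    \<comment> \<open>The horizon \<open>r + 1\<close> lies beyond the support of \<theta>, so
      closeness to the trace is needed only on (0, r + 1).\<close>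
    have "r + 1 > 0" using B(2) by simp
    then obtain d where d: "d > 0" "AE x in lborel. x \<in> edge k \<and> \<bar>x\<bar> < d \<longrightarrow>
      (\<integral>\<^sup>+t. ennreal (indicator {0<..<r + 1} t * \<bar>Q (x, t) - q t\<bar>) \<partial>lborel) \<le> ennreal e'"
      using tr e'(1) unfolding edge_trace_def by blast
    have "dist (I2 \<epsilon>) (- orient k * q0) < e" if \<epsilon>: "0 < \<epsilon>" "\<epsilon> < d / 2" for \<epsilon>
    proof -
      let ?m = "\<lambda>x. mollifier \<epsilon> (orient k * x)"
      define D where "D p = ?m (fst p) * (future (snd p) * (Q p - q (snd p)) * \<theta> (snd p))" for p :: "real \<times> real"
      have m0: "0 \<le> ?m x" for x by (rule mollifier_nonneg[OF \<epsilon>(1)])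
      have i1: "integrable lborel (\<lambda>p. indicator (edge k) (fst p) * future (snd p) * Q p * (deriv (cutoff \<epsilon>) (fst p) * \<theta> (snd p)))"
        by (intro weak_pairing_integrable(2) bQ \<theta> cutoff_test_fun \<epsilon>)
      have i2: "integrable lborel (\<lambda>p. ?m (fst p) * (future (snd p) * q (snd p) * \<theta> (snd p)))"
        "(LINT p|lborel. ?m (fst p) * (future (snd p) * q (snd p) * \<theta> (snd p))) = q0"
        using integral_lborel_product[OF integral_mollifier_orient(1)[OF \<epsilon>(1), of k] integrable_future_test[OF q \<theta>]]
          integral_mollifier_orient(2)[OF \<epsilon>(1), of k] by (simp_all add: q0_def)
      have "I2 \<epsilon> + orient k * q0 = (LINT p|lborel. indicator (edge k) (fst p) * future (snd p) * Q p * (deriv (cutoff \<epsilon>) (fst p) * \<theta> (snd p))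
          + orient k * (?m (fst p) * (future (snd p) * q (snd p) * \<theta> (snd p))))"
        using i1 i2 by (simp add: I2_def)
      also have "\<dots> = (LINT p|lborel. - orient k * D p)"
      proof (intro Bochner_Integration.integral_cong refl)
        fix p :: "real \<times> real"
        have "indicator (edge k) (fst p) * future (snd p) * Q p * (deriv (cutoff \<epsilon>) (fst p) * \<theta> (snd p))
          = (indicator (edge k) (fst p) * deriv (cutoff \<epsilon>) (fst p)) * (future (snd p) * Q p * \<theta> (snd p))" by simp
        also have "\<dots> = (- orient k * ?m (fst p)) * (future (snd p) * Q p * \<theta> (snd p))"
          by (simp only: deriv_cutoff_on_edge[OF \<epsilon>(1)])
        finally show "indicator (edge k) (fst p) * future (snd p) * Q p * (deriv (cutoff \<epsilon>) (fst p) * \<theta> (snd p))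
          + orient k * (?m (fst p) * (future (snd p) * q (snd p) * \<theta> (snd p))) = - orient k * D p"
          by (simp add: D_def algebra_simps)
      qed
      finally have "\<bar>I2 \<epsilon> + orient k * q0\<bar> = \<bar>LINT p|lborel. D p\<bar>"
        by (simp add: abs_mult orient_sq)
      also have "\<dots> \<le> (LINT p|lborel. \<bar>D p\<bar>)" by (rule integral_abs_bound)
      finally have "ennreal \<bar>I2 \<epsilon> + orient k * q0\<bar> \<le> ennreal (LINT p|lborel. \<bar>D p\<bar>)" by (rule ennreal_leI)
      also have "\<dots> \<le> (\<integral>\<^sup>+p. ennreal \<bar>D p\<bar> \<partial>lborel)" by (rule ennreal_integral_le_nn_integral) simp
      also have "\<dots> = (\<integral>\<^sup>+p. ennreal \<bar>D p\<bar> \<partial>(lborel \<Otimes>\<^sub>M lborel))" by (simp add: lborel_prod)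
      also have "\<dots> = (\<integral>\<^sup>+x. (\<integral>\<^sup>+t. ennreal \<bar>D (x, t)\<bar> \<partial>lborel) \<partial>lborel)"
      proof (rule lborel.nn_integral_fst[symmetric])
        have "D \<in> borel_measurable borel" unfolding D_def by measurable
        then show "(\<lambda>p. ennreal \<bar>D p\<bar>) \<in> borel_measurable (lborel \<Otimes>\<^sub>M lborel)" by (simp add: lborel_prod)
      qed
      also have "\<dots> \<le> (\<integral>\<^sup>+x. ennreal (?m x) * ennreal (B * e') \<partial>lborel)"
      proof (rule nn_integral_mono_AE)
        show "AE x in lborel. (\<integral>\<^sup>+t. ennreal \<bar>D (x, t)\<bar> \<partial>lborel) \<le> ennreal (?m x) * ennreal (B * e')"
          using d(2)
        proof eventually_elim
          case (elim x)
          show ?case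
          proof (cases "?m x = 0")
            case False
            have "\<not> (orient k * x \<le> \<epsilon> \<or> 2 * \<epsilon> \<le> orient k * x)"
              using False mollifier_eq_0[OF \<epsilon>(1)] by blast
            then have "\<bar>x\<bar> < d"
              using \<epsilon> by (auto simp: orient_def split: if_splits)
            with False have x: "x \<in> edge k" "\<bar>x\<bar> < d"
              using mollifier_off_edge[OF \<epsilon>(1), of x k] by auto
            have "(\<integral>\<^sup>+t. ennreal \<bar>D (x, t)\<bar> \<partial>lborel)
              \<le> (\<integral>\<^sup>+t. ennreal (?m x * B) * ennreal (indicator {0<..<r + 1} t * \<bar>Q (x, t) - q t\<bar>) \<partial>lborel)"
            proof (rule nn_integral_mono)
              fix t
              have "\<bar>D (x, t)\<bar> \<le> ?m x * B * (indicator {0<..<r + 1} t * \<bar>Q (x, t) - q t\<bar>)"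
              proof (cases "t \<in> {0<..<r + 1}")
                case True
                have "?m x * (\<bar>Q (x, t) - q t\<bar> * \<bar>\<theta> t\<bar>) \<le> ?m x * (\<bar>Q (x, t) - q t\<bar> * B)"
                  by (intro mult_left_mono B m0) simp
                then show ?thesis using True m0[of x] by (simp add: D_def abs_mult mult_ac)
              next
                case False
                then have "future t * \<theta> t = 0" using B(5)[of t] by (cases "t \<le> 0") auto
                then have "D (x, t) = 0" by (auto simp: D_def)
                then show ?thesis using False by simp
              qed
              then show "ennreal \<bar>D (x, t)\<bar> \<le> ennreal (?m x * B) * ennreal (indicator {0<..<r + 1} t * \<bar>Q (x, t) - q t\<bar>)"
                using m0[of x] B(1) by (simp add: ennreal_mult[symmetric] ennreal_leI)
            qed
            also have "\<dots> = ennreal (?m x * B) * (\<integral>\<^sup>+t. ennreal (indicator {0<..<r + 1} t * \<bar>Q (x, t) - q t\<bar>) \<partial>lborel)"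
              by (rule nn_integral_cmult) measurable
            also have "\<dots> \<le> ennreal (?m x * B) * ennreal e'"
              using elim x by (intro mult_left_mono) auto
            also have "\<dots> = ennreal (?m x) * ennreal (B * e')"
              using m0[of x] B(1) e'(1) by (simp add: ennreal_mult[symmetric] mult_ac)
            finally show ?thesis .
          qed (simp add: D_def)
        qed
      qed
      also have "\<dots> = ennreal (B * e')"
        by (subst nn_integral_multc) (simp_all add: integral_mollifier_orient(3)[OF \<epsilon>(1)])
      finally have "\<bar>I2 \<epsilon> + orient k * q0\<bar> \<le> B * e'"
        using B(1) e'(1) by (simp add: ennreal_le_iff)
      then show ?thesis using e'(2) by (simp add: dist_real_def)
    qed
    then show "\<forall>\<^sub>F \<epsilon> in at_right 0. dist (I2 \<epsilon>) (- orient k * q0) < e"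
      using d(1) by (auto simp: eventually_at_right_field intro!: exI[of _ "d / 2"])
  qed
  have "((\<lambda>\<epsilon>. I1 \<epsilon> + I2 \<epsilon>) \<longlongrightarrow> 0 + - orient k * q0) (at_right 0)"
    by (intro tendsto_add lim1 lim2)
  then have "((\<lambda>\<epsilon>. I1 \<epsilon> + I2 \<epsilon>) \<longlongrightarrow> - orient k * q0) (at_right 0)" by simp
  then show ?thesis unfolding q0_def
  proof (rule Lim_transform_eventually)
    show "\<forall>\<^sub>F \<epsilon> in at_right 0. I1 \<epsilon> + I2 \<epsilon> = weak_pairing (\<lambda>p. indicator (edge k) (fst p) * H p) (\<lambda>p. indicator (edge k) (fst p) * future (snd p) * Q p) (cutoff \<epsilon>) \<theta>"
      unfolding I1_def I2_def
      by (auto simp: eventually_at_filter weak_pairing_split[OF bH bQ cutoff_test_fun \<theta>])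
  qed
qed

section \<open>Kruzkov pairs\<close>

text \<open>Written without the sign function, the flux is visibly symmetric in \<open>u\<close> and
  \<open>c\<close> and continuous, also across \<open>u = c\<close>.\<close>

lemma kruzkov_flux_max_min: "kruzkov_flux g c u = g (max u c) - g (min u c)"
  by (auto simp: kruzkov_flux_def max_def min_def sgn_if)

lemma kruzkov_flux_commute: "kruzkov_flux g c u = kruzkov_flux g u c"
  by (simp add: kruzkov_flux_max_min max.commute min.commute)

lemma kruzkov_flux_same [simp]: "kruzkov_flux g c c = 0"
  by (simp add: kruzkov_flux_def)

lemma continuous_kruzkov_flux:
  assumes "continuous_on UNIV g"
  shows "continuous_on UNIV (\<lambda>z. kruzkov_flux g (snd z) (fst z))"
  unfolding kruzkov_flux_max_min
  by (intro continuous_intros continuous_on_compose2[OF assms]) auto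

lemma bounded_borel_continuous2:
  fixes F :: "real \<Rightarrow> real \<Rightarrow> real"
  assumes F: "continuous_on UNIV (\<lambda>z. F (fst z) (snd z))" and U: "bounded_borel U" and V: "bounded_borel V"
  shows "bounded_borel (\<lambda>p. F (U p) (V p))"
proof -
  obtain C where C: "\<And>p. \<bar>U p\<bar> \<le> C" using U by (auto simp: bounded_borel_def)
  obtain D where D: "\<And>p. \<bar>V p\<bar> \<le> D" using V by (auto simp: bounded_borel_def)
  have "compact ((\<lambda>z. F (fst z) (snd z)) ` ({-C..C} \<times> {-D..D}))"
    by (intro compact_continuous_image compact_Times compact_Icc continuous_on_subset[OF F]) auto
  then obtain B where B: "\<And>y. y \<in> (\<lambda>z. F (fst z) (snd z)) ` ({-C..C} \<times> {-D..D}) \<Longrightarrow> norm y \<le> B"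
    by (meson bounded_pos compact_imp_bounded)
  note [measurable] = bounded_borel_measurable[OF U] bounded_borel_measurable[OF V]
  have [measurable]: "(\<lambda>z. F (fst z) (snd z)) \<in> borel_measurable borel"
    by (intro borel_measurable_continuous_onI F)
  have "(\<lambda>p. (\<lambda>z. F (fst z) (snd z)) (U p, V p)) \<in> borel_measurable borel" by measurable
  then have "(\<lambda>p. F (U p) (V p)) \<in> borel_measurable borel" by simp
  moreover have "\<bar>F (U p) (V p)\<bar> \<le> B" for p
  proof -
    have "(U p, V p) \<in> {-C..C} \<times> {-D..D}" using C[of p] D[of p] by (auto simp: abs_le_iff)
    then show ?thesis using B[of "F (U p) (V p)"] by force
  qed
  ultimately show ?thesis by (rule bounded_borelI)
qed

lemma bounded_borel_kruzkov_flux: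
  assumes "continuous_on UNIV g" "bounded_borel U" "bounded_borel V"
  shows "bounded_borel (\<lambda>p. kruzkov_flux g (V p) (U p))"
  using bounded_borel_continuous2[of "\<lambda>u v. kruzkov_flux g v u", OF continuous_kruzkov_flux[OF assms(1)] assms(2,3)] .

lemma bounded_borel_abs_diff:
  assumes "bounded_borel U" "bounded_borel V"
  shows "bounded_borel (\<lambda>p. \<bar>U p - V p\<bar>)"
  by (rule bounded_borel_continuous2[OF _ assms]) (intro continuous_intros)

lemma flux_modulus:
  fixes g :: "real \<Rightarrow> real"
  assumes g: "continuous_on UNIV g" and e: "0 < e"
  obtains C where "C \<ge> 0" "\<And>u v. \<bar>u\<bar> \<le> M \<Longrightarrow> \<bar>v\<bar> \<le> M \<Longrightarrow> \<bar>g u - g v\<bar> \<le> e + C * \<bar>u - v\<bar>"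
proof -
  obtain C where "C \<ge> 0" "\<And>p q. p \<in> {-M..M} \<Longrightarrow> q \<in> {-M..M} \<Longrightarrow> \<bar>g p - g q\<bar> \<le> e + C * dist p q"
    using compact_continuous_modulus[OF compact_Icc continuous_on_subset[OF g] e] by auto
  then show ?thesis by (intro that[of C]) (auto simp: dist_real_def abs_le_iff minus_le_iff)
qed

lemma sum_modulus:
  fixes Q w :: "'k \<Rightarrow> 'p \<Rightarrow> real"
  assumes I: "finite I" and e: "0 < e"
    and C: "\<And>k. k \<in> I \<Longrightarrow> C k \<ge> 0 \<and> (\<forall>p. \<bar>Q k p\<bar> \<le> e / real (card I) + C k * w k p)"
    and w: "\<And>k p. 0 \<le> w k p"
  shows "\<exists>C\<ge>0. \<forall>p. \<bar>\<Sum>k\<in>I. Q k p\<bar> \<le> e + C * (\<Sum>k\<in>I. w k p)"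
proof (intro exI[of _ "\<Sum>k\<in>I. C k"] conjI allI)
  show "0 \<le> (\<Sum>k\<in>I. C k)" using C by (auto intro: sum_nonneg)
  fix p
  have "\<bar>\<Sum>k\<in>I. Q k p\<bar> \<le> (\<Sum>k\<in>I. \<bar>Q k p\<bar>)" by (rule sum_abs)
  also have "\<dots> \<le> (\<Sum>k\<in>I. e / real (card I) + (\<Sum>j\<in>I. C j) * w k p)"
  proof (rule sum_mono)
    fix k assume k: "k \<in> I"
    have "C k \<le> (\<Sum>j\<in>I. C j)" using k C I by (intro member_le_sum) auto
    then have "C k * w k p \<le> (\<Sum>j\<in>I. C j) * w k p" by (intro mult_right_mono w)
    then show "\<bar>Q k p\<bar> \<le> e / real (card I) + (\<Sum>j\<in>I. C j) * w k p" using C[OF k] by (meson add_left_mono order_trans)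
  qed
  also have "\<dots> = real (card I) * (e / real (card I)) + (\<Sum>k\<in>I. C k) * (\<Sum>k\<in>I. w k p)"
    by (simp add: sum.distrib sum_distrib_left)
  also have "\<dots> \<le> e + (\<Sum>k\<in>I. C k) * (\<Sum>k\<in>I. w k p)"
    using e by (cases "card I = 0") auto
  finally show "\<bar>\<Sum>k\<in>I. Q k p\<bar> \<le> e + (\<Sum>k\<in>I. C k) * (\<Sum>k\<in>I. w k p)" .
qed

lemma edge_test_off_edge:
  assumes "edge_test E \<psi>" "x \<notin> E"
  shows "\<psi> x = 0" "deriv \<psi> x = 0"
proof -
  obtain K where K: "compact K" "K \<subseteq> E" "\<And>x. x \<notin> K \<Longrightarrow> \<psi> x = 0" using assms(1) by (auto simp: edge_test_def)
  then have x: "x \<notin> K" using assms(2) by auto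
  then show "\<psi> x = 0" by (rule K(3))
  show "deriv \<psi> x = 0"
  proof (rule DERIV_imp_deriv)
    have "((\<lambda>_. 0) has_real_derivative 0) (at x)" by simp
    then show "(\<psi> has_real_derivative 0) (at x)"
      by (rule has_field_derivative_transform_within_open[where S = "- K"])
        (use x K in \<open>auto simp: compact_imp_closed open_Compl\<close>)
  qed
qed

section \<open>Entropy solutions with Borel representatives\<close>

locale network =
  fixes Nin Nout :: nat and f :: "int \<Rightarrow> real \<Rightarrow> real" and G :: "(int \<Rightarrow> real) set"
  assumes f_cont: "\<And>k. k \<in> idx Nin Nout \<Longrightarrow> continuous_on UNIV (f k)"
    and G_max: "maximal_consistent Nin Nout f G"
begin

abbreviation "I \<equiv> idx Nin Nout"

text \<open>
  The entropy inequality for \<open>U\<close> extended by the initial data to \<open>t \<le> 0\<close>: the initial term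
  of the definition is the part of the integral over negative times.
\<close>

definition entropy_pairing :: "int \<Rightarrow> real \<Rightarrow> (real \<times> real \<Rightarrow> real) \<Rightarrow> (real \<Rightarrow> real) \<Rightarrow> (real \<Rightarrow> real) \<Rightarrow> real" where
  "entropy_pairing k c W = weak_pairing (\<lambda>p. indicator (edge k) (fst p) * \<bar>W p - c\<bar>)
    (\<lambda>p. indicator (edge k) (fst p) * future (snd p) * kruzkov_flux (f k) c (W p))"

text \<open>Only products with one time factor common to all edges are tested. Matching at the
  vertex then reduces to \<open>\<psi> k 0 = \<psi> 1 0\<close>, and both a cutoff shared by all
  edges and a function living inside a single edge qualify.\<close>

definition borel_entropy :: "(int \<Rightarrow> real \<times> real \<Rightarrow> real) \<Rightarrow> bool" where
  "borel_entropy U \<longleftrightarrow> (\<forall>c\<in>G. \<forall>\<psi> \<theta>. (\<forall>k\<in>I. test_fun (\<psi> k) \<and> \<psi> k 0 = \<psi> 1 0) \<longrightarrow> test_fun \<theta> \<longrightarrow>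
    0 \<le> (\<Sum>k\<in>I. entropy_pairing k (c k) (U k) (\<psi> k) \<theta>))"

section \<open>Balance at the vertex and maximality of \<open>G\<close>\<close>

lemma finite_I [simp]: "finite I"
  by (simp add: idx_def idx_in_def idx_out_def)

lemma sum_orient: "(\<Sum>k\<in>I. orient k * X k) = (\<Sum>k\<in>idx_out Nout. X k) - (\<Sum>k\<in>idx_in Nin. X k)"
proof -
  have "(\<Sum>k\<in>I. orient k * X k) = (\<Sum>k\<in>idx_in Nin. orient k * X k) + (\<Sum>k\<in>idx_out Nout. orient k * X k)"
    unfolding idx_def by (rule sum.union_disjoint) (auto simp: idx_in_def idx_out_def)
  also have "(\<Sum>k\<in>idx_in Nin. orient k * X k) = (\<Sum>k\<in>idx_in Nin. - X k)"
    by (intro sum.cong) (auto simp: idx_in_def orient_def)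
  also have "(\<Sum>k\<in>idx_out Nout. orient k * X k) = (\<Sum>k\<in>idx_out Nout. X k)"
    by (intro sum.cong) (auto simp: idx_out_def orient_def)
  finally show ?thesis by (simp add: sum_negf)
qed

lemma G_consistent: "mutually_consistent Nin Nout f G"
  using G_max by (simp add: maximal_consistent_def)

lemma G_stationary: "c \<in> G \<Longrightarrow> (\<Sum>k\<in>I. orient k * f k (c k)) = 0"
  using G_consistent by (auto simp: mutually_consistent_def stationary_def sum_orient)

lemma G_flux_le: "c \<in> G \<Longrightarrow> b \<in> G \<Longrightarrow> (\<Sum>k\<in>I. orient k * kruzkov_flux (f k) (c k) (b k)) \<le> 0"
  using G_consistent by (auto simp: mutually_consistent_def sum_orient)

text \<open>Adding the vector to \<open>G\<close> keeps mutual consistency: the Kruzkov flux is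
  symmetric in its two arguments, so the assumed inequality covers both orders.
  \<open>restrict\<close> makes the vector extensional, as membership in \<open>stationary\<close>
  demands.\<close>

lemma in_G_if_consistent:
  assumes st: "(\<Sum>k\<in>I. orient k * f k (g k)) = 0"
    and le: "\<And>c. c \<in> G \<Longrightarrow> (\<Sum>k\<in>I. orient k * kruzkov_flux (f k) (c k) (g k)) \<le> 0"
  shows "restrict g I \<in> G"
proof (rule ccontr)
  let ?g = "restrict g I"
  assume n: "?g \<notin> G"
  have *: "(\<Sum>k\<in>I. orient k * X (restrict g I k) k) = (\<Sum>k\<in>I. orient k * X (g k) k)" for X :: "real \<Rightarrow> int \<Rightarrow> real"
    by (intro sum.cong) auto
  have "?g \<in> stationary Nin Nout f"
    using st *[of "\<lambda>x k. f k x"] sum_orient[of "\<lambda>k. f k (?g k)"]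
    by (auto simp: stationary_def)
  moreover have "(\<Sum>k\<in>idx_out Nout. kruzkov_flux (f k) (c k) (b k)) \<le> (\<Sum>k\<in>idx_in Nin. kruzkov_flux (f k) (c k) (b k))"
    if "c \<in> insert ?g G" "b \<in> insert ?g G" for c b
  proof -
    have "(\<Sum>k\<in>I. orient k * kruzkov_flux (f k) (c k) (b k)) \<le> 0"
    proof (cases "c = ?g")
      case True
      show ?thesis
      proof (cases "b = ?g")
        case False
        then have "b \<in> G" using that by auto
        have "(\<Sum>k\<in>I. orient k * kruzkov_flux (f k) (c k) (b k)) = (\<Sum>k\<in>I. orient k * kruzkov_flux (f k) (b k) (g k))"
          using *[of "\<lambda>x k. kruzkov_flux (f k) x (b k)"] by (simp add: True kruzkov_flux_commute[of _ "b _"])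
        then show ?thesis using le[OF \<open>b \<in> G\<close>] by simp
      qed (simp add: True)
    next
      case False
      then have c: "c \<in> G" using that by auto
      show ?thesis
      proof (cases "b = ?g")
        case True
        then show ?thesis using *[of "\<lambda>x k. kruzkov_flux (f k) (c k) x"] le[OF c] by simp
      qed (use that c G_flux_le in auto)
    qed
    then show ?thesis by (simp add: sum_orient)
  qed
  ultimately have "mutually_consistent Nin Nout f (insert ?g G)"
    using G_consistent by (auto simp: mutually_consistent_def)
  then show False using G_max n by (auto simp: maximal_consistent_def)
qed

lemma entropy_bounded_borel:
  assumes "k \<in> I" "bounded_borel W"
  shows "bounded_borel (\<lambda>p. indicator (edge k) (fst p) * \<bar>W p - c\<bar>)"
    "bounded_borel (\<lambda>p. indicator (edge k) (fst p) * future (snd p) * kruzkov_flux (f k) c (W p))"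
  by (intro bounded_borel_mult edge_bounded_borel future_snd_bounded_borel bounded_borel_abs_diff assms
      bounded_borel_kruzkov_flux f_cont const_bounded_borel)+

text \<open>All edges are laid over one real line and their quantities added; restrictions to the
  edges are carried by \<open>w k\<close> and \<open>Q k\<close>. As the cutoff is common to all
  edges, the sum falls under the one-dimensional estimate.\<close>

lemma network_L1_bound:
  assumes bw: "\<And>k. k \<in> I \<Longrightarrow> bounded_borel (w k)" and bQ: "\<And>k. k \<in> I \<Longrightarrow> bounded_borel (Q k)"
    and w0: "\<And>k p. 0 \<le> w k p"
    and modulus: "\<And>k e. k \<in> I \<Longrightarrow> e > 0 \<Longrightarrow> \<exists>C\<ge>0. \<forall>p. \<bar>Q k p\<bar> \<le> e + C * w k p"
    and past: "\<And>k x t. k \<in> I \<Longrightarrow> t \<le> 0 \<Longrightarrow> w k (x, t) = w k (x, 0)" "\<And>k x t. k \<in> I \<Longrightarrow> t \<le> 0 \<Longrightarrow> Q k (x, t) = 0"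
    and ineq: "\<And>R \<theta>. R > 0 \<Longrightarrow> test_fun \<theta> \<Longrightarrow> 0 \<le> (\<Sum>k\<in>I. weak_pairing (w k) (Q k) (cutoff R) \<theta>)"
  shows "AE t in lborel. 0 < t \<longrightarrow> (\<integral>\<^sup>+x. ennreal (\<Sum>k\<in>I. w k (x, t)) \<partial>lborel) \<le> (\<integral>\<^sup>+x. ennreal (\<Sum>k\<in>I. w k (x, 0)) \<partial>lborel)"
proof -
  have b: "bounded_borel (\<lambda>p. \<Sum>k\<in>I. w k p)" "bounded_borel (\<lambda>p. \<Sum>k\<in>I. Q k p)"
    by (intro bounded_borel_sum finite_I bw bQ; assumption)+
  obtain M where M: "\<And>p. \<bar>\<Sum>k\<in>I. w k p\<bar> \<le> M" "\<And>p. \<bar>\<Sum>k\<in>I. Q k p\<bar> \<le> M"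
    using bounded_borel_common_bound[OF b] by metis
  show ?thesis
  proof (rule L1_estimate.L1_bound[of "\<lambda>p. \<Sum>k\<in>I. w k p" "\<lambda>p. \<Sum>k\<in>I. Q k p" M, OF L1_estimate.intro])
    show "(\<Sum>k\<in>I. w k p) \<le> M" for p using M(1)[of p] by linarith
    fix e :: real assume e: "e > 0"
    have "\<exists>C\<ge>0. \<forall>p. \<bar>Q k p\<bar> \<le> e / real (card I) + C * w k p" if k: "k \<in> I" for k
    proof (rule modulus[OF k])
      have "card I > 0" using k card_gt_0_iff[of I] by auto
      then show "e / real (card I) > 0" using e by simp
    qed
    then obtain C where C: "\<And>k. k \<in> I \<Longrightarrow> C k \<ge> 0 \<and> (\<forall>p. \<bar>Q k p\<bar> \<le> e / real (card I) + C k * w k p)"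
      by metis
    show "\<exists>C\<ge>0. \<forall>p. \<bar>\<Sum>k\<in>I. Q k p\<bar> \<le> e + C * (\<Sum>k\<in>I. w k p)"
      by (rule sum_modulus[OF finite_I e C w0])
  next
    fix R :: real and \<theta> assume R: "R > 0" and \<theta>: "test_fun \<theta>"
    show "0 \<le> weak_pairing (\<lambda>p. \<Sum>k\<in>I. w k p) (\<lambda>p. \<Sum>k\<in>I. Q k p) (cutoff R) \<theta>"
      using ineq[OF R \<theta>] weak_pairing_sum[OF finite_I bw bQ cutoff_test_fun[OF R] \<theta>] by simp
  next
    show "(\<Sum>k\<in>I. w k (x, t)) = (\<Sum>k\<in>I. w k (x, 0))" if "t \<le> 0" for x t
      by (intro sum.cong refl past(1) that)
    show "(\<Sum>k\<in>I. Q k (x, t)) = 0" if "t \<le> 0" for x t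
      by (intro sum.neutral ballI past(2) that)
  qed (intro bounded_borel_measurable b sum_nonneg w0 M(2))+
qed

text \<open>Inside [c, d] the two fluxes cancel in \<open>u\<close> and leave the constant
  \<open>g d - g c\<close>; outside, the excess involves only the nearer endpoint.\<close>

lemma distance_identity:
  fixes u c d :: real
  assumes "c \<le> d"
  shows "\<bar>u - c\<bar> + \<bar>u - d\<bar> = (d - c) + 2 * (max 0 (c - u) + max 0 (u - d))"
    "kruzkov_flux g c u + kruzkov_flux g d u = (g d - g c) + 2 * (g (max u d) - g d + (g c - g (min u c)))"
  using assms by (auto simp: kruzkov_flux_max_min max_def min_def)

text \<open>
  The entropies for \<open>c\<close> and \<open>d\<close> add up to twice the distance to \<open>[c, d]\<close> plus constants whose
  contributions cancel because \<open>c\<close> and \<open>d\<close> are stationary.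
\<close>

lemma comparison:
  assumes U: "\<And>k. k \<in> I \<Longrightarrow> bounded_borel (U k)"
    and past: "\<And>k x t. k \<in> I \<Longrightarrow> t \<le> 0 \<Longrightarrow> U k (x, t) = U k (x, 0)"
    and init: "\<And>k x. k \<in> I \<Longrightarrow> c k \<le> U k (x, 0) \<and> U k (x, 0) \<le> d k"
    and ent: "borel_entropy U" and cG: "c \<in> G" and dG: "d \<in> G"
  shows "AE p in lborel. \<forall>k\<in>I. fst p \<in> edge k \<longrightarrow> c k \<le> U k p \<and> U k p \<le> d k"
proof -
  have cd: "c k \<le> d k" if "k \<in> I" for k using init[OF that, of 0] by linarith
  define wk where "wk k p = indicator (edge k) (fst p) * (max 0 (c k - U k p) + max 0 (U k p - d k))" for k and p :: "real \<times> real"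
  define Qk where "Qk k p = indicator (edge k) (fst p) * future (snd p) * (f k (max (U k p) (d k)) - f k (d k) + (f k (c k) - f k (min (U k p) (c k))))" for k and p :: "real \<times> real"
  have bwk: "bounded_borel (wk k)" if "k \<in> I" for k
    unfolding wk_def
    by (intro bounded_borel_mult edge_bounded_borel bounded_borel_add
        bounded_borel_continuous2[OF _ U[OF that] const_bounded_borel[of "c k"], where F = "\<lambda>u v. max 0 (v - u)"]
        bounded_borel_continuous2[OF _ U[OF that] const_bounded_borel[of "d k"], where F = "\<lambda>u v. max 0 (u - v)"]
        continuous_intros)
  have bQk: "bounded_borel (Qk k)" if "k \<in> I" for k
    unfolding Qk_def
    by (intro bounded_borel_mult edge_bounded_borel future_snd_bounded_borel bounded_borel_add bounded_borel_diff const_bounded_borel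
        bounded_borel_continuous2[OF _ U[OF that] const_bounded_borel[of "d k"], where F = "\<lambda>u v. f k (max u v)"]
        bounded_borel_continuous2[OF _ U[OF that] const_bounded_borel[of "c k"], where F = "\<lambda>u v. f k (min u v)"]
        continuous_intros continuous_on_compose2[OF f_cont[OF that]]) auto
  have wk0: "0 \<le> wk k p" for k p by (simp add: wk_def)
  have wk_past: "wk k (x, t) = 0" if "k \<in> I" "t \<le> 0" for k x t
    using past[OF that, of x] init[OF that(1), of x] by (simp add: wk_def)
  have bound: "AE t in lborel. 0 < t \<longrightarrow> (\<integral>\<^sup>+x. ennreal (\<Sum>k\<in>I. wk k (x, t)) \<partial>lborel) \<le> (\<integral>\<^sup>+x. ennreal (\<Sum>k\<in>I. wk k (x, 0)) \<partial>lborel)"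
  proof (rule network_L1_bound[OF bwk bQk wk0])
    show "wk k (x, t) = wk k (x, 0)" if "k \<in> I" "t \<le> 0" for k x t using that by (simp add: wk_past)
    show "Qk k (x, t) = 0" if "t \<le> 0" for k x t using that by (simp add: Qk_def)
  next
    fix k and ec :: real assume k: "k \<in> I" and ec: "ec > 0"
    show "\<exists>C\<ge>0. \<forall>p. \<bar>Qk k p\<bar> \<le> ec + C * wk k p"
    proof -
      obtain M0 where M0: "\<And>p. \<bar>U k p\<bar> \<le> M0" using U[OF k] by (auto simp: bounded_borel_def)
      define M where "M = max M0 (max \<bar>c k\<bar> \<bar>d k\<bar>)"
      have M: "\<bar>U k p\<bar> \<le> M" "\<bar>c k\<bar> \<le> M" "\<bar>d k\<bar> \<le> M" for p
        using M0[of p] by (auto simp: M_def le_max_iff_disj)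
      obtain C where C: "C \<ge> 0" "\<And>u v. \<bar>u\<bar> \<le> M \<Longrightarrow> \<bar>v\<bar> \<le> M \<Longrightarrow> \<bar>f k u - f k v\<bar> \<le> ec / 2 + C * \<bar>u - v\<bar>"
        using flux_modulus[OF f_cont[OF k], of "ec / 2"] ec by auto
      have "\<bar>Qk k p\<bar> \<le> ec + C * wk k p" for p
      proof (cases "fst p \<in> edge k")
        case True
        let ?u = "U k p"
        have 1: "\<bar>f k (max ?u (d k)) - f k (d k)\<bar> \<le> ec / 2 + C * max 0 (?u - d k)"
          using C(2)[of "max ?u (d k)" "d k"] M(1)[of p] M(2,3) by (auto simp: max_def)
        have 2: "\<bar>f k (c k) - f k (min ?u (c k))\<bar> \<le> ec / 2 + C * max 0 (c k - ?u)"
          using C(2)[of "c k" "min ?u (c k)"] M(1)[of p] M(2,3) by (auto simp: max_def min_def)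
        have "\<bar>Qk k p\<bar> \<le> \<bar>f k (max ?u (d k)) - f k (d k) + (f k (c k) - f k (min ?u (c k)))\<bar>"
          using True by (auto simp: Qk_def future_def indicator_def)
        also have "\<dots> \<le> ec + C * (max 0 (c k - ?u) + max 0 (?u - d k))"
          unfolding distrib_left using 1 2 by linarith
        finally show ?thesis using True by (simp add: wk_def)
      next
        case False
        then show ?thesis using ec by (simp add: Qk_def wk_def)
      qed
      with C(1) show ?thesis by blast
    qed
  next
    fix R :: real and \<theta> assume R: "R > 0" and \<theta>: "test_fun \<theta>"
    note \<kappa> = cutoff_test_fun[OF R]
    have pair: "entropy_pairing k (c k) (U k) (cutoff R) \<theta> + entropy_pairing k (d k) (U k) (cutoff R) \<theta>
      = - (orient k * (f k (d k) - f k (c k)) * (LINT t|lborel. future t * \<theta> t)) + 2 * weak_pairing (wk k) (Qk k) (cutoff R) \<theta>"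
      if k: "k \<in> I" for k
    proof -
      have "entropy_pairing k (c k) (U k) (cutoff R) \<theta> + entropy_pairing k (d k) (U k) (cutoff R) \<theta>
        = weak_pairing (\<lambda>p. indicator (edge k) (fst p) * \<bar>U k p - c k\<bar> + indicator (edge k) (fst p) * \<bar>U k p - d k\<bar>)
          (\<lambda>p. indicator (edge k) (fst p) * future (snd p) * kruzkov_flux (f k) (c k) (U k p)
            + indicator (edge k) (fst p) * future (snd p) * kruzkov_flux (f k) (d k) (U k p)) (cutoff R) \<theta>"
        unfolding entropy_pairing_def
        by (rule weak_pairing_add[symmetric]; intro entropy_bounded_borel k U \<kappa> \<theta>)
      also have "(\<lambda>p. indicator (edge k) (fst p) * \<bar>U k p - c k\<bar> + indicator (edge k) (fst p) * \<bar>U k p - d k\<bar>)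
          = (\<lambda>p. (d k - c k) * indicator (edge k) (fst p) + 2 * wk k p)"
      proof
        fix p :: "real \<times> real"
        have "indicator (edge k) (fst p) * \<bar>U k p - c k\<bar> + indicator (edge k) (fst p) * \<bar>U k p - d k\<bar>
          = indicator (edge k) (fst p) * (\<bar>U k p - c k\<bar> + \<bar>U k p - d k\<bar>)" by (simp add: distrib_left)
        then show "indicator (edge k) (fst p) * \<bar>U k p - c k\<bar> + indicator (edge k) (fst p) * \<bar>U k p - d k\<bar>
          = (d k - c k) * indicator (edge k) (fst p) + 2 * wk k p"
          unfolding distance_identity(1)[OF cd[OF k]] by (simp add: wk_def algebra_simps)
      qed
      also have "(\<lambda>p. indicator (edge k) (fst p) * future (snd p) * kruzkov_flux (f k) (c k) (U k p)
            + indicator (edge k) (fst p) * future (snd p) * kruzkov_flux (f k) (d k) (U k p))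
          = (\<lambda>p. (f k (d k) - f k (c k)) * (indicator (edge k) (fst p) * future (snd p)) + 2 * Qk k p)"
      proof
        fix p :: "real \<times> real"
        have "indicator (edge k) (fst p) * future (snd p) * kruzkov_flux (f k) (c k) (U k p)
            + indicator (edge k) (fst p) * future (snd p) * kruzkov_flux (f k) (d k) (U k p)
          = indicator (edge k) (fst p) * future (snd p) * (kruzkov_flux (f k) (c k) (U k p) + kruzkov_flux (f k) (d k) (U k p))"
          by (simp add: distrib_left)
        then show "indicator (edge k) (fst p) * future (snd p) * kruzkov_flux (f k) (c k) (U k p)
            + indicator (edge k) (fst p) * future (snd p) * kruzkov_flux (f k) (d k) (U k p)
          = (f k (d k) - f k (c k)) * (indicator (edge k) (fst p) * future (snd p)) + 2 * Qk k p"
          unfolding distance_identity(2)[OF cd[OF k]] by (simp add: Qk_def algebra_simps)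
      qed
      also have "weak_pairing (\<lambda>p. (d k - c k) * indicator (edge k) (fst p) + 2 * wk k p)
          (\<lambda>p. (f k (d k) - f k (c k)) * (indicator (edge k) (fst p) * future (snd p)) + 2 * Qk k p) (cutoff R) \<theta>
        = weak_pairing (\<lambda>p. (d k - c k) * indicator (edge k) (fst p)) (\<lambda>p. (f k (d k) - f k (c k)) * (indicator (edge k) (fst p) * future (snd p))) (cutoff R) \<theta>
          + weak_pairing (\<lambda>p. 2 * wk k p) (\<lambda>p. 2 * Qk k p) (cutoff R) \<theta>"
        by (intro weak_pairing_add bounded_borel_mult const_bounded_borel edge_bounded_borel future_snd_bounded_borel bwk bQk k \<kappa> \<theta>)
      finally show ?thesis
        by (simp add: weak_pairing_cutoff_const[OF R \<theta>] weak_pairing_cmult)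
    qed
    have "0 \<le> (\<Sum>k\<in>I. entropy_pairing k (c k) (U k) (cutoff R) \<theta>)" "0 \<le> (\<Sum>k\<in>I. entropy_pairing k (d k) (U k) (cutoff R) \<theta>)"
      using ent cG dG \<kappa> \<theta> unfolding borel_entropy_def by (auto dest!: bspec spec[of _ "\<lambda>_. cutoff R"] spec[of _ \<theta>])
    then have "0 \<le> (\<Sum>k\<in>I. entropy_pairing k (c k) (U k) (cutoff R) \<theta> + entropy_pairing k (d k) (U k) (cutoff R) \<theta>)"
      by (simp add: sum.distrib)
    also have "\<dots> = - ((\<Sum>k\<in>I. orient k * (f k (d k) - f k (c k))) * (LINT t|lborel. future t * \<theta> t))
        + 2 * (\<Sum>k\<in>I. weak_pairing (wk k) (Qk k) (cutoff R) \<theta>)"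
      by (simp add: pair sum.distrib sum_negf sum_subtractf sum_distrib_right sum_distrib_left)
    also have "(\<Sum>k\<in>I. orient k * (f k (d k) - f k (c k))) = 0"
      using G_stationary[OF cG] G_stationary[OF dG] by (simp add: right_diff_distrib sum_subtractf)
    finally show "0 \<le> (\<Sum>k\<in>I. weak_pairing (wk k) (Qk k) (cutoff R) \<theta>)" by simp
  qed
  define w where "w p = (\<Sum>k\<in>I. wk k p)" for p
  have w_nonneg: "0 \<le> w p" for p by (simp add: w_def sum_nonneg wk0)
  have [measurable]: "w \<in> borel_measurable borel"
    unfolding w_def by (intro bounded_borel_measurable bounded_borel_sum finite_I bwk)
  \<comment> \<open>The data lie between \<open>c\<close> and \<open>d\<close>, so the initial mass
    is 0 and the estimate makes \<open>w\<close> vanish at almost every time.\<close>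
  have "AE t in lborel. (\<integral>\<^sup>+x. ennreal (w (x, t)) \<partial>lborel) = 0"
    using bound
  proof eventually_elim
    case (elim t)
    show ?case using elim by (cases "t \<le> 0") (auto simp: w_def wk_past)
  qed
  then have "(\<integral>\<^sup>+t. (\<integral>\<^sup>+x. ennreal (w (x, t)) \<partial>lborel) \<partial>lborel) = (\<integral>\<^sup>+t. 0 \<partial>(lborel :: real measure))"
    by (rule nn_integral_cong_AE)
  moreover have "(\<lambda>p. ennreal (w p)) \<in> borel_measurable (lborel \<Otimes>\<^sub>M lborel)" by (simp add: lborel_prod)
  ultimately have "(\<integral>\<^sup>+p. ennreal (w p) \<partial>lborel) = 0"
    using lborel_pair.nn_integral_snd[of "\<lambda>p. ennreal (w p)"] by (simp add: lborel_prod)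
  then have "AE p in lborel. ennreal (w p) = 0" by (subst (asm) nn_integral_0_iff_AE) auto
  then show ?thesis
  proof eventually_elim
    case (elim p)
    then have "w p = 0" using w_nonneg[of p] by (simp add: ennreal_eq_0_iff)
    then have "\<forall>k\<in>I. wk k p = 0" unfolding w_def using wk0 by (simp add: sum_nonneg_eq_0_iff)
    then show ?case by (auto simp: wk_def max_def split: if_splits)
  qed
qed

text \<open>The bounds hold at every point of the plane, not just almost everywhere and not just on
  the edge. Together with the inclusion of intervals they make every value of \<open>U k\<close> and
  of its trace a component of some element of \<open>G\<close>.\<close>

definition representative ::
    "(int \<Rightarrow> real \<times> real \<Rightarrow> real) \<Rightarrow> (int \<Rightarrow> real \<Rightarrow> real) \<Rightarrow> (int \<Rightarrow> real) \<Rightarrow> (int \<Rightarrow> real) \<Rightarrow> bool" where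
  "representative U tr c d \<longleftrightarrow> c \<in> G \<and> d \<in> G \<and> borel_entropy U \<and>
    (\<forall>k\<in>I. {c k..d k} \<subseteq> (\<lambda>b. b k) ` G \<and> U k \<in> borel_measurable borel \<and> (\<forall>p. c k \<le> U k p \<and> U k p \<le> d k) \<and>
      (\<forall>x t. t \<le> 0 \<longrightarrow> U k (x, t) = U k (x, 0)) \<and> tr k \<in> borel_measurable borel \<and>
      (\<forall>t. c k \<le> tr k t \<and> tr k t \<le> d k) \<and> edge_trace (edge k) (U k) (tr k))"

lemma representativeD:
  assumes "representative U tr c d"
  shows "c \<in> G" "d \<in> G" "borel_entropy U"
    and "\<And>k. k \<in> I \<Longrightarrow> {c k..d k} \<subseteq> (\<lambda>b. b k) ` G"
    and "\<And>k p. k \<in> I \<Longrightarrow> c k \<le> U k p" "\<And>k p. k \<in> I \<Longrightarrow> U k p \<le> d k"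
    and "\<And>k t. k \<in> I \<Longrightarrow> c k \<le> tr k t" "\<And>k t. k \<in> I \<Longrightarrow> tr k t \<le> d k"
    and "\<And>k x t. k \<in> I \<Longrightarrow> t \<le> 0 \<Longrightarrow> U k (x, t) = U k (x, 0)"
    and "\<And>k. k \<in> I \<Longrightarrow> edge_trace (edge k) (U k) (tr k)"
    and "\<And>k. k \<in> I \<Longrightarrow> bounded_borel (U k)" "\<And>k. k \<in> I \<Longrightarrow> bounded_borel (tr k)"
proof -
  note r = assms[unfolded representative_def]
  show "c \<in> G" by (rule r[THEN conjunct1])
  show "d \<in> G" by (rule r[THEN conjunct2, THEN conjunct1])
  show "borel_entropy U" by (rule r[THEN conjunct2, THEN conjunct2, THEN conjunct1])
  have k: "{c k..d k} \<subseteq> (\<lambda>b. b k) ` G \<and> U k \<in> borel_measurable borel \<and> (\<forall>p. c k \<le> U k p \<and> U k p \<le> d k) \<and>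
      (\<forall>x t. t \<le> 0 \<longrightarrow> U k (x, t) = U k (x, 0)) \<and> tr k \<in> borel_measurable borel \<and>
      (\<forall>t. c k \<le> tr k t \<and> tr k t \<le> d k) \<and> edge_trace (edge k) (U k) (tr k)" if "k \<in> I" for k
    using r[THEN conjunct2, THEN conjunct2, THEN conjunct2] that by (rule bspec)
  show "{c k..d k} \<subseteq> (\<lambda>b. b k) ` G" if "k \<in> I" for k
    using k[OF that] by (elim conjE)
  show "edge_trace (edge k) (U k) (tr k)" if "k \<in> I" for k
    using k[OF that] by (elim conjE)
  show "U k (x, t) = U k (x, 0)" if "k \<in> I" "t \<le> 0" for k x t
    using k[OF that(1)] that(2) by metis
  show b: "c k \<le> U k p" "U k p \<le> d k" if "k \<in> I" for k p
    using k[OF that] by metis+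
  show b': "c k \<le> tr k t" "tr k t \<le> d k" if "k \<in> I" for k t
    using k[OF that] by metis+
  have m: "U k \<in> borel_measurable borel" if "k \<in> I" for k
    using k[OF that] by (elim conjE)
  have m': "tr k \<in> borel_measurable borel" if "k \<in> I" for k
    using k[OF that] by (elim conjE)
  show "bounded_borel (U k)" if "k \<in> I" for k
  proof (rule bounded_borelI[OF m[OF that]])
    show "\<bar>U k p\<bar> \<le> \<bar>c k\<bar> + \<bar>d k\<bar>" for p using b[OF that, of p] by linarith
  qed
  show "bounded_borel (tr k)" if "k \<in> I" for k
  proof (rule bounded_borelI[OF m'[OF that]])
    show "\<bar>tr k t\<bar> \<le> \<bar>c k\<bar> + \<bar>d k\<bar>" for t using b'[OF that, of t] by linarith
  qed
qed

section \<open>Traces of a solution at the vertex\<close>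

lemma AE_le_0_if_tested:
  assumes H: "bounded_borel H" and le: "\<And>\<theta>. test_fun \<theta> \<Longrightarrow> (LINT t|lborel. H t * \<theta> t) \<le> 0"
  shows "AE t in lborel. H t \<le> (0::real)"
proof -
  obtain M where M: "\<And>t. \<bar>H t\<bar> \<le> M" using H by (auto simp: bounded_borel_def)
  have "AE t in lborel. - real n < t \<and> t < real n \<longrightarrow> H t \<le> 0" for n
  proof (rule AE_le_if_mollified_le[OF bounded_borel_measurable[OF H] M])
    fix h s :: real assume h: "h > 0"
    have sm: "smooth_fun (\<lambda>t. mollifier h (t - s))"
      using smooth_fun_affine[OF mollifier_smooth[of h], of 1 1 "- s"] by simp
    have "mollifier h (t - s) = 0" if "\<bar>s\<bar> + 2 * h < \<bar>t\<bar>" for t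
      using that h by (intro mollifier_eq_0) auto
    then show "(LINT t|lborel. H t * mollifier h (t - s)) \<le> 0"
      by (intro le) (use sm mollifier_nonneg[OF h] in \<open>auto simp: test_fun_def\<close>)
  qed
  then have "AE t in lborel. \<forall>n. - real n < t \<and> t < real n \<longrightarrow> H t \<le> 0"
    by (intro AE_all_countable[THEN iffD2] allI)
  then show ?thesis
  proof eventually_elim
    case (elim t)
    obtain n where "\<bar>t\<bar> < real n" using reals_Archimedean2 by blast
    then show ?case using elim by (auto simp: abs_less_iff minus_less_iff)
  qed
qed

text \<open>\<open>cutoff \<epsilon>\<close> equals 1 at the vertex on all edges, so it is an
  admissible family; as \<epsilon> tends to 0 only the trace fluxes survive, weighted by
  \<open>- orient k\<close>. The exceptional set of times depends on \<open>b\<close>.\<close>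

lemma traces_satisfy_entropy:
  assumes rep: "representative U tr c d" and b: "b \<in> G"
  shows "AE t in lborel. 0 < t \<longrightarrow> (\<Sum>k\<in>I. orient k * kruzkov_flux (f k) (b k) (tr k t)) \<le> 0"
proof -
  note R = representativeD[OF rep]
  define q where "q k t = kruzkov_flux (f k) (b k) (tr k t)" for k t
  have bq: "bounded_borel (q k)" if "k \<in> I" for k
    unfolding q_def by (intro bounded_borel_kruzkov_flux f_cont R const_bounded_borel that)
  have bQ: "bounded_borel (\<lambda>p. kruzkov_flux (f k) (b k) (U k p))" if "k \<in> I" for k
    by (intro bounded_borel_kruzkov_flux f_cont R const_bounded_borel that)
  have tr: "edge_trace (edge k) (\<lambda>p. kruzkov_flux (f k) (b k) (U k p)) (q k)" if k: "k \<in> I" for k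
    unfolding q_def
    by (rule edge_trace_compose[where F = "\<lambda>u v. kruzkov_flux (f k) v u", OF continuous_kruzkov_flux[OF f_cont[OF k]]
          R(11)[OF k] const_bounded_borel R(12)[OF k] const_bounded_borel R(10)[OF k] edge_trace_const])
  define H where "H t = future t * (\<Sum>k\<in>I. orient k * q k t)" for t
  have "AE t in lborel. H t \<le> 0"
  proof (rule AE_le_0_if_tested)
    show "bounded_borel H"
      unfolding H_def by (intro bounded_borel_mult future_bounded_borel bounded_borel_sum finite_I const_bounded_borel bq)
    fix \<theta> assume \<theta>: "test_fun \<theta>"
    have "((\<lambda>\<epsilon>. \<Sum>k\<in>I. entropy_pairing k (b k) (U k) (cutoff \<epsilon>) \<theta>)
      \<longlongrightarrow> (\<Sum>k\<in>I. - orient k * (LINT t|lborel. future t * q k t * \<theta> t))) (at_right 0)"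
      unfolding entropy_pairing_def
      by (intro tendsto_sum weak_pairing_trace bQ bq tr \<theta> bounded_borel_abs_diff R const_bounded_borel)
    moreover have "\<forall>\<^sub>F \<epsilon> in at_right 0. 0 \<le> (\<Sum>k\<in>I. entropy_pairing k (b k) (U k) (cutoff \<epsilon>) \<theta>)"
      unfolding eventually_at_filter
    proof (intro always_eventually allI impI)
      fix \<epsilon> :: real assume "\<epsilon> \<in> {0<..}"
      then show "0 \<le> (\<Sum>k\<in>I. entropy_pairing k (b k) (U k) (cutoff \<epsilon>) \<theta>)"
        using R(3) b cutoff_test_fun[of \<epsilon>] \<theta> unfolding borel_entropy_def
        by (auto dest!: bspec spec[of _ "\<lambda>_. cutoff \<epsilon>"] spec[of _ \<theta>])
    qed
    ultimately have "0 \<le> (\<Sum>k\<in>I. - orient k * (LINT t|lborel. future t * q k t * \<theta> t))"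
      by (rule tendsto_lowerbound) simp
    also have "\<dots> = - (LINT t|lborel. (\<Sum>k\<in>I. orient k * (future t * q k t * \<theta> t)))"
      using integrable_future_test[OF bq \<theta>] by (simp add: sum_negf)
    also have "(\<lambda>t. \<Sum>k\<in>I. orient k * (future t * q k t * \<theta> t)) = (\<lambda>t. H t * \<theta> t)"
      by (simp add: H_def sum_distrib_left sum_distrib_right mult_ac)
    finally show "(LINT t|lborel. H t * \<theta> t) \<le> 0" by simp
  qed
  then show ?thesis by eventually_elim (auto simp: H_def q_def)
qed

text \<open>The points are chosen inside \<open>S\<close> itself, one from each basic open set that
  meets it; a countable dense subset of the whole space might miss \<open>S\<close>.\<close>

lemma countable_dense_subset:
  fixes S :: "'a::second_countable_topology set"
  obtains T where "countable T" "T \<subseteq> S" "S \<subseteq> closure T"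
proof -
  obtain B :: "'a set set" where B: "countable B" "topological_basis B"
    using ex_countable_basis by blast
  define T where "T = (\<lambda>A. SOME x. x \<in> A \<inter> S) ` {A \<in> B. A \<inter> S \<noteq> {}}"
  have T: "(SOME x. x \<in> A \<inter> S) \<in> A \<inter> S" if "A \<inter> S \<noteq> {}" for A
    using that by (metis ex_in_conv someI_ex)
  show ?thesis
  proof (rule that[of T])
    show "countable T" unfolding T_def using B(1) by auto
    show "T \<subseteq> S" unfolding T_def using T by blast
    show "S \<subseteq> closure T"
    proof
      fix x assume x: "x \<in> S"
      show "x \<in> closure T"
        unfolding closure_iff_nhds_not_empty
      proof (intro allI impI)
        fix A V assume "V \<subseteq> A" "open V" "x \<in> V"
        then obtain W where W: "W \<in> B" "x \<in> W" "W \<subseteq> V"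
          using topological_basisE[OF B(2)] by metis
        then have "(SOME x. x \<in> W \<inter> S) \<in> T \<inter> W"
          using T[of W] x by (auto simp: T_def)
        then show "T \<inter> A \<noteq> {}" using W \<open>V \<subseteq> A\<close> by blast
      qed
    qed
  qed
qed

text \<open>At a given time the vertex inequality depends on \<open>b\<close> continuously, through
  finitely many coordinates. So it passes from a countable dense subset, where one null set
  suffices, to all of \<open>G\<close>.\<close>

lemma traces_in_G:
  assumes rep: "representative U tr c d"
  shows "AE t in lborel. 0 < t \<longrightarrow> restrict (\<lambda>k. tr k t) I \<in> G"
proof -
  note R = representativeD[OF rep]
  obtain T where T: "countable T" "T \<subseteq> G" "G \<subseteq> closure T"
    using countable_dense_subset[of G] by blast
  have "AE t in lborel. \<forall>b\<in>insert c (insert d T). 0 < t \<longrightarrow> (\<Sum>k\<in>I. orient k * kruzkov_flux (f k) (b k) (tr k t)) \<le> 0"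
    using T R(1,2) by (intro AE_ball_countable[THEN iffD2] ballI traces_satisfy_entropy[OF rep]) auto
  then show ?thesis
  proof eventually_elim
    case (elim t)
    show ?case
    proof
      assume t: "0 < t"
      define \<Phi> where "\<Phi> b = (\<Sum>k\<in>I. orient k * kruzkov_flux (f k) (b k) (tr k t))" for b :: "int \<Rightarrow> real"
      have "continuous_on UNIV \<Phi>"
        unfolding \<Phi>_def
      proof (intro continuous_intros)
        fix k assume k: "k \<in> I"
        have "continuous_on UNIV (\<lambda>b::int \<Rightarrow> real. (tr k t, b k))"
          by (intro continuous_intros continuous_on_product_coordinates)
        from continuous_on_compose2[OF continuous_kruzkov_flux[OF f_cont[OF k]] this]
        show "continuous_on UNIV (\<lambda>b. kruzkov_flux (f k) (b k) (tr k t))" by simp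
      qed
      then have "closed {b. \<Phi> b \<le> 0}"
        by (intro closed_Collect_le continuous_on_const)
      moreover have "T \<subseteq> {b. \<Phi> b \<le> 0}" using elim t by (auto simp: \<Phi>_def)
      ultimately have "closure T \<subseteq> {b. \<Phi> b \<le> 0}" by (rule closure_minimal[rotated])
      then have le: "(\<Sum>k\<in>I. orient k * kruzkov_flux (f k) (b k) (tr k t)) \<le> 0" if "b \<in> G" for b
        using T(3) that by (auto simp: \<Phi>_def)
      \<comment> \<open>The trace lies above \<open>c\<close> and below \<open>d\<close>, so the
        fluxes lose their signs. The inequality for \<open>c\<close> bounds the balance of the trace
        from above by 0, the one for \<open>d\<close> from below.\<close>
      have "(\<Sum>k\<in>I. orient k * kruzkov_flux (f k) (c k) (tr k t)) = (\<Sum>k\<in>I. orient k * f k (tr k t)) - (\<Sum>k\<in>I. orient k * f k (c k))"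
        unfolding sum_subtractf[symmetric]
        by (intro sum.cong refl) (use R(7) in \<open>simp add: kruzkov_flux_max_min max_absorb1 min_absorb2 right_diff_distrib\<close>)
      moreover have "(\<Sum>k\<in>I. orient k * kruzkov_flux (f k) (d k) (tr k t)) = (\<Sum>k\<in>I. orient k * f k (d k)) - (\<Sum>k\<in>I. orient k * f k (tr k t))"
        unfolding sum_subtractf[symmetric]
        by (intro sum.cong refl) (use R(8) in \<open>simp add: kruzkov_flux_max_min max_absorb2 min_absorb1 right_diff_distrib\<close>)
      ultimately have "(\<Sum>k\<in>I. orient k * f k (tr k t)) = 0"
        using le[OF R(1)] le[OF R(2)] G_stationary[OF R(1)] G_stationary[OF R(2)] by linarith
      then show "restrict (\<lambda>k. tr k t) I \<in> G" by (rule in_G_if_consistent) (rule le)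
    qed
  qed
qed

text \<open>The form with steps in \<open>orient k * x\<close> vanishes near the vertex and on the
  opposite side, so it extends the difference of the two cutoffs smoothly by zero from the edge to
  the line. Monotonicity of the step and \<epsilon> < R give nonnegativity.\<close>

lemma step_difference:
  fixes k :: int
  assumes "0 < \<epsilon>" "\<epsilon> < R"
  defines "\<psi> \<equiv> \<lambda>x. smooth_step (orient k * x / \<epsilon>) - smooth_step (orient k * x / R)"
  shows "edge_test (edge k) \<psi>" "x \<in> edge k \<Longrightarrow> \<psi> x = cutoff R x - cutoff \<epsilon> x"
    "x \<in> edge k \<Longrightarrow> deriv \<psi> x = deriv (cutoff R) x - deriv (cutoff \<epsilon>) x"
proof -
  have R: "R > 0" using assms by simp
  have eq: "\<psi> x = cutoff R x - cutoff \<epsilon> x" if "x \<in> edge k" for x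
  proof -
    have x: "0 < orient k * x" by (rule orient_edge[OF that])
    have "smooth_step (- (orient k * x) / \<epsilon>) = 0" "smooth_step (- (orient k * x) / R) = 0"
      using x assms(1) R by (auto intro!: smooth_step_le_1 simp: field_simps)
    then show ?thesis by (auto simp: \<psi>_def cutoff_def orient_def split: if_splits)
  qed
  then show "x \<in> edge k \<Longrightarrow> \<psi> x = cutoff R x - cutoff \<epsilon> x" by simp
  have sm: "smooth_fun \<psi>"
    unfolding \<psi>_def
    using smooth_fun_diff[OF smooth_fun_affine[OF smooth_step_smooth, of 1 "orient k / \<epsilon>" 0] smooth_fun_affine[OF smooth_step_smooth, of 1 "orient k / R" 0]]
    by simp
  show "edge_test (edge k) \<psi>"
    unfolding edge_test_def
  proof (intro conjI allI exI[of _ "{x. \<epsilon> \<le> orient k * x \<and> orient k * x \<le> 2 * R}"] impI sm)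
    show "0 \<le> \<psi> x" for x
    proof (cases "0 \<le> orient k * x")
      case True
      then have "orient k * x / R \<le> orient k * x / \<epsilon>" using assms by (intro divide_left_mono) auto
      then show ?thesis by (simp add: \<psi>_def smooth_step_mono)
    next
      case False
      then have "orient k * x / R \<le> 1" "orient k * x / \<epsilon> \<le> 1" using assms by (auto simp: field_simps)
      then show ?thesis by (simp add: \<psi>_def smooth_step_le_1)
    qed
    show "compact {x. \<epsilon> \<le> orient k * x \<and> orient k * x \<le> 2 * R}"
    proof -
      have "{x. \<epsilon> \<le> orient k * x \<and> orient k * x \<le> 2 * R} = (if k < 0 then {-2 * R..-\<epsilon>} else {\<epsilon>..2 * R})"
        by (auto simp: orient_def)
      then show ?thesis by simp
    qed
    show "{x. \<epsilon> \<le> orient k * x \<and> orient k * x \<le> 2 * R} \<subseteq> edge k"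
      using assms(1) by (auto simp: edge_iff_orient)
    fix x assume "x \<notin> {x. \<epsilon> \<le> orient k * x \<and> orient k * x \<le> 2 * R}"
    then consider "orient k * x \<le> \<epsilon>" | "2 * R \<le> orient k * x" by fastforce
    then show "\<psi> x = 0"
    proof cases
      case 1
      then have "orient k * x / \<epsilon> \<le> 1" "orient k * x / R \<le> 1" using assms by (auto simp: field_simps)
      then show ?thesis by (simp add: \<psi>_def smooth_step_le_1)
    next
      case 2
      then have "2 \<le> orient k * x / \<epsilon>" "2 \<le> orient k * x / R" using assms by (auto simp: field_simps)
      then show ?thesis by (simp add: \<psi>_def smooth_step_ge_2)
    qed
  qed
  show "deriv \<psi> x = deriv (cutoff R) x - deriv (cutoff \<epsilon>) x" if "x \<in> edge k"
  proof (rule DERIV_imp_deriv)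
    have "((\<lambda>x. cutoff R x - cutoff \<epsilon> x) has_real_derivative deriv (cutoff R) x - deriv (cutoff \<epsilon>) x) (at x)"
      by (intro DERIV_diff smooth_fun_has_deriv cutoff_smooth)
    then show "(\<psi> has_real_derivative deriv (cutoff R) x - deriv (cutoff \<epsilon>) x) (at x)"
      by (rule has_field_derivative_transform_within_open[OF _ edge_open that]) (simp add: eq)
  qed
qed

text \<open>A test function that vanishes near the vertex may live on one edge alone, so only the
  component \<open>b k\<close> enters. This is how every point of the projection of \<open>G\<close>
  becomes an admissible constant on that edge.\<close>

lemma edge_entropy:
  assumes rep: "representative U tr c d" and k: "k \<in> I" and m: "m \<in> (\<lambda>b. b k) ` G"
    and \<psi>: "edge_test (edge k) \<psi>" and \<theta>: "test_fun \<theta>"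
  shows "0 \<le> weak_pairing (\<lambda>p. \<bar>U k p - m\<bar>) (\<lambda>p. future (snd p) * kruzkov_flux (f k) m (U k p)) \<psi> \<theta>"
proof -
  note R = representativeD[OF rep]
  from m obtain b where b: "b \<in> G" "m = b k" by auto
  define \<Psi> where "\<Psi> j = (if j = k then \<psi> else (\<lambda>_. 0))" for j
  have \<psi>0: "\<psi> 0 = 0" by (rule edge_test_off_edge(1)[OF \<psi>]) (simp add: edge_def)
  have t0: "test_fun (\<lambda>_. 0)" by (simp add: test_fun_def smooth_fun_const)
  have "\<forall>j\<in>I. test_fun (\<Psi> j) \<and> \<Psi> j 0 = \<Psi> 1 0"
    using edge_test_test_fun[OF \<psi>] t0 \<psi>0 by (auto simp: \<Psi>_def)
  then have "0 \<le> (\<Sum>j\<in>I. entropy_pairing j (b j) (U j) (\<Psi> j) \<theta>)"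
    using R(3) b(1) \<theta> by (simp add: borel_entropy_def)
  also have "\<dots> = (\<Sum>j\<in>I. if j = k then entropy_pairing k m (U k) \<psi> \<theta> else 0)"
    by (intro sum.cong refl) (auto simp: \<Psi>_def b(2) entropy_pairing_def weak_pairing_def)
  also have "\<dots> = entropy_pairing k m (U k) \<psi> \<theta>" using k by simp
  also have "\<dots> = weak_pairing (\<lambda>p. \<bar>U k p - m\<bar>) (\<lambda>p. future (snd p) * kruzkov_flux (f k) m (U k p)) \<psi> \<theta>"
    unfolding entropy_pairing_def weak_pairing_def
  proof (intro Bochner_Integration.integral_cong refl)
    fix p :: "real \<times> real"
    have "\<psi> (fst p) = 0 \<and> deriv \<psi> (fst p) = 0" if "fst p \<notin> edge k"
      using edge_test_off_edge[OF \<psi> that] by simp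
    then show "indicator (edge k) (fst p) * \<bar>U k p - m\<bar> * (\<psi> (fst p) * deriv \<theta> (snd p))
        + indicator (edge k) (fst p) * future (snd p) * kruzkov_flux (f k) m (U k p) * (deriv \<psi> (fst p) * \<theta> (snd p))
      = \<bar>U k p - m\<bar> * (\<psi> (fst p) * deriv \<theta> (snd p)) + future (snd p) * kruzkov_flux (f k) m (U k p) * (deriv \<psi> (fst p) * \<theta> (snd p))"
      by (cases "fst p \<in> edge k") auto
  qed
  finally show ?thesis .
qed

lemma kato_on_edge:
  assumes repU: "representative U tr c d" and repV: "representative V tr' c' d'" and k: "k \<in> I"
    and \<psi>: "edge_test (edge k) \<psi>" and \<theta>: "test_fun \<theta>"
  shows "0 \<le> weak_pairing (\<lambda>p. \<bar>U k p - V k p\<bar>) (\<lambda>p. future (snd p) * kruzkov_flux (f k) (V k p) (U k p)) \<psi> \<theta>"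
proof -
  note RU = representativeD[OF repU] and RV = representativeD[OF repV]
  have Vm: "V k q \<in> (\<lambda>b. b k) ` G" for q
    using RV(4)[OF k] RV(5,6)[OF k, of q] by auto
  have Um: "U k q \<in> (\<lambda>b. b k) ` G" for q
    using RU(4)[OF k] RU(5,6)[OF k, of q] by auto
  show ?thesis
  proof (rule kato_inequality[where A = "\<lambda>u v. \<bar>u - v\<bar>" and F = "\<lambda>u v. kruzkov_flux (f k) v u" and a = future,
        OF RU(11)[OF k] RV(11)[OF k] _ continuous_kruzkov_flux[OF f_cont[OF k]] future_def edge_open[of k] _ _ \<psi> \<theta>])
    show "continuous_on UNIV (\<lambda>z::real \<times> real. \<bar>fst z - snd z\<bar>)" by (intro continuous_intros)
    show "0 \<le> weak_pairing (\<lambda>p. \<bar>U k p - V k q\<bar>) (\<lambda>p. future (snd p) * kruzkov_flux (f k) (V k q) (U k p)) \<psi> \<theta>"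
      if "edge_test (edge k) \<psi>" "test_fun \<theta>" for q \<psi> \<theta>
      by (rule edge_entropy[OF repU k Vm that])
    show "0 \<le> weak_pairing (\<lambda>q. \<bar>U k p - V k q\<bar>) (\<lambda>q. future (snd q) * kruzkov_flux (f k) (V k q) (U k p)) \<psi> \<theta>"
      if "edge_test (edge k) \<psi>" "test_fun \<theta>" for p \<psi> \<theta>
      using edge_entropy[OF repV k Um that, of p]
      by (simp add: abs_minus_commute kruzkov_flux_commute[of _ "U k p"])
  qed
qed

text \<open>The Kato inequality compares the pairing at radius \<open>R\<close> with the one at a
  small radius \<epsilon>; the latter tends to the vertex term, whose sign is decided by mutual
  consistency of the traces. The integral estimate does the rest.\<close>

theorem contraction_representatives:
  assumes repU: "representative U tr c d" and repV: "representative V tr' c' d'"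
  shows "AE t in lborel. 0 < t \<longrightarrow>
    (\<integral>\<^sup>+x. ennreal (\<Sum>k\<in>I. indicator (edge k) x * \<bar>U k (x, t) - V k (x, t)\<bar>) \<partial>lborel)
    \<le> (\<integral>\<^sup>+x. ennreal (\<Sum>k\<in>I. indicator (edge k) x * \<bar>U k (x, 0) - V k (x, 0)\<bar>) \<partial>lborel)"
proof -
  note RU = representativeD[OF repU] and RV = representativeD[OF repV]
  define wk where "wk k p = indicator (edge k) (fst p) * \<bar>U k p - V k p\<bar>" for k and p :: "real \<times> real"
  define F where "F k p = kruzkov_flux (f k) (V k p) (U k p)" for k p
  define q where "q k t = kruzkov_flux (f k) (tr' k t) (tr k t)" for k t
  define Qk where "Qk k p = indicator (edge k) (fst p) * future (snd p) * F k p" for k and p :: "real \<times> real"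
  have bF: "bounded_borel (F k)" if "k \<in> I" for k
    unfolding F_def by (intro bounded_borel_kruzkov_flux f_cont RU RV that)
  have bq: "bounded_borel (q k)" if "k \<in> I" for k
    unfolding q_def by (intro bounded_borel_kruzkov_flux f_cont RU RV that)
  have bA: "bounded_borel (\<lambda>p. \<bar>U k p - V k p\<bar>)" if "k \<in> I" for k
    by (intro bounded_borel_abs_diff RU RV that)
  have bwk: "bounded_borel (wk k)" if "k \<in> I" for k
    unfolding wk_def by (intro bounded_borel_mult edge_bounded_borel bA that)
  have bQk: "bounded_borel (Qk k)" if "k \<in> I" for k
    unfolding Qk_def by (intro bounded_borel_mult edge_bounded_borel future_snd_bounded_borel bF that)
  have trF: "edge_trace (edge k) (F k) (q k)" if k: "k \<in> I" for k
    unfolding q_def F_def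
    by (rule edge_trace_compose[where F = "\<lambda>u v. kruzkov_flux (f k) v u", OF continuous_kruzkov_flux[OF f_cont[OF k]]
          RU(11)[OF k] RV(11)[OF k] RU(12)[OF k] RV(12)[OF k] RU(10)[OF k] RV(10)[OF k]])
  \<comment> \<open>At almost every positive time both trace vectors lie in \<open>G\<close>, so
    mutual consistency applies to this pair; \<open>restrict\<close> does not change the sum over
    \<open>I\<close>.\<close>
  have traces: "AE t in lborel. future t * (\<Sum>k\<in>I. orient k * q k t) \<le> 0"
    using traces_in_G[OF repU] traces_in_G[OF repV]
  proof eventually_elim
    case (elim t)
    show ?case
    proof (cases "0 < t")
      case True
      with elim have "(\<Sum>k\<in>I. orient k * kruzkov_flux (f k) (restrict (\<lambda>k. tr' k t) I k) (restrict (\<lambda>k. tr k t) I k)) \<le> 0"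
        by (intro G_flux_le; blast)
      also have "(\<Sum>k\<in>I. orient k * kruzkov_flux (f k) (restrict (\<lambda>k. tr' k t) I k) (restrict (\<lambda>k. tr k t) I k)) = (\<Sum>k\<in>I. orient k * q k t)"
        by (intro sum.cong) (auto simp: q_def)
      finally show ?thesis using True by simp
    qed simp
  qed
  have wk0: "0 \<le> wk k p" for k p by (simp add: wk_def)
  have "AE t in lborel. 0 < t \<longrightarrow> (\<integral>\<^sup>+x. ennreal (\<Sum>k\<in>I. wk k (x, t)) \<partial>lborel) \<le> (\<integral>\<^sup>+x. ennreal (\<Sum>k\<in>I. wk k (x, 0)) \<partial>lborel)"
  proof (rule network_L1_bound[OF bwk bQk wk0])
    show "wk k (x, t) = wk k (x, 0)" if "k \<in> I" "t \<le> 0" for k x t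
      by (simp add: wk_def RU(9)[OF that] RV(9)[OF that])
    show "Qk k (x, t) = 0" if "t \<le> 0" for k x t using that by (simp add: Qk_def)
  next
    fix k and ec :: real assume k: "k \<in> I" and ec: "ec > 0"
    show "\<exists>C\<ge>0. \<forall>p. \<bar>Qk k p\<bar> \<le> ec + C * wk k p"
    proof -
      obtain N1 where N1: "\<And>p. \<bar>U k p\<bar> \<le> N1" using RU(11)[OF k] by (auto simp: bounded_borel_def)
      obtain N2 where N2: "\<And>p. \<bar>V k p\<bar> \<le> N2" using RV(11)[OF k] by (auto simp: bounded_borel_def)
      obtain C where C: "C \<ge> 0" "\<And>u v. \<bar>u\<bar> \<le> max N1 N2 \<Longrightarrow> \<bar>v\<bar> \<le> max N1 N2 \<Longrightarrow> \<bar>f k u - f k v\<bar> \<le> ec + C * \<bar>u - v\<bar>"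
        using flux_modulus[OF f_cont[OF k] ec] by blast
      have "\<bar>Qk k p\<bar> \<le> ec + C * wk k p" for p
      proof (cases "fst p \<in> edge k")
        case True
        have "\<bar>Qk k p\<bar> \<le> \<bar>F k p\<bar>" using True by (auto simp: Qk_def future_def indicator_def)
        also have "\<dots> \<le> \<bar>f k (U k p) - f k (V k p)\<bar>" by (auto simp: F_def kruzkov_flux_def abs_mult sgn_if)
        also have "\<dots> \<le> ec + C * \<bar>U k p - V k p\<bar>"
          using N1[of p] N2[of p] by (intro C) (auto simp: le_max_iff_disj)
        finally show ?thesis using True by (simp add: wk_def)
      next
        case False
        then show ?thesis using ec by (simp add: Qk_def wk_def)
      qed
      with C(1) show ?thesis by blast
    qed
  next
    fix R :: real and \<theta> assume R: "R > 0" and \<theta>: "test_fun \<theta>"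
    \<comment> \<open>The difference of the two cutoffs is admissible inside the edge, so the Kato
      inequality says that the pairing does not decrease when the radius grows.\<close>
    have mono: "weak_pairing (wk k) (Qk k) (cutoff \<epsilon>) \<theta> \<le> weak_pairing (wk k) (Qk k) (cutoff R) \<theta>"
      if k: "k \<in> I" and \<epsilon>: "0 < \<epsilon>" "\<epsilon> < R" for k \<epsilon>
    proof -
      define \<psi> where "\<psi> x = smooth_step (orient k * x / \<epsilon>) - smooth_step (orient k * x / R)" for x
      have et: "edge_test (edge k) \<psi>"
        using step_difference(1)[OF \<epsilon>] unfolding \<psi>_def[abs_def] .
      have "0 \<le> weak_pairing (\<lambda>p. \<bar>U k p - V k p\<bar>) (\<lambda>p. future (snd p) * kruzkov_flux (f k) (V k p) (U k p)) \<psi> \<theta>"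
        by (rule kato_on_edge[OF repU repV k et \<theta>])
      also have "\<dots> = (LINT p|lborel. (wk k p * (cutoff R (fst p) * deriv \<theta> (snd p)) + Qk k p * (deriv (cutoff R) (fst p) * \<theta> (snd p)))
         - (wk k p * (cutoff \<epsilon> (fst p) * deriv \<theta> (snd p)) + Qk k p * (deriv (cutoff \<epsilon>) (fst p) * \<theta> (snd p))))"
        unfolding weak_pairing_def
      proof (intro Bochner_Integration.integral_cong refl)
        fix p :: "real \<times> real"
        show "\<bar>U k p - V k p\<bar> * (\<psi> (fst p) * deriv \<theta> (snd p))
            + future (snd p) * kruzkov_flux (f k) (V k p) (U k p) * (deriv \<psi> (fst p) * \<theta> (snd p))
          = (wk k p * (cutoff R (fst p) * deriv \<theta> (snd p)) + Qk k p * (deriv (cutoff R) (fst p) * \<theta> (snd p)))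
            - (wk k p * (cutoff \<epsilon> (fst p) * deriv \<theta> (snd p)) + Qk k p * (deriv (cutoff \<epsilon>) (fst p) * \<theta> (snd p)))"
        proof (cases "fst p \<in> edge k")
          case True
          have eq: "\<psi> (fst p) = cutoff R (fst p) - cutoff \<epsilon> (fst p)"
            "deriv \<psi> (fst p) = deriv (cutoff R) (fst p) - deriv (cutoff \<epsilon>) (fst p)"
            using step_difference(2,3)[OF \<epsilon> True] unfolding \<psi>_def[abs_def] by auto
          show ?thesis
            unfolding eq wk_def Qk_def F_def using True by (simp add: algebra_simps)
        next
          case False
          have "\<psi> (fst p) = 0" "deriv \<psi> (fst p) = 0" using edge_test_off_edge[OF et False] by auto
          then show ?thesis using False by (simp add: wk_def Qk_def)
        qed
      qed
      also have "\<dots> = weak_pairing (wk k) (Qk k) (cutoff R) \<theta> - weak_pairing (wk k) (Qk k) (cutoff \<epsilon>) \<theta>"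
        unfolding weak_pairing_def
        by (intro Bochner_Integration.integral_diff Bochner_Integration.integrable_add weak_pairing_integrable bwk bQk k \<theta> cutoff_test_fun \<epsilon> R)
      finally show ?thesis by simp
    qed
    have "((\<lambda>\<epsilon>. \<Sum>k\<in>I. weak_pairing (wk k) (Qk k) (cutoff \<epsilon>) \<theta>)
      \<longlongrightarrow> (\<Sum>k\<in>I. - orient k * (LINT t|lborel. future t * q k t * \<theta> t))) (at_right 0)"
      unfolding wk_def Qk_def
      by (intro tendsto_sum weak_pairing_trace bA bF bq trF \<theta>)
    moreover have "\<forall>\<^sub>F \<epsilon> in at_right 0. (\<Sum>k\<in>I. weak_pairing (wk k) (Qk k) (cutoff \<epsilon>) \<theta>) \<le> (\<Sum>k\<in>I. weak_pairing (wk k) (Qk k) (cutoff R) \<theta>)"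
      unfolding eventually_at_right_field using R mono by (intro exI[of _ R]) (auto intro: sum_mono)
    ultimately have "(\<Sum>k\<in>I. - orient k * (LINT t|lborel. future t * q k t * \<theta> t)) \<le> (\<Sum>k\<in>I. weak_pairing (wk k) (Qk k) (cutoff R) \<theta>)"
      by (rule tendsto_upperbound) simp
    also have "(\<Sum>k\<in>I. - orient k * (LINT t|lborel. future t * q k t * \<theta> t)) = - (LINT t|lborel. (\<Sum>k\<in>I. orient k * (future t * q k t * \<theta> t)))"
      using integrable_future_test[OF bq \<theta>] by (simp add: sum_negf)
    also have "(\<lambda>t. \<Sum>k\<in>I. orient k * (future t * q k t * \<theta> t)) = (\<lambda>t. (future t * (\<Sum>k\<in>I. orient k * q k t)) * \<theta> t)"
      by (simp add: sum_distrib_left sum_distrib_right mult_ac)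
    finally have "- (LINT t|lborel. (future t * (\<Sum>k\<in>I. orient k * q k t)) * \<theta> t) \<le> (\<Sum>k\<in>I. weak_pairing (wk k) (Qk k) (cutoff R) \<theta>)" .
    moreover have "(LINT t|lborel. (future t * (\<Sum>k\<in>I. orient k * q k t)) * \<theta> t) \<le> 0"
    proof -
      have "0 \<le> (LINT t|lborel. - ((future t * (\<Sum>k\<in>I. orient k * q k t)) * \<theta> t))"
        by (rule integral_nonneg_AE, use traces in eventually_elim)
          (simp add: mult_nonpos_nonneg test_fun_nonneg[OF \<theta>])
      then show ?thesis by simp
    qed
    ultimately show "0 \<le> (\<Sum>k\<in>I. weak_pairing (wk k) (Qk k) (cutoff R) \<theta>)" by simp
  qed
  then show ?thesis by (simp add: wk_def)
qed

end

section \<open>From Lebesgue to Borel representatives\<close>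

lemma bounded_borel_indicator: "A \<in> sets borel \<Longrightarrow> bounded_borel (indicator A)"
  by (rule bounded_borelI[of _ 1]) (auto simp: indicator_def)

lemma edge_future_measurable: "edge k \<times> {0<..} \<in> sets (borel :: (real \<times> real) measure)"
  unfolding borel_prod[symmetric] by (intro pair_measureI) auto

lemma AE_lebesgue_on_iff:
  assumes [measurable]: "S \<in> sets borel"
  shows "(AE x in lebesgue_on S. P x) \<longleftrightarrow> (AE x in lborel. x \<in> S \<longrightarrow> P x)"
  by (subst AE_restrict_space_iff) (auto simp: AE_completion_iff)

lemma lebesgue_measurable_if_AE_eq:
  fixes h g :: "'a::euclidean_space \<Rightarrow> real"
  assumes [measurable]: "g \<in> borel_measurable borel" and ae: "AE x in lborel. h x = g x"
  shows "h \<in> borel_measurable lebesgue"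
proof (rule measurableI)
  fix A :: "real set" assume [measurable]: "A \<in> sets borel"
  have "AE x in lebesgue. x \<in> g -` A \<longleftrightarrow> x \<in> h -` A"
    using AE_completion[OF ae] by eventually_elim auto
  moreover have "g -` A \<in> sets lebesgue"
    using measurable_sets_borel[OF assms(1)] by auto
  ultimately have "h -` A \<in> sets lebesgue" by (rule completion.in_sets_AE) auto
  then show "h -` A \<inter> space lebesgue \<in> sets lebesgue" by simp
qed auto

text \<open>\<open>h\<close> is not assumed measurable: equality almost everywhere with a Borel
  function and completeness of Lebesgue measure supply it. Integrals then pass to
  \<open>lborel\<close>, the restriction becoming an indicator.\<close>

lemma lebesgue_on_integral_eq:
  fixes h g :: "'a::euclidean_space \<Rightarrow> real"
  assumes [measurable]: "S \<in> sets borel" "g \<in> borel_measurable borel"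
    and ae: "AE x in lborel. x \<in> S \<longrightarrow> h x = g x"
  shows "h \<in> borel_measurable (lebesgue_on S)"
    "(LINT x|lebesgue_on S. h x) = (LINT x|lborel. indicator S x * g x)"
    "integrable (lebesgue_on S) h \<longleftrightarrow> integrable lborel (\<lambda>x. indicator S x * g x)"
    "(\<integral>\<^sup>+x. ennreal (h x) \<partial>lebesgue_on S) = (\<integral>\<^sup>+x. ennreal (indicator S x * g x) \<partial>lborel)"
proof -
  have S: "S \<inter> space lebesgue \<in> sets lebesgue" by simp
  have ae': "AE x in lborel. indicator S x * h x = indicator S x * g x"
    using ae by eventually_elim (auto simp: indicator_def)
  have m: "(\<lambda>x. indicator S x * h x) \<in> borel_measurable lebesgue"
    by (rule lebesgue_measurable_if_AE_eq[OF _ ae']) measurable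
  have m': "(\<lambda>x. indicator S x * g x) \<in> borel_measurable lborel" by measurable
  show "h \<in> borel_measurable (lebesgue_on S)"
    using m by (subst borel_measurable_restrict_space_iff[OF S]) simp
  have "(LINT x|lebesgue_on S. h x) = (LINT x|lebesgue. indicator S x * h x)"
    by (simp add: integral_restrict_space)
  also have "\<dots> = (LINT x|lebesgue. indicator S x * g x)"
    by (intro integral_cong_AE m measurable_completion[OF m'] AE_completion ae')
  also have "\<dots> = (LINT x|lborel. indicator S x * g x)" by (rule integral_completion[OF m'])
  finally show "(LINT x|lebesgue_on S. h x) = (LINT x|lborel. indicator S x * g x)" .
  have "integrable (lebesgue_on S) h \<longleftrightarrow> integrable lebesgue (\<lambda>x. indicator S x * h x)"
    by (simp add: integrable_restrict_space)
  also have "\<dots> \<longleftrightarrow> integrable lebesgue (\<lambda>x. indicator S x * g x)"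
    by (intro integrable_cong_AE m measurable_completion[OF m'] AE_completion ae')
  also have "\<dots> \<longleftrightarrow> integrable lborel (\<lambda>x. indicator S x * g x)" by (rule integrable_completion[OF m'])
  finally show "integrable (lebesgue_on S) h \<longleftrightarrow> integrable lborel (\<lambda>x. indicator S x * g x)" .
  have "(\<integral>\<^sup>+x. ennreal (h x) \<partial>lebesgue_on S) = (\<integral>\<^sup>+x. ennreal (h x) * indicator S x \<partial>lebesgue)"
    by (rule nn_integral_restrict_space) simp
  also have "\<dots> = (\<integral>\<^sup>+x. ennreal (h x) * indicator S x \<partial>lborel)" by (rule nn_integral_completion)
  also have "\<dots> = (\<integral>\<^sup>+x. ennreal (indicator S x * g x) \<partial>lborel)"
    using ae by (intro nn_integral_cong_AE, eventually_elim) (auto simp: indicator_def)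
  finally show "(\<integral>\<^sup>+x. ennreal (h x) \<partial>lebesgue_on S) = (\<integral>\<^sup>+x. ennreal (indicator S x * g x) \<partial>lborel)" .
qed

lemma L1_norm_eq:
  assumes "S \<in> sets borel" "g \<in> borel_measurable borel" "AE x in lborel. x \<in> S \<longrightarrow> h x = g x"
  shows "L1_norm S h = (\<integral>\<^sup>+x. ennreal (indicator S x * \<bar>g x\<bar>) \<partial>lborel)"
  unfolding L1_norm_def using assms by (intro lebesgue_on_integral_eq(4)) auto

text \<open>Completion gives a Borel function equal almost everywhere, and clamping at the essential
  bound makes it bounded at every point. \<open>\<bar>C\<bar>\<close> covers a negative bound,
  possible when \<open>S\<close> is null.\<close>

lemma Linf_on_borel:
  fixes g :: "'a::euclidean_space \<Rightarrow> real"
  assumes [measurable]: "S \<in> sets borel" and g: "Linf_on S g"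
  obtains g' where "bounded_borel g'" "AE x in lborel. x \<in> S \<longrightarrow> g x = g' x"
proof -
  have m: "(\<lambda>x. indicator S x * g x) \<in> borel_measurable lebesgue"
    using g borel_measurable_restrict_space_iff[of S lebesgue g] by (simp add: Linf_on_def)
  obtain h where h [measurable]: "h \<in> borel_measurable lborel" and eq: "AE x in lborel. indicator S x * g x = h x"
    using completion_ex_borel_measurable_real[OF m] by blast
  obtain C where C: "AE x in lborel. x \<in> S \<longrightarrow> \<bar>g x\<bar> \<le> C"
    using g by (auto simp: Linf_on_def AE_lebesgue_on_iff)
  define h' where "h' x = max (- \<bar>C\<bar>) (min \<bar>C\<bar> (h x))" for x
  have "h \<in> borel_measurable borel" using h by simp
  then have "h' \<in> borel_measurable borel" unfolding h'_def by measurable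
  then have "bounded_borel h'"
    by (rule bounded_borelI[of _ "\<bar>C\<bar>"]) (auto simp: h'_def)
  moreover have "AE x in lborel. x \<in> S \<longrightarrow> g x = h' x"
    using eq C by eventually_elim (auto simp: h'_def indicator_def)
  ultimately show ?thesis by (rule that)
qed

text \<open>The predicate need not be measurable, so the second part works with a measurable null
  set containing the exceptional points; almost all of its sections at fixed t are null.\<close>

lemma AE_lborel_swap:
  fixes P :: "real \<times> real \<Rightarrow> bool"
  assumes "AE p in lborel. P p"
  shows "AE x in lborel. AE t in lborel. P (x, t)" "AE t in lborel. AE x in lborel. P (x, t)"
proof -
  have ae: "AE p in lborel \<Otimes>\<^sub>M lborel. P p" unfolding lborel_prod by (rule assms)
  then show "AE x in lborel. AE t in lborel. P (x, t)" by (rule lborel_pair.AE_pair)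
  obtain N where N: "{p \<in> space (lborel \<Otimes>\<^sub>M lborel). \<not> P p} \<subseteq> N" "emeasure (lborel \<Otimes>\<^sub>M lborel) N = 0"
    "N \<in> sets ((lborel :: real measure) \<Otimes>\<^sub>M (lborel :: real measure))"
    using AE_E[OF ae] by blast
  have "(\<lambda>p. indicator N p :: ennreal) \<in> borel_measurable (lborel \<Otimes>\<^sub>M lborel)" using N(3) by simp
  from lborel_pair.nn_integral_snd[OF this] have "(\<integral>\<^sup>+t. (\<integral>\<^sup>+x. indicator N (x, t) \<partial>lborel) \<partial>lborel) = 0"
    using N(2,3) by simp
  moreover have "(\<lambda>t. \<integral>\<^sup>+x. indicator N (x, t) \<partial>lborel) \<in> borel_measurable lborel"
    using N(3) by measurable
  ultimately have "AE t in lborel. (\<integral>\<^sup>+x. indicator N (x, t) \<partial>lborel) = 0"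
    by (simp add: nn_integral_0_iff_AE)
  then show "AE t in lborel. AE x in lborel. P (x, t)"
  proof eventually_elim
    case (elim t)
    have "(\<lambda>x. indicator N (x, t) :: ennreal) \<in> borel_measurable lborel"
      using N(3) by measurable
    with elim have "AE x in lborel. indicator N (x, t) = (0::ennreal)" by (simp add: nn_integral_0_iff_AE)
    then show ?case
      by eventually_elim (use N(1) in \<open>auto simp: indicator_def space_pair_measure split: if_splits\<close>)
  qed
qed

lemma ex_in_interval_if_AE:
  fixes a b :: real
  assumes "AE s in lborel. P s" "a < b"
  shows "\<exists>s\<in>{a<..<b}. P s"
proof (rule ccontr)
  assume "\<not> ?thesis"
  then have "AE s in lborel. s \<notin> {a<..<b}" using assms(1) by (auto elim: eventually_mono)
  then have "{a<..<b} \<in> null_sets lborel" by (subst AE_iff_null_sets) auto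
  then show False using assms(2) by (simp add: null_sets_def)
qed

lemma smooth_fun_funpow: "smooth_fun g \<Longrightarrow> smooth_fun ((deriv ^^ n) g)"
  by (induction n) (auto intro: smooth_fun_deriv)

text \<open>Mixed derivatives of the product are products of one-variable derivatives. These exist
  on the whole line, so they serve as one-sided derivatives at the boundary.\<close>

lemma test_function_product:
  assumes "test_fun \<psi>" "test_fun \<theta>"
  shows "test_function k (\<lambda>p. \<psi> (fst p) * \<theta> (snd p))"
  unfolding test_function_def
proof
  note s = smooth_fun_funpow[OF test_fun_smooth[OF assms(1)]] smooth_fun_funpow[OF test_fun_smooth[OF assms(2)]]
  show "smooth_upto (closure (edge k) \<times> {0..}) (\<lambda>p. \<psi> (fst p) * \<theta> (snd p))"
    unfolding smooth_upto_def
  proof (intro exI[of _ "\<lambda>i j p. (deriv ^^ i) \<psi> (fst p) * (deriv ^^ j) \<theta> (snd p)"] conjI allI ballI impI)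
    show "continuous_on (closure (edge k) \<times> {0..}) (\<lambda>p. (deriv ^^ i) \<psi> (fst p) * (deriv ^^ j) \<theta> (snd p))" for i j
      by (intro continuous_intros continuous_on_compose2[OF smooth_fun_continuous[OF s(1), of UNIV]]
          continuous_on_compose2[OF smooth_fun_continuous[OF s(2), of UNIV]]) auto
    fix i j :: nat and x t :: real
    have "((deriv ^^ i) \<psi> has_real_derivative (deriv ^^ Suc i) \<psi> x) (at x)"
      using smooth_fun_has_deriv[OF s(1)] by simp
    from DERIV_cmult_right[OF this] show "((\<lambda>y. (deriv ^^ i) \<psi> (fst (y, t)) * (deriv ^^ j) \<theta> (snd (y, t))) has_real_derivative
        (deriv ^^ Suc i) \<psi> (fst (x, t)) * (deriv ^^ j) \<theta> (snd (x, t))) (at x within {y. (y, t) \<in> closure (edge k) \<times> {0..}})"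
      by (auto intro: has_field_derivative_at_within)
    have "((deriv ^^ j) \<theta> has_real_derivative (deriv ^^ Suc j) \<theta> t) (at t)"
      using smooth_fun_has_deriv[OF s(2)] by simp
    from DERIV_cmult[OF this] show "((\<lambda>r. (deriv ^^ i) \<psi> (fst (x, r)) * (deriv ^^ j) \<theta> (snd (x, r))) has_real_derivative
        (deriv ^^ i) \<psi> (fst (x, t)) * (deriv ^^ Suc j) \<theta> (snd (x, t))) (at t within {r. (x, r) \<in> closure (edge k) \<times> {0..}})"
      by (auto intro: has_field_derivative_at_within)
  qed simp
  obtain r where r: "\<And>x. r < \<bar>x\<bar> \<Longrightarrow> \<psi> x = 0" using test_fun_bounds[OF assms(1)] by metis
  obtain r' where r': "\<And>x. r' < \<bar>x\<bar> \<Longrightarrow> \<theta> x = 0" using test_fun_bounds[OF assms(2)] by metis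
  show "\<exists>K. compact K \<and> (\<forall>p\<in>closure (edge k) \<times> {0..} - K. \<psi> (fst p) * \<theta> (snd p) = 0)"
  proof (intro exI[of _ "{-r..r} \<times> {-r'..r'}"] conjI ballI)
    show "compact ({-r..r} \<times> {-r'..r'})" by (intro compact_Times compact_Icc)
    fix p assume "p \<in> closure (edge k) \<times> {0..} - {-r..r} \<times> {-r'..r'}"
    then have "r < \<bar>fst p\<bar> \<or> r' < \<bar>snd p\<bar>" by (cases p) auto
    then show "\<psi> (fst p) * \<theta> (snd p) = 0" using r r' by auto
  qed
qed

lemma integral_past_deriv:
  assumes "test_fun \<theta>"
  shows "integrable lborel (\<lambda>t. (1 - future t) * deriv \<theta> t)" "(LINT t|lborel. (1 - future t) * deriv \<theta> t) = \<theta> 0"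
proof -
  obtain r where r: "r > 0" "\<And>x. r < \<bar>x\<bar> \<Longrightarrow> \<theta> x = 0" "\<And>x. r < \<bar>x\<bar> \<Longrightarrow> deriv \<theta> x = 0"
    using test_fun_bounds[OF assms] by metis
  have eq: "(1 - future t) * deriv \<theta> t = deriv \<theta> t * indicator {-(r+1)..0} t" for t
    using r(1) r(3)[of t] by (cases "r < \<bar>t\<bar>") (auto simp: indicator_def future_def)
  have c: "isCont (deriv \<theta>) x" for x
    using smooth_fun_continuous[OF smooth_fun_deriv[OF test_fun_smooth[OF assms]], of UNIV]
    by (simp add: continuous_on_eq_continuous_at)
  have "(LINT t|lborel. deriv \<theta> t * indicator {-(r+1)..0} t) = \<theta> 0 - \<theta> (-(r+1))"
    using r(1) by (intro integral_FTC_Icc_real smooth_fun_has_deriv[OF test_fun_smooth[OF assms]] c) auto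
  then show "(LINT t|lborel. (1 - future t) * deriv \<theta> t) = \<theta> 0"
    unfolding eq using r(1) by (simp add: r(2))
  show "integrable lborel (\<lambda>t. (1 - future t) * deriv \<theta> t)"
    unfolding eq
    by (rule bounded_borel_integrable[of _ "{-(r+1)..0}",
          OF bounded_borel_mult[OF test_fun_bounded_borel(2)[OF assms] bounded_borel_indicator]]) auto
qed

context network
begin

text \<open>Split at t = 0. In the past the flux is switched off and \<open>U\<close> does not
  depend on time, so the derivative of \<theta> integrates to \<theta>(0), which produces the
  initial term.\<close>

lemma entropy_pairing_initial:
  assumes k: "k \<in> I" and U: "bounded_borel U" and past: "\<And>x t. t \<le> 0 \<Longrightarrow> U (x, t) = U (x, 0)"
    and \<psi>: "test_fun \<psi>" and \<theta>: "test_fun \<theta>"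
  shows "entropy_pairing k m U \<psi> \<theta> =
    (LINT p|lborel. indicator (edge k) (fst p) * future (snd p) *
      (\<bar>U p - m\<bar> * (\<psi> (fst p) * deriv \<theta> (snd p)) + kruzkov_flux (f k) m (U p) * (deriv \<psi> (fst p) * \<theta> (snd p))))
    + (LINT x|lborel. indicator (edge k) x * (\<bar>U (x, 0) - m\<bar> * (\<psi> x * \<theta> 0)))"
proof -
  note bH = bounded_borel_abs_diff[OF U const_bounded_borel[of m]]
  note bE = edge_bounded_borel[of k] and bf = future_snd_bounded_borel
  have bL: "bounded_borel (\<lambda>p. kruzkov_flux (f k) m (U p))"
    by (intro bounded_borel_kruzkov_flux f_cont k U const_bounded_borel)
  let ?H1 = "\<lambda>p. indicator (edge k) (fst p) * future (snd p) * \<bar>U p - m\<bar>"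
  let ?L = "\<lambda>p. indicator (edge k) (fst p) * future (snd p) * kruzkov_flux (f k) m (U p)"
  let ?H2 = "\<lambda>p. indicator (edge k) (fst p) * (1 - future (snd p)) * \<bar>U p - m\<bar>"
  have b1: "bounded_borel ?H1" "bounded_borel ?L" by (intro bounded_borel_mult bE bf bH bL)+
  have b2: "bounded_borel ?H2" by (intro bounded_borel_mult bounded_borel_diff const_bounded_borel bE bf bH)
  have "entropy_pairing k m U \<psi> \<theta> = weak_pairing (\<lambda>p. ?H1 p + ?H2 p) (\<lambda>p. ?L p + 0) \<psi> \<theta>"
    unfolding entropy_pairing_def by (simp add: algebra_simps)
  also have "\<dots> = weak_pairing ?H1 ?L \<psi> \<theta> + weak_pairing ?H2 (\<lambda>_. 0) \<psi> \<theta>"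
    by (intro weak_pairing_add b1 b2 const_bounded_borel \<psi> \<theta>)
  also have "weak_pairing ?H1 ?L \<psi> \<theta> = (LINT p|lborel. indicator (edge k) (fst p) * future (snd p) *
      (\<bar>U p - m\<bar> * (\<psi> (fst p) * deriv \<theta> (snd p)) + kruzkov_flux (f k) m (U p) * (deriv \<psi> (fst p) * \<theta> (snd p))))"
    unfolding weak_pairing_def by (simp add: algebra_simps)
  also have "weak_pairing ?H2 (\<lambda>_. 0) \<psi> \<theta>
      = (LINT p|lborel. (indicator (edge k) (fst p) * (\<bar>U (fst p, 0) - m\<bar> * \<psi> (fst p))) * ((1 - future (snd p)) * deriv \<theta> (snd p)))"
    unfolding weak_pairing_def
  proof (intro Bochner_Integration.integral_cong refl)
    fix p :: "real \<times> real"
    show "?H2 p * (\<psi> (fst p) * deriv \<theta> (snd p)) + 0 * (deriv \<psi> (fst p) * \<theta> (snd p))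
      = (indicator (edge k) (fst p) * (\<bar>U (fst p, 0) - m\<bar> * \<psi> (fst p))) * ((1 - future (snd p)) * deriv \<theta> (snd p))"
      using past[of "snd p" "fst p"] by (cases "snd p \<le> 0") (auto simp: algebra_simps)
  qed
  also have "\<dots> = (LINT x|lborel. indicator (edge k) x * (\<bar>U (x, 0) - m\<bar> * \<psi> x)) * \<theta> 0"
  proof -
    obtain r where r: "\<And>x. r < \<bar>x\<bar> \<Longrightarrow> \<psi> x = 0" using test_fun_bounds[OF \<psi>] by metis
    have U0: "bounded_borel (\<lambda>x. U (x, 0))"
      by (rule bounded_borel_compose[OF U]) measurable
    have "integrable lborel (\<lambda>x. indicator (edge k) x * (\<bar>U (x, 0) - m\<bar> * \<psi> x))"
    proof (rule bounded_borel_integrable[of _ "{-r..r}"])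
      show "bounded_borel (\<lambda>x. indicator (edge k) x * (\<bar>U (x, 0) - m\<bar> * \<psi> x))"
        by (intro bounded_borel_mult bounded_borel_abs_diff U0 const_bounded_borel test_fun_bounded_borel(1)[OF \<psi>]
            bounded_borelI[of "indicator (edge k)" 1]) (auto simp: indicator_def)
      fix x assume "x \<notin> {-r..r}"
      then have "r < \<bar>x\<bar>" by auto
      then show "indicator (edge k) x * (\<bar>U (x, 0) - m\<bar> * \<psi> x) = 0" by (simp add: r)
    qed simp
    from integral_lborel_product(2)[OF this integral_past_deriv(1)[OF \<theta>]] show ?thesis
      by (simp add: integral_past_deriv(2)[OF \<theta>])
  qed
  also have "\<dots> = (LINT x|lborel. indicator (edge k) x * (\<bar>U (x, 0) - m\<bar> * (\<psi> x * \<theta> 0)))"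
    by (subst Bochner_Integration.integral_mult_left_zero[symmetric]) (simp add: mult.assoc)
  finally show ?thesis .
qed

lemma borel_entropy_of_entropy_solution:
  assumes sol: "entropy_solution Nin Nout f G u0 u"
    and U: "\<And>k. k \<in> I \<Longrightarrow> bounded_borel (U k)"
    and past: "\<And>k x t. k \<in> I \<Longrightarrow> t \<le> 0 \<Longrightarrow> U k (x, t) = U k (x, 0)"
    and eq: "\<And>k. k \<in> I \<Longrightarrow> AE p in lborel. p \<in> edge k \<times> {0<..} \<longrightarrow> u k p = U k p"
    and eq0: "\<And>k. k \<in> I \<Longrightarrow> AE x in lborel. x \<in> edge k \<longrightarrow> u0 k x = U k (x, 0)"
  shows "borel_entropy U"
  unfolding borel_entropy_def
proof (intro ballI allI impI)
  fix c \<psi> \<theta> assume c: "c \<in> G" and \<psi>: "\<forall>k\<in>I. test_fun (\<psi> k) \<and> \<psi> k 0 = \<psi> 1 0" and \<theta>: "test_fun \<theta>"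
  define \<phi> where "\<phi> k p = \<psi> k (fst p) * \<theta> (snd p)" for k and p :: "real \<times> real"
  have "(\<forall>k\<in>I. test_function k (\<phi> k) \<and> (\<forall>p\<in>closure (edge k) \<times> {0..}. 0 \<le> \<phi> k p)) \<and>
    (\<forall>k\<in>I. \<forall>t\<ge>0. \<phi> k (0, t) = \<phi> 1 (0, t))"
  proof (intro conjI ballI allI impI)
    fix k assume k: "k \<in> I"
    show "test_function k (\<phi> k)"
      unfolding \<phi>_def[abs_def] using \<psi> \<theta> k by (intro test_function_product) auto
    show "0 \<le> \<phi> k p" for p
      unfolding \<phi>_def using \<psi> \<theta> k by (intro mult_nonneg_nonneg test_fun_nonneg[of "\<psi> k"] test_fun_nonneg[of \<theta>]) auto
    show "\<phi> k (0, t) = \<phi> 1 (0, t)" for t using \<psi> k by (simp add: \<phi>_def)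
  qed
  then have "0 \<le> (\<Sum>k\<in>I. LINT (x, t)|lebesgue_on (edge k \<times> {0<..}).
        kruzkov_eta (c k) (u k (x, t)) * deriv (\<lambda>s. \<phi> k (x, s)) t + kruzkov_flux (f k) (c k) (u k (x, t)) * deriv (\<lambda>y. \<phi> k (y, t)) x)
      + (\<Sum>k\<in>I. LINT x|lebesgue_on (edge k). kruzkov_eta (c k) (u0 k x) * \<phi> k (x, 0))"
    using sol c unfolding entropy_solution_def by blast
  also have "\<dots> = (\<Sum>k\<in>I. entropy_pairing k (c k) (U k) (\<psi> k) \<theta>)"
    unfolding sum.distrib[symmetric]
  proof (intro sum.cong refl)
    fix k assume k: "k \<in> I"
    have \<psi>k: "test_fun (\<psi> k)" using \<psi> k by simp
    note [measurable] = bounded_borel_measurable[OF U[OF k]] bounded_borel_measurable[OF test_fun_bounded_borel(1)[OF \<psi>k]]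
      bounded_borel_measurable[OF test_fun_bounded_borel(2)[OF \<psi>k]] bounded_borel_measurable[OF test_fun_bounded_borel(1)[OF \<theta>]]
      bounded_borel_measurable[OF test_fun_bounded_borel(2)[OF \<theta>]]
      bounded_borel_measurable[OF bounded_borel_kruzkov_flux[OF f_cont[OF k] U[OF k] const_bounded_borel[of "c k"]]]
    have d1: "deriv (\<lambda>s. \<phi> k (x, s)) t = \<psi> k x * deriv \<theta> t" for x t
      unfolding \<phi>_def fst_conv snd_conv
      by (intro DERIV_imp_deriv DERIV_cmult smooth_fun_has_deriv test_fun_smooth \<theta>)
    have d2: "deriv (\<lambda>y. \<phi> k (y, t)) x = deriv (\<psi> k) x * \<theta> t" for x t
      unfolding \<phi>_def fst_conv snd_conv
      by (intro DERIV_imp_deriv DERIV_cmult_right smooth_fun_has_deriv test_fun_smooth \<psi>k)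
    have "(LINT (x, t)|lebesgue_on (edge k \<times> {0<..}).
        kruzkov_eta (c k) (u k (x, t)) * deriv (\<lambda>s. \<phi> k (x, s)) t + kruzkov_flux (f k) (c k) (u k (x, t)) * deriv (\<lambda>y. \<phi> k (y, t)) x)
      = (LINT p|lborel. indicator (edge k \<times> {0<..}) p * (\<bar>U k p - c k\<bar> * (\<psi> k (fst p) * deriv \<theta> (snd p))
          + kruzkov_flux (f k) (c k) (U k p) * (deriv (\<psi> k) (fst p) * \<theta> (snd p))))"
    proof (rule lebesgue_on_integral_eq(2)[OF edge_future_measurable])
      show "AE p in lborel. p \<in> edge k \<times> {0<..} \<longrightarrow>
        (case p of (x, t) \<Rightarrow> kruzkov_eta (c k) (u k (x, t)) * deriv (\<lambda>s. \<phi> k (x, s)) t + kruzkov_flux (f k) (c k) (u k (x, t)) * deriv (\<lambda>y. \<phi> k (y, t)) x)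
        = \<bar>U k p - c k\<bar> * (\<psi> k (fst p) * deriv \<theta> (snd p)) + kruzkov_flux (f k) (c k) (U k p) * (deriv (\<psi> k) (fst p) * \<theta> (snd p))"
        using eq[OF k] by eventually_elim (auto simp: d1 d2 kruzkov_eta_def)
    qed measurable
    also have "\<dots> = (LINT p|lborel. indicator (edge k) (fst p) * future (snd p) * (\<bar>U k p - c k\<bar> * (\<psi> k (fst p) * deriv \<theta> (snd p))
          + kruzkov_flux (f k) (c k) (U k p) * (deriv (\<psi> k) (fst p) * \<theta> (snd p))))"
      by (intro Bochner_Integration.integral_cong refl) (auto simp: indicator_def future_def)
    finally have 1: "(LINT (x, t)|lebesgue_on (edge k \<times> {0<..}).
        kruzkov_eta (c k) (u k (x, t)) * deriv (\<lambda>s. \<phi> k (x, s)) t + kruzkov_flux (f k) (c k) (u k (x, t)) * deriv (\<lambda>y. \<phi> k (y, t)) x) = \<dots>" .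
    have 2: "(LINT x|lebesgue_on (edge k). kruzkov_eta (c k) (u0 k x) * \<phi> k (x, 0))
      = (LINT x|lborel. indicator (edge k) x * (\<bar>U k (x, 0) - c k\<bar> * (\<psi> k x * \<theta> 0)))"
    proof (rule lebesgue_on_integral_eq(2))
      show "AE x in lborel. x \<in> edge k \<longrightarrow> kruzkov_eta (c k) (u0 k x) * \<phi> k (x, 0) = \<bar>U k (x, 0) - c k\<bar> * (\<psi> k x * \<theta> 0)"
        using eq0[OF k] by eventually_elim (auto simp: kruzkov_eta_def \<phi>_def)
    qed measurable
    show "(LINT (x, t)|lebesgue_on (edge k \<times> {0<..}).
        kruzkov_eta (c k) (u k (x, t)) * deriv (\<lambda>s. \<phi> k (x, s)) t + kruzkov_flux (f k) (c k) (u k (x, t)) * deriv (\<lambda>y. \<phi> k (y, t)) x)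
      + (LINT x|lebesgue_on (edge k). kruzkov_eta (c k) (u0 k x) * \<phi> k (x, 0)) = entropy_pairing k (c k) (U k) (\<psi> k) \<theta>"
      unfolding 1 2 by (rule entropy_pairing_initial[symmetric, OF k U[OF k] past[OF k] \<psi>k \<theta>])
  qed
  finally show "0 \<le> (\<Sum>k\<in>I. entropy_pairing k (c k) (U k) (\<psi> k) \<theta>)" .
qed

text \<open>The trace is clamped as well: projection onto [c, d] is nonexpansive and fixes the
  values of \<open>U\<close>, so the distance to the trace does not increase.\<close>

lemma edge_trace_of_strong_trace:
  assumes U: "bounded_borel U" and cd: "\<And>p. c \<le> U p \<and> U p \<le> d"
    and eq: "AE p in lborel. p \<in> edge k \<times> {0<..} \<longrightarrow> u p = U p" and tr: "has_strong_trace k u"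
  obtains tr where "tr \<in> borel_measurable borel" "\<And>t. c \<le> tr t \<and> tr t \<le> d" "edge_trace (edge k) U tr"
proof -
  note [measurable] = bounded_borel_measurable[OF U]
  obtain h where h: "Linf_on {0<..} h"
    "\<And>T. T > 0 \<Longrightarrow> ess_lim (\<lambda>x. LINT t|lebesgue_on {0<..<T}. \<bar>u (x, t) - h t\<bar>) (edge k) 0 0"
    using tr by (auto simp: has_strong_trace_def)
  obtain g where g: "bounded_borel g" "AE t in lborel. t \<in> {0<..} \<longrightarrow> h t = g t"
    by (rule Linf_on_borel[OF _ h(1)]) auto
  note [measurable] = bounded_borel_measurable[OF g(1)]
  have cd': "c \<le> d" using cd[of undefined] by linarith
  define q where "q t = max c (min d (g t))" for t
  have qm [measurable]: "q \<in> borel_measurable borel" unfolding q_def by measurable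
  have "edge_trace (edge k) U q"
    unfolding edge_trace_def
  proof (intro allI impI)
    fix T e :: real assume T: "T > 0" and e: "e > 0"
    obtain \<delta> where \<delta>: "\<delta> > 0" "AE x in lborel. x \<in> edge k \<longrightarrow> \<bar>x\<bar> < \<delta> \<longrightarrow> \<bar>LINT t|lebesgue_on {0<..<T}. \<bar>u (x, t) - h t\<bar>\<bar> < e"
      using h(2)[OF T] e unfolding ess_lim_def by (auto simp: AE_lebesgue_on_iff)
    have "AE x in lborel. x \<in> edge k \<and> \<bar>x\<bar> < \<delta> \<longrightarrow> (\<integral>\<^sup>+t. ennreal (indicator {0<..<T} t * \<bar>U (x, t) - q t\<bar>) \<partial>lborel) \<le> ennreal e"
      using \<delta>(2) AE_lborel_swap(1)[OF eq]
    proof eventually_elim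
      case (elim x)
      show ?case
      proof
        assume x: "x \<in> edge k \<and> \<bar>x\<bar> < \<delta>"
        have ae: "AE t in lborel. t \<in> {0<..<T} \<longrightarrow> \<bar>u (x, t) - h t\<bar> = \<bar>U (x, t) - g t\<bar>"
          using elim(2) g(2) by eventually_elim (use x in auto)
        have Ux: "bounded_borel (\<lambda>t. U (x, t))" by (rule bounded_borel_compose[OF U]) measurable
        have i: "integrable lborel (\<lambda>t. indicator {0<..<T} t * \<bar>U (x, t) - g t\<bar>)"
          by (rule bounded_borel_integrable[of _ "{0<..<T}"])
            (auto intro!: bounded_borel_mult bounded_borel_abs_diff Ux g(1) bounded_borel_indicator)
        have "(\<integral>\<^sup>+t. ennreal (indicator {0<..<T} t * \<bar>U (x, t) - q t\<bar>) \<partial>lborel) \<le> (\<integral>\<^sup>+t. ennreal (indicator {0<..<T} t * \<bar>U (x, t) - g t\<bar>) \<partial>lborel)"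
        proof (intro nn_integral_mono ennreal_leI mult_left_mono)
          show "\<bar>U (x, t) - q t\<bar> \<le> \<bar>U (x, t) - g t\<bar>" for t
            using cd[of "(x, t)"] by (auto simp: q_def max_def min_def)
        qed simp
        also have "\<dots> = ennreal (LINT t|lborel. indicator {0<..<T} t * \<bar>U (x, t) - g t\<bar>)"
          by (rule nn_integral_eq_integral[OF i]) auto
        also have "(LINT t|lborel. indicator {0<..<T} t * \<bar>U (x, t) - g t\<bar>) = (LINT t|lebesgue_on {0<..<T}. \<bar>u (x, t) - h t\<bar>)"
          by (rule lebesgue_on_integral_eq(2)[symmetric, OF _ _ ae]) measurable
        also have "ennreal \<dots> \<le> ennreal e"
          using elim(1) x by (intro ennreal_leI) auto
        finally show "(\<integral>\<^sup>+t. ennreal (indicator {0<..<T} t * \<bar>U (x, t) - q t\<bar>) \<partial>lborel) \<le> ennreal e" .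
      qed
    qed
    with \<delta>(1) show "\<exists>d>0. AE x in lborel. x \<in> edge k \<and> \<bar>x\<bar> < d \<longrightarrow>
      (\<integral>\<^sup>+t. ennreal (indicator {0<..<T} t * \<bar>U (x, t) - q t\<bar>) \<partial>lborel) \<le> ennreal e" by blast
  qed
  then show ?thesis using cd' by (intro that[of q] qm) (auto simp: q_def)
qed

text \<open>The bounds come from comparison, which itself needs an entropy inequality for a Borel
  function. Hence two rounds: a Borel version \<open>U1\<close> without bounds at positive times is
  compared with \<open>c\<close> and \<open>d\<close>, and only then clamped to give
  \<open>U\<close>.\<close>

lemma entropy_solution_representative:
  assumes sol: "entropy_solution Nin Nout f G u0 u" and u0: "u0 \<in> Linf_oco Nin Nout G"
    and tr: "\<And>k. k \<in> I \<Longrightarrow> has_strong_trace k (u k)"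
  obtains U tr c d where "representative U tr c d"
    "\<And>k. k \<in> I \<Longrightarrow> AE p in lborel. p \<in> edge k \<times> {0<..} \<longrightarrow> u k p = U k p"
    "\<And>k. k \<in> I \<Longrightarrow> AE x in lborel. x \<in> edge k \<longrightarrow> u0 k x = U k (x, 0)"
proof -
  obtain c d where cd: "c \<in> G" "d \<in> G" "\<And>k. k \<in> I \<Longrightarrow> {c k..d k} \<subseteq> (\<lambda>b. b k) ` G"
    "\<And>k. k \<in> I \<Longrightarrow> AE x in lborel. x \<in> edge k \<longrightarrow> c k \<le> u0 k x \<and> u0 k x \<le> d k"
    "\<And>k l. k \<in> I \<Longrightarrow> l \<in> I \<Longrightarrow> c k \<le> d l"
    using u0 unfolding Linf_oco_def AE_lebesgue_on_iff[OF edge_measurable(1)] by blast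
  have u0L: "Linf_on (edge k) (u0 k)" if "k \<in> I" for k
    using u0 that by (simp add: Linf_oco_def)
  have "\<exists>B. bounded_borel B \<and> (AE p in lborel. p \<in> edge k \<times> {0<..} \<longrightarrow> u k p = B p)" if "k \<in> I" for k
  proof -
    have "Linf_on (edge k \<times> {0<..}) (u k)" using sol that by (simp add: entropy_solution_def)
    from Linf_on_borel[OF edge_future_measurable this] show ?thesis by metis
  qed
  then obtain B where B: "\<And>k. k \<in> I \<Longrightarrow> bounded_borel (B k)"
    "\<And>k. k \<in> I \<Longrightarrow> AE p in lborel. p \<in> edge k \<times> {0<..} \<longrightarrow> u k p = B k p" by metis
  have "\<exists>b. bounded_borel b \<and> (AE x in lborel. x \<in> edge k \<longrightarrow> u0 k x = b x)" if "k \<in> I" for k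
    using Linf_on_borel[OF edge_measurable(1) u0L[OF that]] by metis
  then obtain b where b: "\<And>k. k \<in> I \<Longrightarrow> bounded_borel (b k)"
    "\<And>k. k \<in> I \<Longrightarrow> AE x in lborel. x \<in> edge k \<longrightarrow> u0 k x = b k x" by metis
  \<comment> \<open>Clamping the initial values provides the pointwise bounds that
    \<open>comparison\<close> asks of the data; at positive times nothing is imposed yet.\<close>
  define U1 where "U1 k p = (if 0 < snd p then B k p else max (c k) (min (d k) (b k (fst p))))" for k p
  have U1b: "bounded_borel (U1 k)" if k: "k \<in> I" for k
  proof -
    have bm: "bounded_borel (\<lambda>x. max (c k) (min (d k) (b k x)))"
      by (rule bounded_borel_continuous2[OF _ b(1)[OF k] const_bounded_borel[of 0], where F = "\<lambda>u v. max (c k) (min (d k) u)"])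
        (intro continuous_intros)
    have "bounded_borel (\<lambda>p. future (snd p) * B k p + (1 - future (snd p)) * max (c k) (min (d k) (b k (fst p))))"
      by (intro bounded_borel_add bounded_borel_mult bounded_borel_diff const_bounded_borel future_snd_bounded_borel B(1)[OF k]
          bounded_borel_compose[OF bm measurable_fst_snd_borel(1)])
    also have "(\<lambda>p. future (snd p) * B k p + (1 - future (snd p)) * max (c k) (min (d k) (b k (fst p)))) = U1 k"
      by (auto simp: U1_def future_def)
    finally show ?thesis .
  qed
  have past1: "U1 k (x, t) = U1 k (x, 0)" if "t \<le> 0" for k x t using that by (simp add: U1_def)
  have eq1: "AE p in lborel. p \<in> edge k \<times> {0<..} \<longrightarrow> u k p = U1 k p" if "k \<in> I" for k
    using B(2)[OF that] by eventually_elim (auto simp: U1_def)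
  have eq01: "AE x in lborel. x \<in> edge k \<longrightarrow> u0 k x = U1 k (x, 0)" if "k \<in> I" for k
    using b(2)[OF that] cd(4)[OF that] by eventually_elim (auto simp: U1_def)
  have ent1: "borel_entropy U1"
    by (rule borel_entropy_of_entropy_solution[OF sol U1b past1 eq1 eq01])
  \<comment> \<open>The ordering for k = l makes the intervals nonempty, so that clamping lands in
    them.\<close>
  have cdk: "c k \<le> d k" if "k \<in> I" for k using cd(5)[OF that that] .
  have comp: "AE p in lborel. \<forall>k\<in>I. fst p \<in> edge k \<longrightarrow> c k \<le> U1 k p \<and> U1 k p \<le> d k"
    by (rule comparison[OF U1b past1 _ ent1 cd(1,2)]) (use cdk in \<open>auto simp: U1_def\<close>)
  \<comment> \<open>By comparison this changes \<open>U1\<close> on each edge only on a null set,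
    yet gives the bounds at every point, also off the edge.\<close>
  define U where "U k p = max (c k) (min (d k) (U1 k p))" for k p
  have Ub: "bounded_borel (U k)" if "k \<in> I" for k
    unfolding U_def
    by (rule bounded_borel_continuous2[OF _ U1b[OF that] const_bounded_borel[of 0], where F = "\<lambda>u v. max (c k) (min (d k) u)"])
      (intro continuous_intros)
  have U1U: "AE p in lborel. fst p \<in> edge k \<longrightarrow> U1 k p = U k p" if "k \<in> I" for k
    using comp by eventually_elim (use that in \<open>auto simp: U_def\<close>)
  have Ucd: "c k \<le> U k p \<and> U k p \<le> d k" if "k \<in> I" for k p using cdk[OF that] by (simp add: U_def)
  have past: "U k (x, t) = U k (x, 0)" if "t \<le> 0" for k x t using past1[OF that] by (simp add: U_def)
  have eq: "AE p in lborel. p \<in> edge k \<times> {0<..} \<longrightarrow> u k p = U k p" if "k \<in> I" for k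
    using eq1[OF that] U1U[OF that] by eventually_elim auto
  have U10: "U k (x, 0) = U1 k (x, 0)" if "k \<in> I" for k x using cdk[OF that] by (simp add: U_def U1_def)
  have eq0: "AE x in lborel. x \<in> edge k \<longrightarrow> u0 k x = U k (x, 0)" if "k \<in> I" for k
    using eq01[OF that] by eventually_elim (simp add: U10[OF that])
  have ent: "borel_entropy U"
    by (rule borel_entropy_of_entropy_solution[OF sol Ub past eq eq0])
  have "\<exists>q. q \<in> borel_measurable borel \<and> (\<forall>t. c k \<le> q t \<and> q t \<le> d k) \<and> edge_trace (edge k) (U k) q" if k: "k \<in> I" for k
    using edge_trace_of_strong_trace[OF Ub[OF k] Ucd[OF k] eq[OF k] tr[OF k]] by metis
  then obtain q where q: "\<And>k. k \<in> I \<Longrightarrow> q k \<in> borel_measurable borel \<and> (\<forall>t. c k \<le> q k t \<and> q k t \<le> d k) \<and> edge_trace (edge k) (U k) (q k)"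
    by metis
  have "representative U q c d"
    unfolding representative_def
  proof (intro conjI ballI allI impI cd(1,2) ent)
    fix k assume k: "k \<in> I"
    show "{c k..d k} \<subseteq> (\<lambda>b. b k) ` G" by (rule cd(3)[OF k])
    show "U k \<in> borel_measurable borel" by (rule bounded_borel_measurable[OF Ub[OF k]])
    show "c k \<le> U k p" "U k p \<le> d k" for p using Ucd[OF k, of p] by auto
    show "U k (x, t) = U k (x, 0)" if "t \<le> 0" for x t by (rule past[OF that])
    show "q k \<in> borel_measurable borel" "edge_trace (edge k) (U k) (q k)" using q[OF k] by auto
    show "c k \<le> q k t" "q k t \<le> d k" for t using q[OF k] by auto
  qed
  then show ?thesis using eq eq0 by (rule that)
qed

section \<open>L1 norms and the inequality at individual times\<close>

lemma sum_L1_norm_eq: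
  assumes "\<And>k. k \<in> I \<Longrightarrow> g k \<in> borel_measurable borel"
    and "\<And>k. k \<in> I \<Longrightarrow> AE x in lborel. x \<in> edge k \<longrightarrow> h k x = g k x"
  shows "(\<Sum>k\<in>I. L1_norm (edge k) (h k)) = (\<integral>\<^sup>+x. ennreal (\<Sum>k\<in>I. indicator (edge k) x * \<bar>g k x\<bar>) \<partial>lborel)"
proof -
  have "(\<Sum>k\<in>I. L1_norm (edge k) (h k)) = (\<Sum>k\<in>I. \<integral>\<^sup>+x. ennreal (indicator (edge k) x * \<bar>g k x\<bar>) \<partial>lborel)"
    using assms by (intro sum.cong refl L1_norm_eq) auto
  also have "\<dots> = (\<integral>\<^sup>+x. (\<Sum>k\<in>I. ennreal (indicator (edge k) x * \<bar>g k x\<bar>)) \<partial>lborel)"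
    using assms(1) by (intro nn_integral_sum[symmetric]) auto
  also have "\<dots> = (\<integral>\<^sup>+x. ennreal (\<Sum>k\<in>I. indicator (edge k) x * \<bar>g k x\<bar>) \<partial>lborel)"
    by (intro nn_integral_cong sum_ennreal) auto
  finally show ?thesis .
qed

lemma L1_norm_on_mono:
  assumes "S \<subseteq> T" "S \<in> sets borel" "T \<in> sets borel"
  shows "L1_norm S h \<le> L1_norm T h"
proof -
  have "L1_norm S h = (\<integral>\<^sup>+x. ennreal \<bar>h x\<bar> * indicator S x \<partial>lebesgue)"
    unfolding L1_norm_def using assms by (intro nn_integral_restrict_space) auto
  also have "\<dots> \<le> (\<integral>\<^sup>+x. ennreal \<bar>h x\<bar> * indicator T x \<partial>lebesgue)"
    using assms(1) by (intro nn_integral_mono) (auto simp: indicator_def)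
  also have "\<dots> = L1_norm T h"
    unfolding L1_norm_def using assms by (intro nn_integral_restrict_space[symmetric]) auto
  finally show ?thesis .
qed

text \<open>Monotone convergence. Measurability is asked only on bounded pieces, since the slice of
  a solution at a fixed time comes with local integrability.\<close>

lemma L1_norm_exhaustion:
  assumes [measurable]: "E \<in> sets borel"
    and "\<And>n. h \<in> borel_measurable (lebesgue_on (E \<inter> {- real (Suc n)..real (Suc n)}))"
  shows "(\<lambda>n. L1_norm (E \<inter> {- real (Suc n)..real (Suc n)}) h) \<longlonglongrightarrow> L1_norm E h"
proof -
  define S where "S n = E \<inter> {- real (Suc n)..real (Suc n)}" for n
  have S [measurable]: "S n \<in> sets borel" for n by (simp add: S_def)
  have eq: "L1_norm T h = (\<integral>\<^sup>+x. ennreal (indicator T x * \<bar>h x\<bar>) \<partial>lebesgue)" if "T \<in> sets borel" for T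
  proof -
    have "L1_norm T h = (\<integral>\<^sup>+x. ennreal \<bar>h x\<bar> * indicator T x \<partial>lebesgue)"
      unfolding L1_norm_def using that by (intro nn_integral_restrict_space) auto
    also have "\<dots> = (\<integral>\<^sup>+x. ennreal (indicator T x * \<bar>h x\<bar>) \<partial>lebesgue)"
      by (intro nn_integral_cong) (auto simp: indicator_def)
    finally show ?thesis .
  qed
  have "(\<lambda>n. \<integral>\<^sup>+x. ennreal (indicator (S n) x * \<bar>h x\<bar>) \<partial>lebesgue) \<longlonglongrightarrow> (\<integral>\<^sup>+x. ennreal (indicator E x * \<bar>h x\<bar>) \<partial>lebesgue)"
  proof (rule nn_integral_LIMSEQ)
    show "incseq (\<lambda>n x. ennreal (indicator (S n) x * \<bar>h x\<bar>))"
      by (auto simp: incseq_def le_fun_def S_def indicator_def intro!: ennreal_leI)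
    show "(\<lambda>x. ennreal (indicator (S n) x * \<bar>h x\<bar>)) \<in> borel_measurable lebesgue" for n
    proof -
      have "(\<lambda>x. indicator (S n) x * h x) \<in> borel_measurable lebesgue"
        using assms(2)[of n] borel_measurable_restrict_space_iff[of "S n" lebesgue h] by (simp add: S_def)
      then have "(\<lambda>x. ennreal \<bar>indicator (S n) x * h x\<bar>) \<in> borel_measurable lebesgue" by measurable
      then show ?thesis by (simp add: abs_mult)
    qed
    show "(\<lambda>n. ennreal (indicator (S n) x * \<bar>h x\<bar>)) \<longlonglongrightarrow> ennreal (indicator E x * \<bar>h x\<bar>)" for x
    proof (rule tendsto_eventually)
      obtain N :: nat where "\<bar>x\<bar> < real N" using reals_Archimedean2 by blast
      then have "x \<in> S n \<longleftrightarrow> x \<in> E" if "N \<le> n" for n using that by (auto simp: S_def)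
      then show "\<forall>\<^sub>F n in sequentially. ennreal (indicator (S n) x * \<bar>h x\<bar>) = ennreal (indicator E x * \<bar>h x\<bar>)"
        by (intro eventually_sequentiallyI[of N]) (simp add: indicator_def)
    qed
  qed
  then show ?thesis using eq[OF S] eq[OF assms(1)] by (simp add: S_def)
qed

text \<open>Shortly after \<open>t\<close> there is a time \<open>s\<close> at which the inequality
  holds and the slices are close to those at \<open>t\<close> in L1 on [-R, R]. The triangle
  inequality moves the bound to \<open>t\<close> up to an arbitrary error, and exhaustion removes
  \<open>R\<close>.\<close>

lemma time_value_contraction:
  assumes t: "0 < t" and tu: "time_value_attained Nin Nout u t" and tv: "time_value_attained Nin Nout v t"
    and U: "\<And>k. k \<in> I \<Longrightarrow> bounded_borel (U k)" and V: "\<And>k. k \<in> I \<Longrightarrow> bounded_borel (V k)"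
    and uU: "AE s in lborel. \<forall>k\<in>I. 0 < s \<longrightarrow> (AE x in lborel. x \<in> edge k \<longrightarrow> u k (x, s) = U k (x, s))"
    and vV: "AE s in lborel. \<forall>k\<in>I. 0 < s \<longrightarrow> (AE x in lborel. x \<in> edge k \<longrightarrow> v k (x, s) = V k (x, s))"
    and con: "AE s in lborel. 0 < s \<longrightarrow> (\<Sum>k\<in>I. L1_norm (edge k) (\<lambda>x. u k (x, s) - v k (x, s))) \<le> C"
  shows "(\<Sum>k\<in>I. L1_norm (edge k) (\<lambda>x. u k (x, t) - v k (x, t))) \<le> C"
proof -
  have int: "integrable (lebesgue_on (edge k \<inter> {-R..R})) (\<lambda>x. u k (x, t))"
    "integrable (lebesgue_on (edge k \<inter> {-R..R})) (\<lambda>x. v k (x, t))" if "k \<in> I" "R > 0" for k R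
    using tu tv that by (auto simp: time_value_attained_def)
  have main: "(\<Sum>k\<in>I. L1_norm (edge k \<inter> {-R..R}) (\<lambda>x. u k (x, t) - v k (x, t))) \<le> C + ennreal e"
    if R: "R > 0" and e: "e > 0" for R e
  proof -
    define S where "S k = edge k \<inter> {-R..R}" for k
    have Sm [measurable]: "S k \<in> sets borel" for k by (simp add: S_def)
    \<comment> \<open>Each edge loses \<open>2 * e'\<close>, once for \<open>u\<close> and once for
      \<open>v\<close>; the added 1 keeps the denominator positive.\<close>
    define e' where "e' = e / (2 * (real (card I) + 1))"
    have e': "e' > 0" "real (card I) * (2 * e') \<le> e" using e by (auto simp: e'_def field_simps)
    define near where "near k s \<longleftrightarrow> \<bar>LINT x|lebesgue_on (S k). \<bar>u k (x, s) - u k (x, t)\<bar>\<bar> < e' \<and> \<bar>LINT x|lebesgue_on (S k). \<bar>v k (x, s) - v k (x, t)\<bar>\<bar> < e'" for k s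
    have "\<forall>k\<in>I. \<exists>\<delta>>0. AE s in lborel. 0 < s \<longrightarrow> \<bar>s - t\<bar> < \<delta> \<longrightarrow> near k s"
    proof
      fix k assume k: "k \<in> I"
      have "ess_lim (\<lambda>s. LINT x|lebesgue_on (S k). \<bar>u k (x, s) - u k (x, t)\<bar>) {0<..} t 0"
        using tu k R by (auto simp: time_value_attained_def S_def)
      then obtain d1 where d1: "d1 > 0" "AE s in lborel. s \<in> {0<..} \<longrightarrow> \<bar>s - t\<bar> < d1 \<longrightarrow> \<bar>(LINT x|lebesgue_on (S k). \<bar>u k (x, s) - u k (x, t)\<bar>) - 0\<bar> < e'"
        using e'(1) unfolding ess_lim_def by (subst (asm) AE_lebesgue_on_iff) auto
      have "ess_lim (\<lambda>s. LINT x|lebesgue_on (S k). \<bar>v k (x, s) - v k (x, t)\<bar>) {0<..} t 0"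
        using tv k R by (auto simp: time_value_attained_def S_def)
      then obtain d2 where d2: "d2 > 0" "AE s in lborel. s \<in> {0<..} \<longrightarrow> \<bar>s - t\<bar> < d2 \<longrightarrow> \<bar>(LINT x|lebesgue_on (S k). \<bar>v k (x, s) - v k (x, t)\<bar>) - 0\<bar> < e'"
        using e'(1) unfolding ess_lim_def by (subst (asm) AE_lebesgue_on_iff) auto
      have "AE s in lborel. 0 < s \<longrightarrow> \<bar>s - t\<bar> < min d1 d2 \<longrightarrow> near k s"
        using d1(2) d2(2) by eventually_elim (simp add: near_def)
      with d1(1) d2(1) show "\<exists>\<delta>>0. AE s in lborel. 0 < s \<longrightarrow> \<bar>s - t\<bar> < \<delta> \<longrightarrow> near k s" by (intro exI[of _ "min d1 d2"]) simp
    qed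
    from bchoice[OF this] obtain \<delta> where "\<forall>k\<in>I. 0 < \<delta> k \<and> (AE s in lborel. 0 < s \<longrightarrow> \<bar>s - t\<bar> < \<delta> k \<longrightarrow> near k s)"
      by (elim exE)
    then have \<delta>: "0 < \<delta> k" "AE s in lborel. 0 < s \<longrightarrow> \<bar>s - t\<bar> < \<delta> k \<longrightarrow> near k s" if "k \<in> I" for k
      using that by simp_all
    define \<Delta> where "\<Delta> = Min (insert 1 (\<delta> ` I))"
    have \<Delta>: "\<Delta> > 0" "\<And>k. k \<in> I \<Longrightarrow> \<Delta> \<le> \<delta> k"
      unfolding \<Delta>_def using \<delta>(1) by (auto simp: Min_gr_iff)
    have "AE s in lborel. \<forall>k\<in>I. 0 < s \<longrightarrow> \<bar>s - t\<bar> < \<delta> k \<longrightarrow> near k s"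
      by (intro AE_finite_allI \<delta>(2)) simp_all
    with uU vV con have "AE s in lborel. (\<forall>k\<in>I. 0 < s \<longrightarrow> \<bar>s - t\<bar> < \<delta> k \<longrightarrow> near k s) \<and>
       (\<forall>k\<in>I. 0 < s \<longrightarrow> (AE x in lborel. x \<in> edge k \<longrightarrow> u k (x, s) = U k (x, s))) \<and>
       (\<forall>k\<in>I. 0 < s \<longrightarrow> (AE x in lborel. x \<in> edge k \<longrightarrow> v k (x, s) = V k (x, s))) \<and>
       (0 < s \<longrightarrow> (\<Sum>k\<in>I. L1_norm (edge k) (\<lambda>x. u k (x, s) - v k (x, s))) \<le> C)"
      by eventually_elim (intro conjI; assumption)
    from ex_in_interval_if_AE[OF this less_add_same_cancel1[THEN iffD2, OF \<Delta>(1)], of t] obtain s where "s \<in> {t<..<t + \<Delta>}"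
      and cl: "\<forall>k\<in>I. 0 < s \<longrightarrow> \<bar>s - t\<bar> < \<delta> k \<longrightarrow> near k s"
      and us': "\<forall>k\<in>I. 0 < s \<longrightarrow> (AE x in lborel. x \<in> edge k \<longrightarrow> u k (x, s) = U k (x, s))"
      and vs': "\<forall>k\<in>I. 0 < s \<longrightarrow> (AE x in lborel. x \<in> edge k \<longrightarrow> v k (x, s) = V k (x, s))"
      and cs': "0 < s \<longrightarrow> (\<Sum>k\<in>I. L1_norm (edge k) (\<lambda>x. u k (x, s) - v k (x, s))) \<le> C"
      by (elim bexE conjE)
    then have st: "t < s" "s < t + \<Delta>" and s0: "0 < s" using t by auto
    note close = cl[rule_format, OF _ s0] and us = us'[rule_format, OF _ s0] and vs = vs'[rule_format, OF _ s0]
      and cs = cs'[rule_format, OF s0]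
    \<comment> \<open>Closeness at \<open>s\<close> is expressed by Bochner integrals, which are 0
      for nonintegrable functions. Integrability of the slices at \<open>s\<close>, read off the
      Borel representatives, turns it into a genuine L1 bound.\<close>
    have slice: "integrable (lebesgue_on (S k)) (\<lambda>x. w k (x, s))"
      if k: "k \<in> I" and W: "bounded_borel (W k)" and ws: "AE x in lborel. x \<in> edge k \<longrightarrow> w k (x, s) = W k (x, s)"
      for k and w W :: "int \<Rightarrow> real \<times> real \<Rightarrow> real"
    proof -
      have Ws: "bounded_borel (\<lambda>x. W k (x, s))" by (rule bounded_borel_compose[OF W]) measurable
      have "AE x in lborel. x \<in> S k \<longrightarrow> w k (x, s) = W k (x, s)"
        using ws by eventually_elim (auto simp: S_def)
      from lebesgue_on_integral_eq(3)[OF Sm bounded_borel_measurable[OF Ws] this]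
      show ?thesis
        using bounded_borel_integrable[OF bounded_borel_mult[OF bounded_borel_indicator[OF Sm] Ws], of "{-R..R}" k]
        by (auto simp: S_def)
    qed
    have "L1_norm (S k) (\<lambda>x. u k (x, t) - v k (x, t)) \<le> L1_norm (edge k) (\<lambda>x. u k (x, s) - v k (x, s)) + ennreal (2 * e')"
      if k: "k \<in> I" for k
    proof -
      have d: "\<bar>s - t\<bar> < \<delta> k" using st \<Delta>(2)[OF k] by auto
      note ius = slice[where w = u and W = U, OF k U[OF k] us[OF k]] and ivs = slice[where w = v and W = V, OF k V[OF k] vs[OF k]]
      note iut = int(1)[OF k R, folded S_def] and ivt = int(2)[OF k R, folded S_def]
      have near': "(\<integral>\<^sup>+x. ennreal \<bar>w k (x, s) - w k (x, t)\<bar> \<partial>lebesgue_on (S k)) \<le> ennreal e'"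
        if "integrable (lebesgue_on (S k)) (\<lambda>x. w k (x, s))" "integrable (lebesgue_on (S k)) (\<lambda>x. w k (x, t))"
          "\<bar>LINT x|lebesgue_on (S k). \<bar>w k (x, s) - w k (x, t)\<bar>\<bar> < e'" for w :: "int \<Rightarrow> real \<times> real \<Rightarrow> real"
      proof -
        have "(\<integral>\<^sup>+x. ennreal \<bar>w k (x, s) - w k (x, t)\<bar> \<partial>lebesgue_on (S k)) = ennreal (LINT x|lebesgue_on (S k). \<bar>w k (x, s) - w k (x, t)\<bar>)"
          using that(1,2) by (intro nn_integral_eq_integral) auto
        also have "\<dots> \<le> ennreal e'" using that(3) by (intro ennreal_leI) simp
        finally show ?thesis .
      qed
      note [measurable] = borel_measurable_integrable[OF ius] borel_measurable_integrable[OF ivs]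
        borel_measurable_integrable[OF iut] borel_measurable_integrable[OF ivt]
      have "L1_norm (S k) (\<lambda>x. u k (x, t) - v k (x, t)) \<le> (\<integral>\<^sup>+x. ennreal \<bar>u k (x, s) - u k (x, t)\<bar>
          + (ennreal \<bar>u k (x, s) - v k (x, s)\<bar> + ennreal \<bar>v k (x, s) - v k (x, t)\<bar>) \<partial>lebesgue_on (S k))"
        unfolding L1_norm_def
        by (intro nn_integral_mono) (auto simp flip: ennreal_plus intro!: ennreal_leI)
      also have "\<dots> = (\<integral>\<^sup>+x. ennreal \<bar>u k (x, s) - u k (x, t)\<bar> \<partial>lebesgue_on (S k))
          + (L1_norm (S k) (\<lambda>x. u k (x, s) - v k (x, s)) + (\<integral>\<^sup>+x. ennreal \<bar>v k (x, s) - v k (x, t)\<bar> \<partial>lebesgue_on (S k)))"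
        unfolding L1_norm_def by (simp add: nn_integral_add)
      also have "\<dots> \<le> ennreal e' + (L1_norm (edge k) (\<lambda>x. u k (x, s) - v k (x, s)) + ennreal e')"
        using close[OF k d] by (intro add_mono near' L1_norm_on_mono ius ivs iut ivt) (auto simp: S_def near_def)
      also have "\<dots> = L1_norm (edge k) (\<lambda>x. u k (x, s) - v k (x, s)) + ennreal (2 * e')"
        using e'(1) by (simp add: ennreal_plus[symmetric] add.assoc add.left_commute del: ennreal_plus)
      finally show ?thesis .
    qed
    then have "(\<Sum>k\<in>I. L1_norm (S k) (\<lambda>x. u k (x, t) - v k (x, t))) \<le> (\<Sum>k\<in>I. L1_norm (edge k) (\<lambda>x. u k (x, s) - v k (x, s)) + ennreal (2 * e'))"
      by (rule sum_mono)
    also have "\<dots> = (\<Sum>k\<in>I. L1_norm (edge k) (\<lambda>x. u k (x, s) - v k (x, s))) + (\<Sum>k\<in>I. ennreal (2 * e'))"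
      by (rule sum.distrib)
    also have "(\<Sum>k\<in>I. ennreal (2 * e')) = ennreal (\<Sum>k\<in>I. 2 * e')"
      using e'(1) by (intro sum_ennreal) auto
    also have "(\<Sum>k\<in>I. L1_norm (edge k) (\<lambda>x. u k (x, s) - v k (x, s))) + ennreal (\<Sum>k\<in>I. 2 * e') \<le> C + ennreal e"
      using e'(2) by (intro add_mono cs ennreal_leI) simp
    finally show ?thesis by (simp add: S_def)
  qed
  have bounded: "(\<Sum>k\<in>I. L1_norm (edge k \<inter> {-R..R}) (\<lambda>x. u k (x, t) - v k (x, t))) \<le> C" if "R > 0" for R
    by (rule ennreal_le_epsilon) (use main[OF that] in auto)
  have "(\<lambda>n. \<Sum>k\<in>I. L1_norm (edge k \<inter> {- real (Suc n)..real (Suc n)}) (\<lambda>x. u k (x, t) - v k (x, t)))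
    \<longlonglongrightarrow> (\<Sum>k\<in>I. L1_norm (edge k) (\<lambda>x. u k (x, t) - v k (x, t)))"
  proof (intro tendsto_sum L1_norm_exhaustion borel_measurable_diff edge_measurable)
    show "(\<lambda>x. u k (x, t)) \<in> borel_measurable (lebesgue_on (edge k \<inter> {- real (Suc n)..real (Suc n)}))"
      "(\<lambda>x. v k (x, t)) \<in> borel_measurable (lebesgue_on (edge k \<inter> {- real (Suc n)..real (Suc n)}))" if "k \<in> I" for k n
      using int[OF that, of "real (Suc n)"] by (auto intro: borel_measurable_integrable)
  qed
  then show ?thesis
    by (rule LIMSEQ_le_const2) (intro exI[of _ 0] allI impI bounded, simp)
qed

end

text \<open>A class of functions determines its values in time only up to a null set, hence one
  inequality for almost every time and one at times where both representatives attain their value.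
  The norms are extended reals, so the left-hand side is finite whenever the right-hand side
  is.\<close>

theorem theorem3p1:
  fixes Nin Nout :: nat
    and f :: "int \<Rightarrow> real \<Rightarrow> real"
    and G :: "(int \<Rightarrow> real) set"
    and u v :: "int \<Rightarrow> real \<times> real \<Rightarrow> real"
    and u0 v0 :: "int \<Rightarrow> real \<Rightarrow> real"
  assumes "Nin \<ge> 1" and "Nout \<ge> 1"
    and "\<And>k. k \<in> idx Nin Nout \<Longrightarrow> continuous_on UNIV (f k)"
    and "maximal_consistent Nin Nout f G"
    and "u0 \<in> Linf_oco Nin Nout G"
    and "\<And>k. k \<in> idx Nin Nout \<Longrightarrow> integrable (lebesgue_on (edge k)) (u0 k)"
    and "v0 \<in> Linf_oco Nin Nout G"
    and "\<And>k. k \<in> idx Nin Nout \<Longrightarrow> integrable (lebesgue_on (edge k)) (v0 k)"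
    and "entropy_solution Nin Nout f G u0 u"
    and "entropy_solution Nin Nout f G v0 v"
    and "\<And>k. k \<in> idx Nin Nout \<Longrightarrow> has_strong_trace k (u k)"
    and "\<And>k. k \<in> idx Nin Nout \<Longrightarrow> has_strong_trace k (v k)"
  shows "(AE t in lebesgue_on {0<..}.
            (\<Sum>k\<in>idx Nin Nout. L1_norm (edge k) (\<lambda>x. u k (x, t) - v k (x, t)))
              \<le> (\<Sum>k\<in>idx Nin Nout. L1_norm (edge k) (\<lambda>x. u0 k x - v0 k x)))
       \<and> (\<forall>t>0. time_value_attained Nin Nout u t \<and> time_value_attained Nin Nout v t \<longrightarrow>
            (\<Sum>k\<in>idx Nin Nout. L1_norm (edge k) (\<lambda>x. u k (x, t) - v k (x, t)))
              \<le> (\<Sum>k\<in>idx Nin Nout. L1_norm (edge k) (\<lambda>x. u0 k x - v0 k x)))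
       \<and> ((\<forall>k\<in>idx Nin Nout. AE x in lebesgue_on (edge k). u0 k x = v0 k x) \<longrightarrow>
            (\<forall>k\<in>idx Nin Nout. AE p in lebesgue_on (edge k \<times> {0<..}). u k p = v k p))"
proof -
  interpret network Nin Nout f G
    by (rule network.intro) (use assms(3,4) in auto)
  obtain U tr c d where rU: "representative U tr c d"
    and eqU: "\<And>k. k \<in> I \<Longrightarrow> AE p in lborel. p \<in> edge k \<times> {0<..} \<longrightarrow> u k p = U k p"
    and eqU0: "\<And>k. k \<in> I \<Longrightarrow> AE x in lborel. x \<in> edge k \<longrightarrow> u0 k x = U k (x, 0)"
    by (rule entropy_solution_representative[OF assms(9,5,11)], assumption, rule that)
  obtain V tr' c' d' where rV: "representative V tr' c' d'"
    and eqV: "\<And>k. k \<in> I \<Longrightarrow> AE p in lborel. p \<in> edge k \<times> {0<..} \<longrightarrow> v k p = V k p"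
    and eqV0: "\<And>k. k \<in> I \<Longrightarrow> AE x in lborel. x \<in> edge k \<longrightarrow> v0 k x = V k (x, 0)"
    by (rule entropy_solution_representative[OF assms(10,7,12)], assumption, rule that)
  note bU = representativeD(11)[OF rU] and bV = representativeD(11)[OF rV]
  have meas: "(\<lambda>x. U k (x, t) - V k (x, t)) \<in> borel_measurable borel" if "k \<in> I" for k t
  proof -
    note [measurable] = bounded_borel_measurable[OF bU[OF that]] bounded_borel_measurable[OF bV[OF that]]
    show ?thesis by measurable
  qed
  define C where "C = (\<Sum>k\<in>I. L1_norm (edge k) (\<lambda>x. u0 k x - v0 k x))"
  define W where "W t = (\<integral>\<^sup>+x. ennreal (\<Sum>k\<in>I. indicator (edge k) x * \<bar>U k (x, t) - V k (x, t)\<bar>) \<partial>lborel)" for t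
  have C: "C = W 0"
    unfolding C_def W_def
  proof (rule sum_L1_norm_eq[OF meas])
    show "AE x in lborel. x \<in> edge k \<longrightarrow> u0 k x - v0 k x = U k (x, 0) - V k (x, 0)" if "k \<in> I" for k
      using eqU0[OF that] eqV0[OF that] by eventually_elim auto
  qed
  have WC: "AE t in lborel. 0 < t \<longrightarrow> W t \<le> C"
    unfolding C unfolding W_def by (rule contraction_representatives[OF rU rV])
  have uU: "AE t in lborel. \<forall>k\<in>I. 0 < t \<longrightarrow> (AE x in lborel. x \<in> edge k \<longrightarrow> u k (x, t) = U k (x, t))"
  proof (intro AE_finite_allI finite_I)
    show "AE t in lborel. 0 < t \<longrightarrow> (AE x in lborel. x \<in> edge k \<longrightarrow> u k (x, t) = U k (x, t))" if "k \<in> I" for k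
      using AE_lborel_swap(2)[OF eqU[OF that]]
    proof eventually_elim
      case (elim t)
      show ?case
      proof
        assume "0 < t"
        from elim show "AE x in lborel. x \<in> edge k \<longrightarrow> u k (x, t) = U k (x, t)"
          by (rule eventually_mono) (use \<open>0 < t\<close> in auto)
      qed
    qed
  qed
  have vV: "AE t in lborel. \<forall>k\<in>I. 0 < t \<longrightarrow> (AE x in lborel. x \<in> edge k \<longrightarrow> v k (x, t) = V k (x, t))"
  proof (intro AE_finite_allI finite_I)
    show "AE t in lborel. 0 < t \<longrightarrow> (AE x in lborel. x \<in> edge k \<longrightarrow> v k (x, t) = V k (x, t))" if "k \<in> I" for k
      using AE_lborel_swap(2)[OF eqV[OF that]]
    proof eventually_elim
      case (elim t)
      show ?case
      proof
        assume "0 < t"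
        from elim show "AE x in lborel. x \<in> edge k \<longrightarrow> v k (x, t) = V k (x, t)"
          by (rule eventually_mono) (use \<open>0 < t\<close> in auto)
      qed
    qed
  qed
  have con: "AE t in lborel. 0 < t \<longrightarrow> (\<Sum>k\<in>I. L1_norm (edge k) (\<lambda>x. u k (x, t) - v k (x, t))) \<le> C"
    using WC uU vV
  proof eventually_elim
    case (elim t)
    show ?case
    proof
      assume t: "0 < t"
      have "(\<Sum>k\<in>I. L1_norm (edge k) (\<lambda>x. u k (x, t) - v k (x, t))) = W t"
        unfolding W_def
      proof (rule sum_L1_norm_eq[OF meas])
        fix k assume k: "k \<in> I"
        have "AE x in lborel. x \<in> edge k \<longrightarrow> u k (x, t) = U k (x, t)" "AE x in lborel. x \<in> edge k \<longrightarrow> v k (x, t) = V k (x, t)"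
          using elim(2,3) k t by blast+
        then show "AE x in lborel. x \<in> edge k \<longrightarrow> u k (x, t) - v k (x, t) = U k (x, t) - V k (x, t)"
          by eventually_elim auto
      qed
      then show "(\<Sum>k\<in>I. L1_norm (edge k) (\<lambda>x. u k (x, t) - v k (x, t))) \<le> C" using elim(1) t by simp
    qed
  qed
  have part1: "AE t in lebesgue_on {0<..}. (\<Sum>k\<in>I. L1_norm (edge k) (\<lambda>x. u k (x, t) - v k (x, t))) \<le> C"
    using con by (subst AE_lebesgue_on_iff) auto
  have part2: "(\<Sum>k\<in>I. L1_norm (edge k) (\<lambda>x. u k (x, t) - v k (x, t))) \<le> C"
    if "t > 0" "time_value_attained Nin Nout u t" "time_value_attained Nin Nout v t" for t
    by (rule time_value_contraction[OF that bU bV uU vV con])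
  have part3: "AE p in lebesgue_on (edge k \<times> {0<..}). u k p = v k p"
    if 0: "\<forall>k\<in>I. AE x in lebesgue_on (edge k). u0 k x = v0 k x" and k: "k \<in> I" for k
  proof -
    have "C = 0"
      unfolding C_def
    proof (intro sum.neutral ballI)
      fix k assume "k \<in> I"
      with 0 have "AE x in lebesgue_on (edge k). u0 k x = v0 k x" by blast
      then have "L1_norm (edge k) (\<lambda>x. u0 k x - v0 k x) = (\<integral>\<^sup>+x. 0 \<partial>lebesgue_on (edge k))"
        unfolding L1_norm_def by (intro nn_integral_cong_AE, eventually_elim) simp
      then show "L1_norm (edge k) (\<lambda>x. u0 k x - v0 k x) = 0" by simp
    qed
    then have W0: "AE t in lborel. 0 < t \<longrightarrow> W t = 0" using WC by simp
    \<comment> \<open>By Fubini the integral of \<open>D\<close> over the plane is that of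
      \<open>W\<close> over positive times, hence 0; being nonnegative, \<open>D\<close> vanishes
      almost everywhere.\<close>
    define D where "D p = future (snd p) * (\<Sum>k\<in>I. indicator (edge k) (fst p) * \<bar>U k p - V k p\<bar>)" for p
    have bD: "bounded_borel D"
      unfolding D_def
      by (intro bounded_borel_mult future_snd_bounded_borel bounded_borel_sum finite_I edge_bounded_borel bounded_borel_abs_diff bU bV)
    have Dm: "(\<lambda>p. ennreal (D p)) \<in> borel_measurable lborel"
      using bounded_borel_measurable[OF bD] by simp
    have "(\<integral>\<^sup>+p. ennreal (D p) \<partial>lborel) = (\<integral>\<^sup>+t. (\<integral>\<^sup>+x. ennreal (D (x, t)) \<partial>lborel) \<partial>lborel)"
      using lborel_pair.nn_integral_snd[of "\<lambda>p. ennreal (D p)"] Dm by (simp add: lborel_prod)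
    also have "\<dots> = (\<integral>\<^sup>+t. 0 \<partial>(lborel :: real measure))"
    proof (rule nn_integral_cong_AE, use W0 in eventually_elim)
      case (elim t)
      then show ?case by (cases "0 < t") (simp_all add: D_def W_def)
    qed
    also have "\<dots> = 0" by simp
    finally have "AE p in lborel. ennreal (D p) = 0"
      using Dm by (subst (asm) nn_integral_0_iff_AE) auto
    then have "AE p in lborel. p \<in> edge k \<times> {0<..} \<longrightarrow> u k p = v k p"
      using eqU[OF k] eqV[OF k]
    proof eventually_elim
      case (elim p)
      show ?case
      proof
        assume p: "p \<in> edge k \<times> {0<..}"
        have "(\<Sum>k\<in>I. indicator (edge k) (fst p) * \<bar>U k p - V k p\<bar>) = 0"
        proof (rule antisym)
          show "(\<Sum>k\<in>I. indicator (edge k) (fst p) * \<bar>U k p - V k p\<bar>) \<le> 0"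
            using elim(1) p by (auto simp: D_def ennreal_eq_0_iff)
        qed (auto intro: sum_nonneg)
        then have "indicator (edge k) (fst p) * \<bar>U k p - V k p\<bar> = 0"
          using k by (subst (asm) sum_nonneg_eq_0_iff) auto
        then show "u k p = v k p" using elim(2,3) p by auto
      qed
    qed
    then show ?thesis by (subst AE_lebesgue_on_iff[OF edge_future_measurable])
  qed
  show ?thesis
    using part1 part2 part3 unfolding C_def by blast
qed

end
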